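(* Let $p\ge 3$ be a prime and let $G$ be a non-abelian $p$-group of order $p^n$ with cyclic center. Then \[ c(G)=\mu(G)\in\{p^2,p^3,\ldots,p^{n-1}\}. \] Moreover, for every $n\ge 3$ and every $i\in\{2,\ldots,n-1\}$, there exists a $p$-group $G_i$ of order $p^n$, for some prime $p$, such that $\mu(G_i)=p^i$.
   Context: For a finite group $G$, $\mu(G)$ denotes the minimal faithful permutation degree of $G$: the least positive integer $n$ such that $G$ is isomorphic to a subgroup of the symmetric group $S_n$. A quasi-permutation matrix is a square matrix over $\mathbb{C}$ with non-negative integral trace. $c(G)$ denotes the minimal degree of a faithful representation of $G$ by complex quasi-permutation matrices, i.e. the least $n$ such that there is an injective homomorphism $G\to \mathrm{GL}_n(\mathbb{C})$ all of whose image elements have non-negative integer trace. *)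

theory Defs
  imports
    "HOL-Algebra.Sym_Groups"
    "HOL-Algebra.Elementary_Groups"
    "Jordan_Normal_Form.Matrix"
begin

definition group_center :: "('a, 'b) monoid_scheme \<Rightarrow> 'a set" where
  "group_center G = {z \<in> carrier G. \<forall>x \<in> carrier G. z \<otimes>\<^bsub>G\<^esub> x = x \<otimes>\<^bsub>G\<^esub> z}"

definition min_perm_degree :: "('a, 'b) monoid_scheme \<Rightarrow> nat" where
  "min_perm_degree G =
     (LEAST n. 0 < n \<and> (\<exists>H. subgroup H (sym_group n) \<and> G \<cong> (sym_group n)\<lparr>carrier := H\<rparr>))"

definition mat_trace :: "'a::comm_monoid_add mat \<Rightarrow> 'a" where
  "mat_trace A = (\<Sum>i<dim_row A. A $$ (i, i))"

definition quasi_permutation_mat :: "complex mat \<Rightarrow> bool" where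
  "quasi_permutation_mat A \<longleftrightarrow> square_mat A \<and> mat_trace A \<in> \<nat>"

definition complex_GL :: "nat \<Rightarrow> complex mat monoid" where
  "complex_GL n = units_of (ring_mat TYPE(complex) n ())"

text \<open>The degree of a representation is taken to be positive, so that the trivial group has
  degree \<open>1\<close> here, as it does for \<^const>\<open>min_perm_degree\<close>.\<close>

definition min_quasi_perm_degree :: "('a, 'b) monoid_scheme \<Rightarrow> nat" where
  "min_quasi_perm_degree G =
     (LEAST n. 0 < n \<and>
        (\<exists>\<rho> \<in> hom G (complex_GL n). inj_on \<rho> (carrier G) \<and>
           (\<forall>g \<in> carrier G. quasi_permutation_mat (\<rho> g))))"

end

theory Submission
  imports Defs "HOL-Algebra.Sylow" "HOL-Algebra.Group_Action" "HOL-Algebra.Multiplicative_Group"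
    "HOL-Number_Theory.Residues" "Jordan_Normal_Form.Schur_Decomposition"
begin

text \<open>
Let \<open>z\<close> be a central element of order \<open>p\<close>. The center is cyclic, so every nontrivial normal
subgroup of \<open>G\<close> contains \<open>z\<close>, and a subgroup \<open>L\<close> has trivial core as soon as \<open>z \<notin> L\<close>. Hence
\<open>\<mu>(G) \<le> [G : L]\<close> for all these \<open>L\<close>, while \<open>c(G) \<le> \<mu>(G)\<close> because permutation matrices are
quasi-permutation matrices. The equality of the two degrees therefore follows from one statement
(\<open>quasi_perm_rep_subgroup\<close>): a faithful representation of degree \<open>d\<close> by quasi-permutation matrices
yields a subgroup \<open>L\<close> with \<open>z \<notin> L\<close> and \<open>[G : L] \<le> d\<close>. Then \<open>c(G) = \<mu>(G) = [G : L]\<close>, a power of \<open>p\<close>.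

To find \<open>L\<close>, take an eigenvalue \<open>\<zeta> \<noteq> 1\<close> of \<open>z\<close>, with eigenspace \<open>W\<close> of dimension \<open>t\<close>. All traces are
rational, so conjugate eigenvalues of \<open>z\<close> have equal multiplicity and \<open>d = p t + tr z \<ge> p t\<close>. On \<open>W\<close> the
group acts with traces in \<open>\<rat>(\<zeta>)\<close> and \<open>z\<close> acts as the scalar \<open>\<zeta>\<close>; the claim becomes
\<open>[G : L] \<le> p t\<close> for some \<open>L\<close> avoiding \<open>z\<close> (\<open>representation_degree_bound\<close>). It is proved by induction
on the order of the image of \<open>G\<close>.

  \<^item> If the image is cyclic of order \<open>p ^ k\<close>, an element outside \<open>\<langle>z\<rangle>\<close> has as trace a sum of primitive
    \<open>p ^ j\<close>-th roots of unity with \<open>j \<ge> 2\<close>. Such a sum lies in \<open>\<rat>(\<zeta>)\<close> only if it vanishes, because the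
    cyclotomic polynomial is irreducible (\<open>sum_primitive_roots_eq_0\<close>). So the multiplicity of an
    eigenvalue of a generator is \<open>p t / p ^ k\<close>, a positive integer, and the kernel serves as \<open>L\<close>.
  \<^item> If the image is not cyclic, then, \<open>p\<close> being odd, it has a normal subgroup \<open>\<langle>z, w\<rangle>\<close> which is
    elementary abelian of order \<open>p ^ 2\<close> (\<open>noncyclic_p_group_normal_rank_two\<close>). The centralizer of \<open>w\<close> has
    index \<open>1\<close> or \<open>p\<close> and acts on an eigenspace \<open>W'\<close> of \<open>w\<close>. If the index is \<open>p\<close>, the eigenspaces are
    permuted transitively and \<open>dim W' = t / p\<close>. In both cases \<open>[G : C(w)] dim W' \<le> t\<close>, and the induction
    hypothesis applies to \<open>C(w)\<close> and \<open>W'\<close>, on which some element of \<open>w \<langle>z\<rangle>\<close> acts trivially.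

Throughout, a subspace is given by an idempotent matrix with this image; its trace is the dimension.

The bounds for the exponent are elementary: if \<open>\<mu>(G)\<close> divides \<open>p\<close>, then \<open>p ^ n\<close> divides \<open>p!\<close> and \<open>G\<close> is
abelian; and \<open>G\<close> is not cyclic, so it contains itself an element \<open>w\<close> as above, which generates a subgroup of order
\<open>p\<close> that avoids \<open>z\<close>.

For the second part let \<open>p \<ge> n\<close>. The symmetric group on \<open>p ^ i\<close> points has order divisible by \<open>p ^ n\<close> when
\<open>i \<ge> 2\<close>, so the subgroup generated by a cycle of length \<open>p ^ i\<close> extends to a subgroup of order \<open>p ^ n\<close>.
A permutation of order \<open>p ^ i\<close> moves at least \<open>p ^ i\<close> points.
\<close>

section \<open>Fixed points of actions of p-groups\<close>

lemma finite_carrier_if_prime_power_order: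
  "prime (p::nat) \<Longrightarrow> Coset.order G = p ^ k \<Longrightarrow> finite (carrier G)"
  by (metis Coset.order_def card.infinite not_prime_0 power_not_zero)

text \<open>
Restricting the maps to \<open>E\<close> turns an action by arbitrary functions into one by the extensional bijections
that \<^const>\<open>BijGroup\<close> consists of.
\<close>

lemma group_actionI:
  fixes G (structure)
  assumes "group G"
    and closed: "\<And>g x. g \<in> carrier G \<Longrightarrow> x \<in> E \<Longrightarrow> act g x \<in> E"
    and one: "\<And>x. x \<in> E \<Longrightarrow> act \<one>\<^bsub>G\<^esub> x = x"
    and mult: "\<And>g h x. g \<in> carrier G \<Longrightarrow> h \<in> carrier G \<Longrightarrow> x \<in> E \<Longrightarrow>
      act (g \<otimes>\<^bsub>G\<^esub> h) x = act g (act h x)"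
  shows "group_action G E (\<lambda>g. restrict (act g) E)"
proof -
  interpret group G by fact
  have bij: "restrict (act g) E \<in> Bij E" if g: "g \<in> carrier G" for g
  proof -
    have "bij_betw (act g) E E"
      by (rule bij_betw_byWitness[where f' = "act (inv g)"])
        (use g closed mult[symmetric] one in auto)
    then show ?thesis
      by (simp add: Bij_def cong: bij_betw_cong)
  qed
  show ?thesis
    unfolding group_action_def
  proof (intro group_hom.intro group_hom_axioms.intro homI)
    show "group (BijGroup E)" by (rule group_BijGroup)
    fix g h assume gh: "g \<in> carrier G" "h \<in> carrier G"
    then show "restrict (act (g \<otimes> h)) E = restrict (act g) E \<otimes>\<^bsub>BijGroup E\<^esub> restrict (act h) E"
      using bij by (auto simp: BijGroup_def compose_def fun_eq_iff mult closed)
  qed (use bij in \<open>auto simp: BijGroup_def is_group\<close>)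
qed

text \<open>
The size of an orbit divides the order of the group, so the orbits that are not fixed points have sizes
divisible by \<open>p\<close>.
\<close>

lemma p_group_card_fixed_points:
  fixes G (structure)
  assumes G: "group G" and p: "prime (p::nat)" and card: "Coset.order G = p ^ k"
    and E: "finite E"
    and closed: "\<And>g x. g \<in> carrier G \<Longrightarrow> x \<in> E \<Longrightarrow> act g x \<in> E"
    and one: "\<And>x. x \<in> E \<Longrightarrow> act \<one>\<^bsub>G\<^esub> x = x"
    and mult: "\<And>g h x. g \<in> carrier G \<Longrightarrow> h \<in> carrier G \<Longrightarrow> x \<in> E \<Longrightarrow>
      act (g \<otimes>\<^bsub>G\<^esub> h) x = act g (act h x)"
  shows "p dvd card E \<longleftrightarrow> p dvd card {x \<in> E. \<forall>g \<in> carrier G. act g x = x}"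
proof -
  let ?\<phi> = "\<lambda>g. restrict (act g) E"
  let ?F = "{x \<in> E. \<forall>g \<in> carrier G. act g x = x}"
  let ?O = "orbits G E ?\<phi>"
  interpret group_action G E ?\<phi>
    by (rule group_actionI[OF G]) (use assms in auto)
  have finG: "finite (carrier G)"
    by (rule finite_carrier_if_prime_power_order[OF p card])
  have finO: "finite ?O"
    using E unfolding orbits_def by auto
  have sub: "X \<subseteq> E" if "X \<in> ?O" for X
    using that orbits_coverture by blast
  have fixed: "?F \<inter> X = (if card X = 1 then X else {})" if X: "X \<in> ?O" for X
  proof -
    obtain x where x: "x \<in> E" "X = orbit G ?\<phi> x"
      using X unfolding orbits_def by auto
    have orb: "X = {act g x | g. g \<in> carrier G}"
      using x unfolding orbit_def by auto
    show ?thesis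
    proof (cases "card X = 1")
      case True
      then obtain y where y: "X = {y}"
        by (auto simp: card_1_singleton_iff)
      then have "y = x" using orbit_refl[OF x(1)] x by auto
      then have "act g x = x" if "g \<in> carrier G" for g
        using that y orb by auto
      then show ?thesis using True y \<open>y = x\<close> x by auto
    next
      case False
      have "y \<notin> ?F" if yX: "y \<in> X" for y
      proof
        assume y: "y \<in> ?F"
        obtain g where g: "g \<in> carrier G" "y = act g x"
          using yX orb by auto
        interpret G: group G by (rule G)
        have "x = act (inv\<^bsub>G\<^esub> g) y"
          using g x one mult[of "inv\<^bsub>G\<^esub> g" g x] by simp
        also have "\<dots> = y" using y g by auto
        finally have "y = x" by simp
        then have "X = {x}" using y orb x orbit_refl[OF x(1)] by auto
        then show False using False by simp
      qed
      then show ?thesis using False by auto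
    qed
  qed
  have dvd: "p dvd card X" if X: "X \<in> ?O" "card X \<noteq> 1" for X
  proof -
    obtain x where x: "x \<in> E" "X = orbit G ?\<phi> x"
      using X unfolding orbits_def by auto
    have "card X * card (stabilizer G ?\<phi> x) = p ^ k"
      using orbit_stabilizer_theorem[OF x(1)] x(2) card by simp
    then have "card X dvd p ^ k" by (metis dvd_triv_left)
    then obtain j where "card X = p ^ j"
      using p divides_primepow_nat by blast
    then show ?thesis using X(2) by (cases j) auto
  qed
  have disj: "disjoint ?O"
    unfolding disjoint_def using disjoint_union by blast
  have "card E = (\<Sum>X\<in>?O. card X)"
    using card_Union_disjoint[OF disj] orbits_coverture sub E
    by (metis finite_subset)
  also have "\<dots> = (\<Sum>X\<in>?O. card (?F \<inter> X)) + (\<Sum>X\<in>?O. if card X = 1 then 0 else card X)"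
    by (subst sum.distrib[symmetric], rule sum.cong) (auto simp: fixed)
  also have "(\<Sum>X\<in>?O. card (?F \<inter> X)) = card ?F"
  proof -
    have "card ?F = card (\<Union>X\<in>?O. ?F \<inter> X)"
      using orbits_coverture by (intro arg_cong[of _ _ card]) blast
    also have "\<dots> = (\<Sum>X\<in>?O. card (?F \<inter> X))"
    proof (rule card_UN_disjoint[OF finO])
      show "\<forall>X\<in>?O. finite (?F \<inter> X)" using E by auto
      show "\<forall>X\<in>?O. \<forall>Y\<in>?O. X \<noteq> Y \<longrightarrow> (?F \<inter> X) \<inter> (?F \<inter> Y) = {}"
        using disjoint_union by blast
    qed
    finally show ?thesis by simp
  qed
  finally have "card E = card ?F + (\<Sum>X\<in>?O. if card X = 1 then 0 else card X)" .
  moreover have "p dvd (\<Sum>X\<in>?O. if card X = 1 then 0 else card X)"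
    by (rule dvd_sum) (use dvd in auto)
  ultimately show ?thesis
    by (simp add: dvd_add_left_iff)
qed

text \<open>
The group acts on \<open>M\<close> by conjugation and fixes \<open>\<one>\<close>, so the number of fixed points is a positive multiple
of \<open>p\<close>. The fixed points are the central elements of \<open>M\<close>.
\<close>

lemma normal_subgroup_meets_center:
  fixes G (structure)
  assumes G: "group G" and p: "prime (p::nat)" and card: "Coset.order G = p ^ k"
    and M: "M \<lhd> G" and nontriv: "M \<noteq> {\<one>\<^bsub>G\<^esub>}"
  shows "\<exists>x \<in> M \<inter> group_center G. x \<noteq> \<one>\<^bsub>G\<^esub>"
proof -
  interpret group G by fact
  interpret M: normal M G by fact
  have finG: "finite (carrier G)"
    by (rule finite_carrier_if_prime_power_order[OF p card])
  have finM: "finite M" using finG M.subset finite_subset by blast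
  let ?F = "{x \<in> M. \<forall>g \<in> carrier G. g \<otimes> x \<otimes> inv g = x}"
  have M1: "\<one> \<in> M" by simp
  have "card M dvd p ^ k"
    using lagrange[OF M.subgroup_axioms] card by (metis dvd_triv_right)
  then obtain j where "card M = p ^ j"
    using p divides_primepow_nat by blast
  moreover have "card M \<noteq> 1"
    using nontriv M1 by (metis card_1_singletonE singletonD)
  ultimately have "p dvd card M" by (cases j) auto
  moreover have "p dvd card M \<longleftrightarrow> p dvd card ?F"
  proof (rule p_group_card_fixed_points[OF G p card finM, where act = "\<lambda>g x. g \<otimes> x \<otimes> inv g"])
    fix g h x assume gh: "g \<in> carrier G" "h \<in> carrier G" and "x \<in> M"
    then have "x \<in> carrier G" by auto
    then show "g \<otimes> h \<otimes> x \<otimes> inv (g \<otimes> h) = g \<otimes> (h \<otimes> x \<otimes> inv h) \<otimes> inv g"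
      using gh by (simp add: inv_mult_group m_assoc)
  qed (auto intro: M.inv_op_closed2)
  ultimately have "p dvd card ?F" by simp
  moreover have "\<one> \<in> ?F" using M1 by auto
  moreover have "\<not> p dvd card {\<one>}" using p by (simp add: prime_nat_iff)
  ultimately have "?F \<noteq> {\<one>}" by metis
  then obtain x where x: "x \<in> M" "\<forall>g \<in> carrier G. g \<otimes> x \<otimes> inv g = x" "x \<noteq> \<one>"
    using \<open>\<one> \<in> ?F\<close> by auto
  then have xG: "x \<in> carrier G" by auto
  have "x \<otimes> g = g \<otimes> x" if "g \<in> carrier G" for g
    using x(2) that xG by (metis inv_solve_right m_closed)
  then show ?thesis
    using x xG unfolding group_center_def by auto
qed

lemma normal_subgroup_meets_center_order_p:
  fixes G (structure)
  assumes G: "group G" and p: "prime (p::nat)" and card: "Coset.order G = p ^ k"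
    and M: "M \<lhd> G" and nontriv: "M \<noteq> {\<one>\<^bsub>G\<^esub>}"
  shows "\<exists>x \<in> M \<inter> group_center G. x \<noteq> \<one>\<^bsub>G\<^esub> \<and> x [^] p = \<one>"
proof -
  interpret group G by fact
  interpret M: normal M G by fact
  obtain x where x: "x \<in> M" "x \<in> group_center G" "x \<noteq> \<one>"
    using normal_subgroup_meets_center[OF assms] by auto
  then have xG: "x \<in> carrier G" by auto
  have "ord x dvd p ^ k" using ord_dvd_group_order[OF xG] card by simp
  then obtain j where j: "ord x = p ^ j" using p divides_primepow_nat by blast
  have "ord x \<noteq> 1" using x ord_eq_1[OF xG] by simp
  then have "j \<noteq> 0" using j by (cases j) auto
  then obtain i where i: "j = Suc i" by (cases j) auto
  let ?y = "x [^] (p ^ i)"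
  have "?y [^] p = \<one>"
    using j i xG by (simp add: nat_pow_pow mult.commute pow_eq_id)
  moreover have "?y \<noteq> \<one>"
    using j i xG p by (auto simp: pow_eq_id dest!: dvd_imp_le simp: prime_gt_0_nat prime_gt_1_nat)
  moreover have "x [^] n \<in> M" for n :: nat using x(1) by (induction n) auto
  then have "?y \<in> M" .
  moreover have "?y \<in> group_center G"
  proof -
    have "?y \<otimes> g = g \<otimes> ?y" if "g \<in> carrier G" for g
      using that x xG group_commutes_pow[of x g] by (auto simp: group_center_def)
    then show ?thesis using xG by (auto simp: group_center_def)
  qed
  ultimately show ?thesis by blast
qed

lemma (in group) coset_eq_iff:
  assumes S: "subgroup S G" and x: "x \<in> carrier G" and y: "y \<in> carrier G"
  shows "S #> x = S #> y \<longleftrightarrow> x \<otimes> inv y \<in> S"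
proof
  interpret S: subgroup S G by fact
  assume "S #> x = S #> y"
  then have "x \<in> S #> y" using rcos_self[OF x S] by simp
  then show "x \<otimes> inv y \<in> S" using S.rcos_module_imp[OF is_group y] by simp
next
  interpret S: subgroup S G by fact
  assume "x \<otimes> inv y \<in> S"
  then have "x \<in> S #> y" using S.rcos_module_rev[OF is_group y x] by simp
  then show "S #> x = S #> y" using repr_independence[OF _ y S] by simp
qed

text \<open>
Let \<open>S\<close> act on its right cosets by translation. The fixed cosets are those contained in the normalizer \<open>N\<close>
of \<open>S\<close>, so \<open>p\<close> divides the order of \<open>N / S\<close>. The union of the cosets in a subgroup of \<open>N / S\<close> of order \<open>p\<close>
is the required subgroup.
\<close>

lemma p_subgroup_extend_once:
  fixes G (structure)
  assumes G: "group G" and fin: "finite (carrier G)" and p: "prime (p::nat)"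
    and S: "subgroup S G" and card: "card S = p ^ k" and dvd: "p ^ Suc k dvd Coset.order G"
  shows "\<exists>T. subgroup T G \<and> card T = p ^ Suc k \<and> S \<subseteq> T"
proof -
  interpret group G by fact
  interpret S: subgroup S G by fact
  let ?E = "rcosets S"
  define N where "N = {g \<in> carrier G. \<forall>s\<in>S. g \<otimes> s \<otimes> inv g \<in> S}"
  have finS: "finite S" using fin S.subset finite_subset by blast
  have finE: "finite ?E" using fin rcosets_finite S.subset
    by (simp add: RCOSETS_def)
  have N_image: "(\<lambda>s. g \<otimes> s \<otimes> inv g) ` S = S" if g: "g \<in> N" for g
  proof -
    have inj: "inj_on (\<lambda>s. g \<otimes> s \<otimes> inv g) S"
      using g by (auto simp: N_def inj_on_def)
    show ?thesis
      by (rule endo_inj_surj[OF finS _ inj]) (use g in \<open>auto simp: N_def\<close>)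
  qed
  have N_inv: "inv g \<otimes> s \<otimes> g \<in> S" if g: "g \<in> N" and s: "s \<in> S" for g s
  proof -
    obtain t where t: "t \<in> S" "s = g \<otimes> t \<otimes> inv g"
      using N_image[OF g] s by auto
    have "g \<in> carrier G" "t \<in> carrier G" using g t by (auto simp: N_def)
    then have "inv g \<otimes> s \<otimes> g = (inv g \<otimes> g) \<otimes> t \<otimes> (inv g \<otimes> g)"
      unfolding t(2) by (simp only: m_assoc m_closed inv_closed)
    also have "\<dots> = t" using \<open>g \<in> carrier G\<close> \<open>t \<in> carrier G\<close> by simp
    finally have "inv g \<otimes> s \<otimes> g = t" .
    then show ?thesis using t by simp
  qed
  have subN: "subgroup N G"
  proof (rule subgroupI)
    show "N \<noteq> {}" by (auto simp: N_def intro!: exI[of _ "\<one>"])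
    fix g assume g: "g \<in> N"
    then show "inv g \<in> N" using N_inv[OF g] by (auto simp: N_def)
    fix h assume h: "h \<in> N"
    have "g \<otimes> h \<otimes> s \<otimes> inv (g \<otimes> h) = g \<otimes> (h \<otimes> s \<otimes> inv h) \<otimes> inv g" if "s \<in> S" for s
      using g h that by (simp add: N_def inv_mult_group m_assoc)
    then show "g \<otimes> h \<in> N" using g h by (auto simp: N_def)
  qed (auto simp: N_def)
  let ?N = "G\<lparr>carrier := N\<rparr>"
  have grpN: "group ?N" by (rule subgroup.subgroup_is_group[OF subN G])
  have SN: "S \<subseteq> N" by (auto simp: N_def)
  have normal: "S \<lhd> ?N"
  proof -
    interpret N: group ?N by (rule grpN)
    have "subgroup S ?N" using subgroup_incl[OF S subN SN] .
    moreover have "x \<otimes> h \<otimes> inv\<^bsub>?N\<^esub> x \<in> S" if "x \<in> N" "h \<in> S" for x h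
      using that m_inv_consistent[OF subN] by (auto simp: N_def)
    ultimately show ?thesis
      by (intro N.normal_invI) auto
  qed
  have "p dvd card ?E \<longleftrightarrow> p dvd card {X \<in> ?E. \<forall>s \<in> carrier (G\<lparr>carrier := S\<rparr>). X #> inv s = X}"
  proof (rule p_group_card_fixed_points[OF _ p _ finE])
    show "group (G\<lparr>carrier := S\<rparr>)" by (rule S.subgroup_is_group[OF G])
    show "Coset.order (G\<lparr>carrier := S\<rparr>) = p ^ k" using card by (simp add: Coset.order_def)
    fix X assume X: "X \<in> ?E"
    then have Xsub: "X \<subseteq> carrier G" by (rule S.rcosets_carrier[OF G])
    show "X #> inv \<one>\<^bsub>G\<lparr>carrier := S\<rparr>\<^esub> = X" using Xsub by simp
    obtain x where x: "x \<in> carrier G" "X = S #> x" using X by (auto simp: RCOSETS_def)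
    fix s assume s: "s \<in> carrier (G\<lparr>carrier := S\<rparr>)"
    then have "X #> inv s = S #> (x \<otimes> inv s)"
      using x S.subset by (auto simp: coset_mult_assoc)
    then show "X #> inv s \<in> ?E" using x s by (auto simp: RCOSETS_def)
    fix t assume t: "t \<in> carrier (G\<lparr>carrier := S\<rparr>)"
    show "X #> inv (s \<otimes>\<^bsub>G\<lparr>carrier := S\<rparr>\<^esub> t) = X #> inv t #> inv s"
      using s t Xsub by (simp add: coset_mult_assoc inv_mult_group)
  qed
  moreover have "{X \<in> ?E. \<forall>s \<in> carrier (G\<lparr>carrier := S\<rparr>). X #> inv s = X} = carrier (?N Mod S)"
  proof -
    have *: "(\<forall>s\<in>S. S #> x #> inv s = S #> x) \<longleftrightarrow> x \<in> N" if x: "x \<in> carrier G" for x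
    proof -
      have "S #> x #> inv s = S #> x \<longleftrightarrow> x \<otimes> inv s \<otimes> inv x \<in> S" if s: "s \<in> S" for s
      proof -
        have "S #> x #> inv s = S #> (x \<otimes> inv s)"
          using x s S.subset by (auto simp: coset_mult_assoc)
        then show ?thesis
          using coset_eq_iff[OF S, of "x \<otimes> inv s" x] x s S.subset by auto
      qed
      moreover have "(\<forall>s\<in>S. x \<otimes> inv s \<otimes> inv x \<in> S) \<longleftrightarrow> (\<forall>s\<in>S. x \<otimes> s \<otimes> inv x \<in> S)"
        by (metis S.m_inv_closed S.mem_carrier inv_inv)
      ultimately show ?thesis using x by (auto simp: N_def)
    qed
    have E: "?E = (\<lambda>x. S #> x) ` carrier G" by (auto simp: RCOSETS_def)
    have F: "carrier (?N Mod S) = (\<lambda>x. S #> x) ` N" by (simp add: carrier_FactGroup)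
    have NG: "N \<subseteq> carrier G" using subgroup.subset[OF subN] .
    have "carrier (G\<lparr>carrier := S\<rparr>) = S" by simp
    then show ?thesis
      unfolding E F using * NG by (simp only:) blast
  qed
  moreover have "p dvd card ?E"
  proof -
    have "card ?E * p ^ k = Coset.order G" using lagrange[OF S] card by simp
    then have "p ^ k * p dvd p ^ k * card ?E" using dvd by (simp add: mult.commute)
    then show ?thesis using p by (simp add: prime_gt_0_nat)
  qed
  ultimately have pdvd: "p dvd Coset.order (?N Mod S)" by (simp add: Coset.order_def)
  interpret NS: normal S ?N by (rule normal)
  have grpQ: "group (?N Mod S)" by (rule NS.factorgroup_is_group)
  have finQ: "finite (carrier (?N Mod S))"
    using fin subgroup.subset[OF subN] by (auto simp: carrier_FactGroup intro: finite_subset)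
  obtain m where "Coset.order (?N Mod S) = p ^ 1 * m" using pdvd by auto
  from sylow_thm[OF p grpQ this finQ] obtain Q where Q: "subgroup Q (?N Mod S)" "card Q = p"
    by auto
  have T: "subgroup (\<Union>Q) ?N"
    using NS.factgroup_subgroup_union_subgroup[OF Q(1)] .
  then have TG: "subgroup (\<Union>Q) G" by (rule incl_subgroup[OF subN])
  have Qsub: "Q \<subseteq> rcosets\<^bsub>?N\<^esub> S" using subgroup.subset[OF Q(1)] by (simp add: FactGroup_def)
  have "card (\<Union>Q) = (\<Sum>X\<in>Q. card X)"
  proof (rule card_Union_disjoint)
    show "disjoint Q"
      by (rule pairwise_subset[OF NS.rcos_disjoint[OF NS.subgroup_axioms] Qsub])
    show "finite A" if A: "A \<in> Q" for A
    proof -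
      have "A \<subseteq> carrier ?N" using A Qsub NS.rcosets_carrier[OF grpN] by blast
      then have "A \<subseteq> carrier G" using subgroup.subset[OF subN] by auto
      then show ?thesis using fin by (rule finite_subset)
    qed
  qed
  also have "\<dots> = (\<Sum>X\<in>Q. p ^ k)"
    by (rule sum.cong) (use Qsub card NS.card_rcosets_equal NS.subset in auto)
  finally have "card (\<Union>Q) = p ^ Suc k" using Q(2) by simp
  moreover have "S \<subseteq> \<Union>Q"
    using subgroup.one_closed[OF Q(1)] by auto
  ultimately show ?thesis using TG by blast
qed

lemma p_subgroup_extend:
  fixes G (structure)
  assumes G: "group G" and fin: "finite (carrier G)" and p: "prime (p::nat)"
    and S: "subgroup S G" and card: "card S = p ^ k" and "k \<le> n" and "p ^ n dvd Coset.order G"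
  shows "\<exists>T. subgroup T G \<and> card T = p ^ n \<and> S \<subseteq> T"
  using assms(6,7)
proof (induction n rule: dec_induct)
  case base
  then show ?case using S card by auto
next
  case (step n)
  then have "p ^ n dvd Coset.order G" by (metis dvd_trans le_imp_power_dvd le_SucI order_refl)
  with step obtain T where T: "subgroup T G" "card T = p ^ n" "S \<subseteq> T" by auto
  from p_subgroup_extend_once[OF G fin p T(1,2) step.prems] T(3) show ?case by blast
qed

section \<open>Normal elementary abelian subgroups of rank two\<close>

text \<open>
By Fermat's theorem \<open>r\<close> is congruent to \<open>1\<close> modulo \<open>p\<close>. Then the cofactor \<open>1 + r + \<dots> + r ^ (p - 1)\<close>
of \<open>r - 1\<close> is congruent to \<open>p\<close> modulo \<open>p ^ 2\<close>, because \<open>p\<close> divides \<open>0 + 1 + \<dots> + (p - 1)\<close> for odd \<open>p\<close>.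
So the cofactor contributes exactly one factor \<open>p\<close>.
\<close>

lemma prime_power_dvd_pow_minus_one:
  fixes n :: nat
  defines "r \<equiv> int n"
  assumes p: "prime (p::nat)" and odd: "p \<ge> 3" and dvd: "int p ^ m dvd r ^ p - 1"
  shows "int p ^ m dvd int p * (r - 1)"
proof (cases m)
  case 0
  then show ?thesis by simp
next
  case (Suc m')
  have "int p dvd r ^ p - 1" using dvd Suc by (metis dvd_mult_left power_Suc)
  moreover have "[r ^ p = r] (mod int p)"
  proof (cases "int p dvd r")
    case True
    moreover have "r dvd r ^ p" using p by (intro dvd_power) (simp add: prime_gt_0_nat)
    ultimately have "int p dvd r ^ p - r" by (meson dvd_diff dvd_trans)
    then show ?thesis by (simp add: cong_iff_dvd_diff)
  next
    case False
    then have "[n ^ (p - 1) = 1] (mod p)"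
      using p by (intro fermat_theorem) (auto simp: r_def)
    then have "[int (n ^ (p - 1)) = int 1] (mod int p)" by (simp only: cong_int_iff)
    then have "[r ^ (p - 1) = 1] (mod int p)" by (simp add: r_def)
    then have "[r * r ^ (p - 1) = r * 1] (mod int p)" by (rule cong_scalar_left)
    then show ?thesis using p prime_gt_0_nat by (simp add: power_eq_if)
  qed
  ultimately have "int p dvd r - 1"
    by (metis cong_iff_dvd_diff cong_sym cong_trans)
  then obtain s where s: "r = 1 + int p * s" by (metis add.commute diff_add_cancel dvdE)
  have pow: "[r ^ i = 1 + int i * (int p * s)] (mod int p ^ 2)" for i
  proof (induction i)
    case (Suc i)
    have "[r ^ Suc i = r * (1 + int i * (int p * s))] (mod int p ^ 2)"
      using Suc by (simp add: cong_scalar_left)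
    also have "r * (1 + int i * (int p * s)) = 1 + int (Suc i) * (int p * s) + int p ^ 2 * (int i * s * s)"
      by (simp add: s algebra_simps power2_eq_square)
    also have "[\<dots> = 1 + int (Suc i) * (int p * s)] (mod int p ^ 2)"
      by (simp add: cong_iff_dvd_diff)
    finally show ?case .
  qed simp
  have "[(\<Sum>i<p. r ^ i) = (\<Sum>i<p. 1 + int i * (int p * s))] (mod int p ^ 2)"
    by (intro cong_sum pow)
  also have "(\<Sum>i<p. 1 + int i * (int p * s)) = int p + (\<Sum>i<p. int i) * (int p * s)"
    by (simp add: sum.distrib sum_distrib_right)
  also have "[\<dots> = int p] (mod int p ^ 2)"
  proof -
    have "odd p" using p odd prime_odd_nat by auto
    then obtain h where h: "p = 2 * h + 1" by (auto elim: oddE)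
    have "2 * (\<Sum>i<p. int i) = int p * (int p - 1)"
      by (induction p) (auto simp: algebra_simps)
    then have "(\<Sum>i<p. int i) = int p * int h" using h by simp
    then show ?thesis by (simp add: cong_iff_dvd_diff power2_eq_square)
  qed
  finally obtain w where "(\<Sum>i<p. r ^ i) = int p + int p ^ 2 * w"
    by (metis cong_iff_lin cong_sym mult.commute)
  then have sum: "(\<Sum>i<p. r ^ i) = int p * (1 + int p * w)"
    by (simp add: algebra_simps power2_eq_square)
  have "r ^ p - 1 = (r - 1) * (\<Sum>i<p. r ^ i)"
    by (simp add: power_diff_1_eq)
  then have "int p ^ m dvd int p * (r - 1) * (1 + int p * w)"
    using dvd sum by (simp add: mult_ac)
  moreover have "coprime (int p ^ m) (1 + int p * w)"
    by (simp add: coprime_commute) (metis coprime_add_one_right coprime_commute coprime_mult_left_iff add.commute)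
  ultimately show ?thesis by (simp add: coprime_dvd_mult_left_iff)
qed

lemma (in group) pow_mod_ord:
  "x \<in> carrier G \<Longrightarrow> x [^] (n mod ord x) = x [^] (n::nat)"
proof -
  assume x: "x \<in> carrier G"
  have "n = n mod ord x + ord x * (n div ord x)" by simp
  then have "x [^] n = x [^] (n mod ord x + ord x * (n div ord x))" by (rule arg_cong)
  also have "\<dots> = x [^] (n mod ord x) \<otimes> (x [^] ord x) [^] (n div ord x)"
    by (simp only: nat_pow_mult[OF x, symmetric] nat_pow_pow[OF x, symmetric])
  also have "\<dots> = x [^] (n mod ord x)" using x by simp
  finally show ?thesis ..
qed

lemma (in group) pow_eq_if_cong_ord:
  "x \<in> carrier G \<Longrightarrow> [m = n] (mod ord x) \<Longrightarrow> x [^] (m::nat) = x [^] (n::nat)"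
  by (metis cong_def pow_mod_ord)

lemma (in group) conjugate_pow:
  "x \<in> carrier G \<Longrightarrow> h \<in> carrier G \<Longrightarrow> (x \<otimes> h \<otimes> inv x) [^] (n::nat) = x \<otimes> h [^] n \<otimes> inv x"
proof (induction n)
  case (Suc n)
  then have "(x \<otimes> h \<otimes> inv x) [^] Suc n = x \<otimes> h [^] n \<otimes> (inv x \<otimes> x) \<otimes> h \<otimes> inv x"
    by (simp only: nat_pow_Suc m_assoc m_closed inv_closed nat_pow_closed)
  then show ?case using Suc by (simp add: m_assoc)
qed simp

text \<open>
A cyclic group whose order is a power of \<open>p\<close> has only one subgroup of order \<open>p\<close>, and each of its nontrivial
elements generates it.
\<close>

lemma (in group) cyclic_p_torsion:
  assumes p: "prime (p::nat)" and a: "a \<in> carrier G" and ord: "ord a = p ^ m"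
    and z: "z = a [^] (l::nat)" "z [^] p = \<one>" "z \<noteq> \<one>"
    and y: "y = a [^] (i::nat)" "y [^] p = \<one>"
  shows "\<exists>t::nat. y = z [^] t"
proof -
  have "m \<noteq> 0" using z ord a ord_eq_1 by (metis nat_pow_one power_0)
  then obtain n where m: "m = Suc n" by (cases m) auto
  have p0: "p > 0" using p by (simp add: prime_gt_0_nat)
  have "p ^ m dvd l * p" using z a ord by (simp add: nat_pow_pow pow_eq_id)
  then have "p ^ n dvd l" using m p0 by simp
  then obtain u where u: "l = p ^ n * u" by auto
  have "p ^ m dvd i * p" using y a ord by (simp add: nat_pow_pow pow_eq_id)
  then have "p ^ n dvd i" using m p0 by simp
  then obtain v where v: "i = p ^ n * v" by auto
  have "\<not> p dvd u"
  proof
    assume "p dvd u"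
    then have "p ^ m dvd l" using u m by (auto simp: mult_ac)
    then show False using z a ord by (simp add: pow_eq_id)
  qed
  then have "coprime u p" using p prime_imp_coprime coprime_commute by blast
  then obtain x where "[u * x = 1] (mod p)" using cong_solve_coprime_nat by auto
  then have "[u * x * v = 1 * v] (mod p)" by (rule cong_scalar_right)
  then have "[p ^ n * (u * x * v) = p ^ n * v] (mod p ^ n * p)"
    by (simp add: cong_def flip: mult_mod_right)
  then have "[l * (x * v) = i] (mod ord a)" using u v ord m by (simp add: mult_ac)
  then have "a [^] (l * (x * v)) = a [^] i" using a pow_eq_if_cong_ord by blast
  then have "y = z [^] (x * v)" using z y a by (simp add: nat_pow_pow)
  then show ?thesis ..
qed

text \<open>
The collection formula when the commutator \<open>t\<close> of the factors is central. The exponent of \<open>t\<close> is kept as a sum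
and not written as \<open>n (n - 1) div 2\<close>; for an odd prime \<open>n\<close> it is divisible by \<open>n\<close>, so that powering with \<open>n\<close>
is multiplicative if \<open>t\<close> has order \<open>n\<close>.
\<close>

lemma (in group) pow_mult_central_commutator:
  assumes b: "b \<in> carrier G" and y: "y \<in> carrier G" and t: "t \<in> carrier G"
    and comm: "b \<otimes> y = y \<otimes> b \<otimes> t" and tb: "t \<otimes> b = b \<otimes> t" and ty: "t \<otimes> y = y \<otimes> t"
  shows "(b \<otimes> y) [^] (n::nat) \<otimes> t [^] (\<Sum>i<n. i) = b [^] n \<otimes> y [^] n"
proof -
  have *: "y [^] n \<otimes> b \<otimes> t [^] n = b \<otimes> y [^] n" for n :: nat
  proof (induction n)
    case (Suc n)
    have tyn: "t \<otimes> y [^] n = y [^] n \<otimes> t"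
      using group_commutes_pow[of y t n] ty y t by simp
    have "y [^] Suc n \<otimes> b \<otimes> t [^] Suc n = y \<otimes> (y [^] n \<otimes> b \<otimes> t [^] n) \<otimes> t"
      unfolding nat_pow_Suc2[OF y] using b y t by (simp add: m_assoc)
    also have "\<dots> = y \<otimes> b \<otimes> (t \<otimes> y [^] n)"
      unfolding Suc tyn using b y t by (simp add: m_assoc)
    also have "\<dots> = b \<otimes> y \<otimes> y [^] n"
      unfolding comm using b y t by (simp add: m_assoc)
    also have "\<dots> = b \<otimes> y [^] Suc n"
      unfolding nat_pow_Suc2[OF y] using b y by (simp add: m_assoc)
    finally show ?case .
  qed (use b in simp)
  have tby: "t [^] k \<otimes> (b \<otimes> y) = (b \<otimes> y) \<otimes> t [^] k" for k :: nat
  proof -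
    have "t \<otimes> (b \<otimes> y) = (b \<otimes> y) \<otimes> t"
      using b y t tb ty by (metis m_assoc)
    then show ?thesis using group_commutes_pow[of t "b \<otimes> y" k] b y t by simp
  qed
  show ?thesis
  proof (induction n)
    case (Suc n)
    let ?e = "\<Sum>i<n. i"
    have tyn: "t [^] n \<otimes> y = y \<otimes> t [^] n"
      using group_commutes_pow[of t y n] ty y t by simp
    have "(b \<otimes> y) [^] Suc n \<otimes> t [^] (\<Sum>i<Suc n. i) = (b \<otimes> y) [^] n \<otimes> ((b \<otimes> y) \<otimes> t [^] ?e) \<otimes> t [^] n"
      using b y t by (simp add: m_assoc nat_pow_mult)
    also have "\<dots> = ((b \<otimes> y) [^] n \<otimes> t [^] ?e) \<otimes> (b \<otimes> y) \<otimes> t [^] n"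
      unfolding tby[symmetric] using b y t by (simp add: m_assoc)
    also have "\<dots> = b [^] n \<otimes> (y [^] n \<otimes> b \<otimes> (y \<otimes> t [^] n))"
      unfolding Suc using b y t by (simp add: m_assoc)
    also have "\<dots> = b [^] n \<otimes> ((y [^] n \<otimes> b \<otimes> t [^] n) \<otimes> y)"
      unfolding tyn[symmetric] using b y t by (simp add: m_assoc)
    also have "\<dots> = b [^] Suc n \<otimes> y [^] Suc n"
      unfolding * using b y t by (simp add: m_assoc)
    finally show ?case .
  qed simp
qed


text \<open>
Let \<open>A = \<langle>a\<rangle>\<close> be a largest cyclic normal subgroup that contains \<open>z\<close>, and let \<open>b\<close> represent a central element of
order \<open>p\<close> in \<open>P / A\<close>. Conjugation by \<open>b\<close> multiplies \<open>a\<close> by a power of \<open>z\<close>, so \<open>p\<close>-th powers are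
multiplicative on \<open>\<langle>a, b\<rangle>\<close>. If \<open>b [^] p\<close> generated \<open>A\<close>, then \<open>\<langle>b\<rangle>\<close> would be a larger cyclic normal subgroup;
hence \<open>b [^] p\<close> is the \<open>p\<close>-th power of an element \<open>a [^] j\<close> of \<open>A\<close>, and \<open>w = b \<otimes> inv (a [^] j)\<close> satisfies
\<open>w [^] p = \<one>\<close>. A conjugate of \<open>w\<close> is \<open>w \<otimes> u\<close> with \<open>u \<in> A\<close>, and \<open>u [^] p = \<one>\<close> by multiplicativity. The quaternion
group shows that the statement fails for \<open>p = 2\<close>.
\<close>

lemma noncyclic_p_group_normal_rank_two:
  fixes P (structure)
  assumes P: "group P" and p: "prime (p::nat)" and p3: "p \<ge> 3" and card: "Coset.order P = p ^ k"
    and noncyclic: "\<not> cyclic_group P"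
    and z: "z \<in> group_center P" "z \<noteq> \<one>" "z [^] p = \<one>"
  shows "\<exists>w \<in> carrier P. w \<notin> range (\<lambda>i::nat. z [^] i) \<and> w [^] p = \<one> \<and>
    (\<forall>x \<in> carrier P. \<exists>i::nat. x \<otimes> w \<otimes> inv x = w \<otimes> z [^] i)"
proof -
  interpret group P by fact
  have fin: "finite (carrier P)"
    by (rule finite_carrier_if_prime_power_order[OF p card])
  have zP: "z \<in> carrier P" and zc: "\<And>x. x \<in> carrier P \<Longrightarrow> z \<otimes> x = x \<otimes> z"
    using z by (auto simp: group_center_def)
  have zpow: "z [^] (i::nat) \<otimes> x = x \<otimes> z [^] i" if "x \<in> carrier P" for i x
    using group_commutes_pow[OF zc[OF that] zP that] .
  let ?C = "\<lambda>a. range (\<lambda>i::nat. a [^] i)"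
  have gen: "?C a = generate P {a}" if "a \<in> carrier P" for a
    using generate_pow_on_finite_carrier[OF fin that] by auto
  let ?A = "{a \<in> carrier P. z \<in> ?C a \<and> (\<forall>x \<in> carrier P. x \<otimes> a \<otimes> inv x \<in> ?C a)}"
  have "z \<in> ?A"
  proof -
    have "x \<otimes> z \<otimes> inv x = z" if "x \<in> carrier P" for x
      using zc[OF that, symmetric] that zP by (simp add: m_assoc)
    moreover have "z \<in> ?C z" using zP by (auto intro!: image_eqI[of _ _ "1::nat"])
    ultimately show ?thesis using zP by auto
  qed
  moreover have "finite ?A" using fin by auto
  ultimately have Mx: "Max (ord ` ?A) \<in> ord ` ?A" "\<And>a'. a' \<in> ?A \<Longrightarrow> ord a' \<le> Max (ord ` ?A)"
    by (auto intro!: Max_in Max_ge simp del: mem_Collect_eq)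
  then obtain a where aA: "a \<in> ?A" and "Max (ord ` ?A) = ord a" by (elim imageE)
  then have max: "\<And>a'. a' \<in> ?A \<Longrightarrow> ord a' \<le> ord a" using Mx(2) by simp
  have a: "a \<in> carrier P" and za: "z \<in> ?C a"
    and na: "\<And>x. x \<in> carrier P \<Longrightarrow> x \<otimes> a \<otimes> inv x \<in> ?C a"
    using aA by auto
  define A where "A = ?C a"
  have subA: "subgroup A P" using generate_is_subgroup[of "{a}"] a gen[OF a] by (simp add: A_def)
  interpret A: subgroup A P by (rule subA)
  have powA: "a [^] i \<in> A" for i :: nat by (simp add: A_def)
  have AE: "\<exists>i::nat. u = a [^] i" if "u \<in> A" for u using that by (auto simp: A_def)
  have aA: "a \<in> A" using powA[of 1] a by simp
  have normA: "A \<lhd> P"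
  proof (rule normal_invI[OF subA])
    fix x h assume x: "x \<in> carrier P" and "h \<in> A"
    then obtain i :: nat where "h = a [^] i" using AE by auto
    then have "x \<otimes> h \<otimes> inv x = (x \<otimes> a \<otimes> inv x) [^] i" using conjugate_pow x a by simp
    also have "\<dots> \<in> A"
    proof -
      obtain j :: nat where "x \<otimes> a \<otimes> inv x = a [^] j" using na[OF x] by auto
      then show ?thesis using a powA by (simp add: nat_pow_pow)
    qed
    finally show "x \<otimes> h \<otimes> inv x \<in> A" .
  qed
  interpret nA: normal A P by (rule normA)
  have zA: "z \<in> A" using za by (simp add: A_def)
  have ne: "A \<noteq> carrier P"
  proof
    assume A: "A = carrier P"
    have "x \<in> range (\<lambda>n::int. a [^] n)" if x: "x \<in> carrier P" for x
    proof -
      obtain n :: nat where "x = a [^] n" using AE[of x] x A by auto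
      then have "x = a [^] int n" by (simp add: int_pow_int)
      then show ?thesis by (rule range_eqI)
    qed
    then have "carrier P = range (\<lambda>n::int. a [^] n)" using a by auto
    then show False using noncyclic a cyclic_group by metis
  qed
  \<comment> \<open>\<open>b\<close> represents a central element of order \<open>p\<close> in \<open>P / A\<close>.\<close>
  obtain b where b: "b \<in> carrier P" "b \<notin> A" "b [^] p \<in> A"
    and bc: "\<And>x. x \<in> carrier P \<Longrightarrow> x \<otimes> b \<otimes> inv x \<otimes> inv b \<in> A"
  proof -
    let ?Q = "P Mod A"
    interpret Q: group ?Q by (rule nA.factorgroup_is_group)
    have "card (rcosets A) * card A = p ^ k" using lagrange[OF subA] card by simp
    then have "card (rcosets A) dvd p ^ k" by (metis dvd_triv_left)
    then obtain j where j: "Coset.order ?Q = p ^ j"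
      using p divides_primepow_nat by (auto simp: Coset.order_def FactGroup_def)
    have "carrier ?Q \<noteq> {\<one>\<^bsub>?Q\<^esub>}"
    proof
      assume *: "carrier ?Q = {\<one>\<^bsub>?Q\<^esub>}"
      have "x \<in> A" if x: "x \<in> carrier P" for x
      proof -
        have "A #> x = A" using * x by (auto simp: carrier_FactGroup)
        then show ?thesis using rcos_self[OF x subA] by simp
      qed
      then show False using ne A.subset by auto
    qed
    then obtain c where c: "c \<in> carrier ?Q" "c \<in> group_center ?Q" "c \<noteq> \<one>\<^bsub>?Q\<^esub>" "c [^]\<^bsub>?Q\<^esub> p = \<one>\<^bsub>?Q\<^esub>"
      using normal_subgroup_meets_center_order_p[OF Q.is_group p j Q.normal_self] by auto
    obtain b where b: "b \<in> carrier P" "c = A #> b" using c(1) by (auto simp: carrier_FactGroup)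
    have "b \<notin> A" using c(3) b A.rcos_const[OF is_group] by auto
    moreover have "b [^] p \<in> A"
    proof -
      have "A #> (b [^] p) = A" using c(4) b nA.FactGroup_pow[OF b(1)] by simp
      then show ?thesis using rcos_self[OF nat_pow_closed[OF b(1)] subA] by metis
    qed
    moreover have "x \<otimes> b \<otimes> inv x \<otimes> inv b \<in> A" if x: "x \<in> carrier P" for x
    proof -
      have "c \<otimes>\<^bsub>?Q\<^esub> (A #> x) = (A #> x) \<otimes>\<^bsub>?Q\<^esub> c"
        using c(2) x by (auto simp: group_center_def carrier_FactGroup)
      then have "A #> (x \<otimes> b) = A #> (b \<otimes> x)" using b x nA.rcos_sum by simp
      then have "(x \<otimes> b) \<otimes> inv (b \<otimes> x) \<in> A" using coset_eq_iff[OF subA] b x by simp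
      then show ?thesis using b x by (simp add: inv_mult_group m_assoc)
    qed
    ultimately show ?thesis using that b(1) by blast
  qed
  obtain m where m: "ord a = p ^ m"
    using ord_dvd_group_order[OF a] card p divides_primepow_nat by metis
  have torsion: "\<exists>t::nat. u = z [^] t" if u: "u \<in> A" "u [^] p = \<one>" for u
  proof -
    obtain i l :: nat where "u = a [^] i" "z = a [^] l" using AE u zA by meson
    then show ?thesis using cyclic_p_torsion[OF p a m _ z(3,2)] u(2) by blast
  qed
  \<comment> \<open>\<open>b\<close> acts on \<open>A\<close> as raising to the power \<open>r\<close>. As \<open>b [^] p\<close> lies in \<open>A\<close>, \<open>r ^ p\<close> is \<open>1\<close> modulo \<open>p ^ m\<close>.\<close>
  obtain r :: nat where r: "b \<otimes> a \<otimes> inv b = a [^] r" using na[OF b(1)] by auto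
  have rpow: "b [^] n \<otimes> a \<otimes> inv (b [^] n) = a [^] (r ^ n)" for n :: nat
  proof (induction n)
    case (Suc n)
    have "b [^] Suc n \<otimes> a \<otimes> inv (b [^] Suc n) = b \<otimes> (b [^] n \<otimes> a \<otimes> inv (b [^] n)) \<otimes> inv b"
      unfolding nat_pow_Suc2[OF b(1)] using a b by (simp add: inv_mult_group m_assoc)
    also have "\<dots> = a [^] (r ^ Suc n)"
      unfolding Suc using conjugate_pow[OF b(1) a] r a by (simp add: nat_pow_pow)
    finally show ?case .
  qed (use a in simp)
  have "int p ^ m dvd int r ^ p - 1"
  proof -
    obtain i :: nat where "b [^] p = a [^] i" using AE b(3) by auto
    then have "b [^] p \<otimes> a = a \<otimes> b [^] p" using nat_pow_mult[OF a, of i 1] nat_pow_mult[OF a, of 1 i] a by simp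
    then have "a [^] (r ^ p) = a" using rpow[of p] a b by (simp add: m_assoc)
    then have "a [^] int (r ^ p) = a [^] (1::int)" using a by (simp only: int_pow_int) simp
    then have "int (p ^ m) dvd 1 - int (r ^ p)" using int_pow_eq[OF a] m by metis
    then show ?thesis by (metis dvd_diff_commute of_nat_power)
  qed
  then have rm: "int p ^ m dvd int p * (int r - 1)"
    by (rule prime_power_dvd_pow_minus_one[OF p p3])
  obtain T :: nat where T: "a [^] r \<otimes> inv a = z [^] T"
  proof -
    have "(a [^] r \<otimes> inv a) [^] p = \<one>"
    proof -
      have "a [^] r \<otimes> inv a = a [^] (int r - 1)"
        using a by (simp add: int_pow_diff int_pow_int)
      then have "(a [^] r \<otimes> inv a) [^] p = a [^] ((int r - 1) * int p)"
        using a by (metis int_pow_int int_pow_pow)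
      also have "\<dots> = \<one>" using rm a m by (simp add: int_pow_eq_id mult.commute)
      finally show ?thesis .
    qed
    moreover have "a [^] r \<otimes> inv a \<in> A" using powA aA by simp
    ultimately show ?thesis using torsion that by blast
  qed
  have comm: "b \<otimes> a = a \<otimes> b \<otimes> z [^] T"
  proof -
    have "a [^] r = z [^] T \<otimes> a" using T a zP by (simp flip: T add: m_assoc)
    then have "b \<otimes> a \<otimes> inv b = z [^] T \<otimes> a" using r by simp
    then have "b \<otimes> a = z [^] T \<otimes> a \<otimes> b" using a b zP by (metis inv_solve_right' m_closed nat_pow_closed)
    then show ?thesis using zpow[of "a \<otimes> b" T] a b zP by (simp add: m_assoc)
  qed
  have oddp: "p dvd (\<Sum>i<p. i)"
  proof -
    have "odd p" using p p3 prime_odd_nat by auto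
    then obtain h where h: "p = 2 * h + 1" by (auto elim: oddE)
    have "2 * (\<Sum>i<p. i) + p = p * p" by (induction p) auto
    then have "(\<Sum>i<p. i) = p * h" using h by (simp add: algebra_simps)
    then show ?thesis by simp
  qed
  have ppow: "(c \<otimes> u) [^] p = c [^] p \<otimes> u [^] p"
    if c: "c \<in> carrier P" "c \<otimes> a = a \<otimes> c \<otimes> z [^] T" and u: "u \<in> A" for c u
  proof -
    obtain i :: nat where i: "u = a [^] i" using AE u by auto
    have cu: "c \<otimes> a [^] i = a [^] i \<otimes> c \<otimes> (z [^] T) [^] i" for i :: nat
    proof (induction i)
      case (Suc i)
      let ?Z = "(z [^] T) [^] i"
      have Z: "?Z \<otimes> x = x \<otimes> ?Z" if "x \<in> carrier P" for x
        using zpow[OF that] zP by (simp add: nat_pow_pow)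
      have "c \<otimes> a [^] Suc i = a [^] i \<otimes> c \<otimes> (?Z \<otimes> a)"
        using Suc a c zP by (simp add: m_assoc[symmetric])
      also have "\<dots> = a [^] i \<otimes> (c \<otimes> a) \<otimes> ?Z"
        unfolding Z[OF a] using a c(1) zP by (simp add: m_assoc)
      also have "\<dots> = a [^] Suc i \<otimes> c \<otimes> (z [^] T \<otimes> ?Z)"
        unfolding c(2) using a c(1) zP by (simp add: m_assoc)
      also have "z [^] T \<otimes> ?Z = (z [^] T) [^] Suc i"
        unfolding nat_pow_Suc2[OF nat_pow_closed[OF zP]] by simp
      finally show ?case .
    qed (use c in simp)
    let ?t = "(z [^] T) [^] i"
    have t: "?t = z [^] (T * i)" using zP by (simp add: nat_pow_pow)
    have "(c \<otimes> u) [^] p \<otimes> ?t [^] (\<Sum>i<p. i) = c [^] p \<otimes> u [^] p"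
      by (rule pow_mult_central_commutator) (use c u i cu a zP zpow in \<open>auto simp: t\<close>)
    moreover have "?t [^] (\<Sum>i<p. i) = \<one>"
    proof -
      obtain q where q: "(\<Sum>i<p. i) = p * q" using oddp by auto
      have "?t [^] (\<Sum>i<p. i) = (z [^] p) [^] (T * i * q)"
        unfolding q using zP by (simp add: nat_pow_pow mult_ac)
      then show ?thesis using z by simp
    qed
    ultimately show ?thesis using c u by simp
  qed
  obtain i :: nat where i: "b [^] p = a [^] i" using AE b(3) by auto
  have "p dvd i"
  proof (rule ccontr)
    \<comment> \<open>Then \<open>b [^] p\<close> generates \<open>A\<close>, and \<open>b\<close> contradicts the maximality of \<open>ord a\<close>.\<close>
    assume "\<not> p dvd i"
    then have "coprime i p" using p prime_imp_coprime coprime_commute by blast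
    then have ip: "coprime i (p ^ m)" by simp
    obtain l where "[i * l = 1] (mod (p ^ m))" using cong_solve_coprime_nat[OF ip] by auto
    then have "a [^] (i * l) = a" using pow_eq_if_cong_ord[OF a, of "i * l" 1] m a by simp
    then have ab: "a = b [^] (p * l)" using i a b by (metis nat_pow_pow)
    have sub: "A \<subseteq> ?C b"
    proof
      fix u assume "u \<in> A"
      then obtain j :: nat where "u = a [^] j" using AE by auto
      then have "u = b [^] (p * l * j)" using ab b by (simp add: nat_pow_pow)
      then show "u \<in> ?C b" by blast
    qed
    have bC: "b \<in> ?C b" using b by (auto intro!: image_eqI[of _ _ "1::nat"])
    have "x \<otimes> b \<otimes> inv x \<in> ?C b" if x: "x \<in> carrier P" for x
    proof -
      have sb: "subgroup (?C b) P" using generate_is_subgroup[of "{b}"] b gen by simp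
      have "(x \<otimes> b \<otimes> inv x \<otimes> inv b) \<otimes> b \<in> ?C b"
        by (rule subgroup.m_closed[OF sb subsetD[OF sub bc[OF x]] bC])
      then show ?thesis using x b by (simp add: m_assoc)
    qed
    then have "b \<in> ?A" using b sub zA by auto
    then have "ord b \<le> ord a" by (rule max)
    moreover have "card A < card (?C b)"
    proof (rule psubset_card_mono)
      show "finite (?C b)" using fin b by (intro finite_subset[OF _ fin]) auto
      show "A \<subset> ?C b" using sub bC b by auto
    qed
    ultimately show False
      using generate_pow_card[OF a] generate_pow_card[OF b(1)] gen[OF a] gen[OF b(1)]
      by (simp add: A_def)
  qed
  then obtain j where j: "i = j * p" by (metis dvd_mult_div_cancel mult.commute)
  define y where "y = inv (a [^] j)"
  have yA: "y \<in> A" using powA by (simp add: y_def)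
  then have yP: "y \<in> carrier P" by auto
  define w where "w = b \<otimes> y"
  have wP: "w \<in> carrier P" using b yP by (simp add: w_def)
  have wp: "w [^] p = \<one>"
  proof -
    have "y [^] p = inv (a [^] i)" using a j by (simp add: y_def nat_pow_inv nat_pow_pow)
    then show ?thesis using ppow[OF b(1) comm yA] i a by (simp add: w_def)
  qed
  have wA: "w \<notin> A"
  proof
    assume "w \<in> A"
    then have "w \<otimes> inv y \<in> A" using yA by simp
    then show False using b yP by (simp add: w_def m_assoc)
  qed
  have ya: "y \<otimes> a = a \<otimes> y"
  proof -
    have "a [^] j \<otimes> a = a \<otimes> a [^] j" using nat_pow_Suc2[OF a, of j] by simp
    then show ?thesis unfolding y_def using a
      by (metis inv_solve_left inv_solve_right m_assoc m_closed nat_pow_closed inv_closed)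
  qed
  have wcomm: "w \<otimes> a = a \<otimes> w \<otimes> z [^] T"
  proof -
    have "w \<otimes> a = (b \<otimes> a) \<otimes> y" using ya a b yP by (simp add: w_def m_assoc)
    also have "\<dots> = a \<otimes> b \<otimes> (z [^] T \<otimes> y)" unfolding comm using a b yP zP by (simp add: m_assoc)
    also have "\<dots> = a \<otimes> w \<otimes> z [^] T" unfolding zpow[OF yP] using a b yP zP by (simp add: w_def m_assoc)
    finally show ?thesis .
  qed
  have "\<exists>t::nat. x \<otimes> w \<otimes> inv x = w \<otimes> z [^] t" if x: "x \<in> carrier P" for x
  proof -
    define u where "u = inv w \<otimes> (x \<otimes> w \<otimes> inv x)"
    have uP: "u \<in> carrier P" using x wP by (simp add: u_def)
    have xw: "x \<otimes> w \<otimes> inv x = w \<otimes> u" using x wP by (simp add: u_def m_assoc[symmetric])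
    have "u \<in> A"
    proof -
      have 1: "x \<otimes> y \<otimes> inv x \<in> A" using nA.inv_op_closed2 x yA by blast
      have 2: "x \<otimes> b \<otimes> inv x \<otimes> inv b \<in> A" by (rule bc[OF x])
      have "inv b \<otimes> (x \<otimes> b \<otimes> inv x \<otimes> inv b) \<otimes> b \<in> A"
        using nA.inv_op_closed1[OF b(1) 2] .
      then have "inv y \<otimes> (inv b \<otimes> (x \<otimes> b \<otimes> inv x \<otimes> inv b) \<otimes> b) \<otimes> (x \<otimes> y \<otimes> inv x) \<in> A"
        using 1 yA by simp
      also have "inv y \<otimes> (inv b \<otimes> (x \<otimes> b \<otimes> inv x \<otimes> inv b) \<otimes> b) \<otimes> (x \<otimes> y \<otimes> inv x) =
        inv y \<otimes> inv b \<otimes> x \<otimes> b \<otimes> (inv x \<otimes> ((inv b \<otimes> b) \<otimes> x)) \<otimes> y \<otimes> inv x"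
        using b x yP by (simp only: m_assoc m_closed inv_closed)
      also have "\<dots> = u" using b x yP by (simp add: u_def w_def inv_mult_group m_assoc)
      finally show ?thesis .
    qed
    moreover have "u [^] p = \<one>"
    proof -
      have "(x \<otimes> w \<otimes> inv x) [^] p = \<one>" using conjugate_pow[OF x wP, of p] wp x by simp
      then show ?thesis using ppow[OF wP wcomm \<open>u \<in> A\<close>] xw wp uP by simp
    qed
    ultimately show ?thesis using torsion xw by metis
  qed
  moreover have "w \<notin> ?C z"
  proof
    assume "w \<in> ?C z"
    then obtain t :: nat where "w = z [^] t" by auto
    moreover have "z [^] t \<in> A" for t :: nat using zA by (induction t) auto
    ultimately show False using wA by simp
  qed
  ultimately show ?thesis using wP wp by blast
qed

section \<open>Relations between roots of unity of prime power order\<close>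

text \<open>
The first coefficient of \<open>G\<close> that \<open>p\<close> does not divide produces a coefficient of \<open>G * H\<close> of the same index that
\<open>p\<close> does not divide either, so this index is at least the degree of the product.
\<close>

lemma eisenstein_aux:
  fixes G H :: "int poly"
  assumes p: "prime (p::int)" and low: "\<And>i. i < degree (G * H) \<Longrightarrow> p dvd coeff (G * H) i"
    and lead: "\<not> p dvd lead_coeff (G * H)" and g0: "p dvd coeff G 0" and h0: "\<not> p dvd coeff H 0"
  shows "degree H = 0"
proof -
  have G: "\<not> p dvd lead_coeff G" using lead by (auto simp: lead_coeff_mult)
  have nz: "G \<noteq> 0" "H \<noteq> 0" using lead by auto
  define i where "i = (LEAST i. \<not> p dvd coeff G i)"
  have i: "\<not> p dvd coeff G i" unfolding i_def by (rule LeastI, rule G)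
  have ile: "i \<le> degree G" unfolding i_def by (rule Least_le, rule G)
  have below: "p dvd coeff G j" if "j < i" for j using not_less_Least that i_def by blast
  have "coeff (G * H) i = (\<Sum>j<i. coeff G j * coeff H (i - j)) + coeff G i * coeff H 0"
    by (simp add: coeff_mult lessThan_Suc_atMost[symmetric])
  moreover have "p dvd (\<Sum>j<i. coeff G j * coeff H (i - j))"
    using below by (intro dvd_sum) auto
  moreover have "\<not> p dvd coeff G i * coeff H 0"
    using i h0 p by (simp add: prime_dvd_mult_iff)
  ultimately have "\<not> p dvd coeff (G * H) i" by (simp add: dvd_add_right_iff)
  then have "degree (G * H) \<le> i" using low not_le by blast
  then show ?thesis using ile nz by (simp add: degree_mult_eq)
qed

lemma eisenstein:
  fixes G H :: "int poly"
  assumes p: "prime (p::int)" and low: "\<And>i. i < degree (G * H) \<Longrightarrow> p dvd coeff (G * H) i"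
    and lead: "\<not> p dvd lead_coeff (G * H)" and const: "\<not> p ^ 2 dvd coeff (G * H) 0"
  shows "degree G = 0 \<or> degree H = 0"
proof (cases "degree (G * H) = 0")
  case True
  moreover have "G \<noteq> 0" "H \<noteq> 0" using lead by auto
  ultimately show ?thesis by (simp add: degree_mult_eq)
next
  case False
  then have "p dvd coeff G 0 * coeff H 0" using low[of 0] by (simp add: coeff_mult_0)
  then consider "p dvd coeff G 0" | "p dvd coeff H 0" using p by (auto simp: prime_dvd_mult_iff)
  then show ?thesis
  proof cases
    case 1
    then have "\<not> p dvd coeff H 0" using const by (auto simp: coeff_mult_0 power2_eq_square mult_dvd_mono)
    then show ?thesis using eisenstein_aux[OF p low lead 1] by simp
  next
    case 2
    then have "\<not> p dvd coeff G 0" using const by (auto simp: coeff_mult_0 power2_eq_square mult_dvd_mono)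
    then show ?thesis using eisenstein_aux[OF p, of H G] low lead 2 by (simp add: mult.commute)
  qed
qed

lemma prime_dvd_choose_prime_power:
  assumes p: "prime (p::nat)" and i: "0 < i" "i < p ^ k"
  shows "p dvd (p ^ k choose i)"
proof (rule ccontr)
  assume "\<not> p dvd (p ^ k choose i)"
  then have "coprime (p ^ k) (p ^ k choose i)"
    using p prime_imp_coprime by (metis coprime_power_left_iff)
  moreover have "i * (p ^ k choose i) = p ^ k * ((p ^ k - 1) choose (i - 1))"
    using times_binomial_minus1_eq[OF i(1)] by simp
  then have "p ^ k dvd i * (p ^ k choose i)" by simp
  ultimately have "p ^ k dvd i" by (simp add: coprime_dvd_mult_left_iff)
  then show False using i by (simp add: dvd_imp_le leD)
qed

text \<open>
The binomial theorem modulo \<open>p\<close>; it makes the cyclotomic polynomial an Eisenstein polynomial after the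
substitution of \<open>1 + X\<close> for \<open>X\<close>.
\<close>

lemma one_plus_X_prime_power:
  assumes p: "prime (p::nat)"
  shows "\<exists>R. [:1, 1:] ^ (p ^ k) = 1 + monom 1 (p ^ k) + smult (int p) R"
proof -
  let ?f = "[:1, 1:] ^ (p ^ k) - 1 - monom 1 (p ^ k) :: int poly"
  have pk: "p ^ k > 0" using p by (simp add: prime_gt_0_nat)
  have "int p dvd coeff ?f i" for i
  proof -
    have c: "coeff ([:1, 1:] ^ (p ^ k) :: int poly) i = int (p ^ k choose i)"
    proof (cases "i \<le> p ^ k")
      case True
      then show ?thesis using coeff_linear_poly_power[of i "p ^ k" 1 "1::int"] by simp
    next
      case False
      moreover have "degree ([:1, 1:] ^ (p ^ k) :: int poly) = p ^ k" by (simp add: degree_power_eq)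
      ultimately show ?thesis by (simp add: coeff_eq_0 binomial_eq_0)
    qed
    consider "i = 0" | "i = p ^ k" | "0 < i" "i < p ^ k" | "i > p ^ k" by linarith
    then show ?thesis
      by cases (use c pk prime_dvd_choose_prime_power[OF p, of i k] in \<open>auto simp: binomial_eq_0\<close>)
  qed
  then have "[:int p:] dvd ?f" by (simp add: const_poly_dvd_iff)
  then obtain R where R: "?f = [:int p:] * R" by auto
  then have "[:1, 1:] ^ (p ^ k) = 1 + monom 1 (p ^ k) + [:int p:] * R" by (simp add: algebra_simps)
  then show ?thesis by auto
qed

text \<open>
This is the cyclotomic polynomial of index \<open>p ^ Suc k\<close>.
\<close>

definition cyclotomic_prime_power :: "nat \<Rightarrow> nat \<Rightarrow> int poly" where
  "cyclotomic_prime_power p k = (\<Sum>i<p. monom 1 (i * p ^ k))"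

lemma cyclotomic_prime_power_mult:
  "cyclotomic_prime_power p k * (monom 1 (p ^ k) - 1) = monom 1 (p ^ Suc k) - 1"
proof -
  have "cyclotomic_prime_power p k = (\<Sum>i<p. monom 1 (p ^ k) ^ i)"
    by (simp add: cyclotomic_prime_power_def monom_power mult.commute)
  moreover have "(monom 1 (p ^ k) :: int poly) ^ p - 1 = (monom 1 (p ^ k) - 1) * (\<Sum>i<p. monom 1 (p ^ k) ^ i)"
    by (simp add: power_diff_1_eq)
  ultimately show ?thesis by (simp add: monom_power mult.commute)
qed

lemma degree_cyclotomic_prime_power:
  assumes p: "prime (p::nat)"
  shows "degree (cyclotomic_prime_power p k) + p ^ k = p ^ Suc k"
    and "lead_coeff (cyclotomic_prime_power p k) = 1"
proof -
  have d: "degree (monom 1 n - 1 :: int poly) = n" "lead_coeff (monom 1 n - 1 :: int poly) = 1" if "n > 0" for n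
  proof -
    have "degree (monom 1 n + (-1) :: int poly) = degree (monom 1 n :: int poly)"
      by (rule degree_add_eq_left) (use that in \<open>simp add: degree_monom_eq\<close>)
    then show "degree (monom 1 n - 1 :: int poly) = n" by (simp add: degree_monom_eq)
    then show "lead_coeff (monom 1 n - 1 :: int poly) = 1" using that by simp
  qed
  let ?C = "cyclotomic_prime_power p k"
  have pk: "p ^ k > 0" "p ^ Suc k > 0" using p by (simp_all add: prime_gt_0_nat)
  have nz: "monom 1 (p ^ k) - 1 \<noteq> (0::int poly)" using d(2)[OF pk(1)] by force
  have "?C \<noteq> 0"
    using cyclotomic_prime_power_mult[of p k] d(2)[OF pk(2)] by force
  then show "degree ?C + p ^ k = p ^ Suc k"
    using arg_cong[OF cyclotomic_prime_power_mult[of p k], of degree] d(1) pk nz by (simp add: degree_mult_eq)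
  show "lead_coeff ?C = 1"
    using arg_cong[OF cyclotomic_prime_power_mult[of p k], of lead_coeff] d(2)[OF pk(1)] d(2)[OF pk(2)]
    by (simp only: lead_coeff_mult mult_1_right)
qed

text \<open>
Substitute \<open>1 + X\<close> for \<open>X\<close> in the identity \<open>\<Phi> (X ^ (p ^ k) - 1) = X ^ (p ^ Suc k) - 1\<close> and reduce modulo
\<open>p\<close>: the result is \<open>\<Phi> X ^ (p ^ k) = X ^ (p ^ Suc k)\<close>, so \<open>\<Phi>\<close> becomes a power of \<open>X\<close>. Its constant
coefficient is the value \<open>p\<close> of \<open>\<Phi>\<close> at \<open>1\<close>.
\<close>

lemma cyclotomic_prime_power_irreducible:
  assumes p: "prime (p::nat)" and GH: "cyclotomic_prime_power p k = G * H"
  shows "degree G = 0 \<or> degree H = 0"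
proof -
  let ?C = "cyclotomic_prime_power p k"
  let ?s = "[:1, 1:] :: int poly"
  let ?D = "pcompose ?C ?s"
  note deg = degree_cyclotomic_prime_power[OF p, of k]
  have pcm: "pcompose (monom 1 n) ?s = ?s ^ n" for n
    by (induction n) (simp_all add: monom_Suc pcompose_pCons pcompose_1 one_pCons[symmetric] mult.commute)
  have D: "?D = pcompose G ?s * pcompose H ?s" using GH by (simp add: pcompose_mult)
  have dD: "degree ?D = degree ?C" by (simp add: degree_pcompose)
  have eq: "?D * (?s ^ (p ^ k) - 1) = ?s ^ (p ^ Suc k) - 1"
    using arg_cong[OF cyclotomic_prime_power_mult[of p k], of "\<lambda>f. pcompose f ?s"]
    by (simp add: pcompose_mult pcompose_diff pcm del: power_Suc)
  obtain R where R: "?s ^ (p ^ k) = 1 + monom 1 (p ^ k) + smult (int p) R"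
    using one_plus_X_prime_power[OF p] by blast
  obtain R' where R': "?s ^ (p ^ Suc k) = 1 + monom 1 (p ^ Suc k) + smult (int p) R'"
    using one_plus_X_prime_power[OF p] by blast
  have eq': "?D * monom 1 (p ^ k) = monom 1 (p ^ Suc k) + smult (int p) (R' - ?D * R)"
    using eq unfolding R R' by (simp add: algebra_simps smult_diff_right)
  have low: "int p dvd coeff ?D i" if "i < degree ?D" for i
  proof -
    have "coeff ?D i = coeff (?D * monom 1 (p ^ k)) (i + p ^ k)"
      by (simp add: mult.commute[of _ "monom 1 (p ^ k)"] coeff_monom_mult)
    also have "\<dots> = int p * coeff (R' - ?D * R) (i + p ^ k)"
      unfolding eq' using that dD deg(1) by (simp add: coeff_monom)
    finally show ?thesis by simp
  qed
  have lead: "lead_coeff ?D = 1" using deg(2) by (subst lead_coeff_comp) simp_all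
  have const: "coeff ?D 0 = int p"
    by (simp add: poly_0_coeff_0[symmetric] poly_pcompose cyclotomic_prime_power_def poly_sum poly_monom)
  have "degree (pcompose G ?s) = 0 \<or> degree (pcompose H ?s) = 0"
  proof (rule eisenstein)
    show "prime (int p)" using p by simp
    show "\<not> int p dvd lead_coeff (pcompose G ?s * pcompose H ?s)"
      unfolding lead[unfolded D] using prime_gt_1_nat[OF p] by simp
    show "\<not> (int p)\<^sup>2 dvd coeff (pcompose G ?s * pcompose H ?s) 0"
    proof
      assume "(int p)\<^sup>2 dvd coeff (pcompose G ?s * pcompose H ?s) 0"
      then have "int p * int p dvd int p * 1" using const D by (simp add: power2_eq_square)
      then have "int p dvd 1" using p prime_gt_0_nat by (subst (asm) dvd_mult_cancel_left) auto
      then show False using prime_gt_1_nat[OF p] by simp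
    qed
  qed (use low D in auto)
  then show ?thesis by (simp add: degree_pcompose)
qed

abbreviation ipoly :: "int poly \<Rightarrow> complex \<Rightarrow> complex" where
  "ipoly f x \<equiv> poly (map_poly of_int f) x"

text \<open>
All primitive roots of unity of order \<open>p ^ Suc k\<close> are conjugate over \<open>\<rat>\<close>. A nonzero integer polynomial \<open>m\<close> of
least degree with root \<open>\<alpha>\<close> may be taken primitive; by pseudo-division and Gauss's lemma it then divides every
integer polynomial with root \<open>\<alpha>\<close>, in particular the cyclotomic polynomial, to which it is proportional by
irreducibility.
\<close>

lemma ipoly_prime_power_root_conjugate:
  fixes \<alpha> \<beta> :: complex
  assumes p: "prime (p::nat)"
    and \<alpha>: "\<alpha> ^ (p ^ Suc k) = 1" "\<alpha> ^ (p ^ k) \<noteq> 1"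
    and \<beta>: "\<beta> ^ (p ^ Suc k) = 1" "\<beta> ^ (p ^ k) \<noteq> 1"
    and f: "ipoly f \<alpha> = 0"
  shows "ipoly f \<beta> = 0"
proof -
  let ?C = "cyclotomic_prime_power p k"
  have C0: "ipoly ?C x = 0" if "x ^ (p ^ Suc k) = 1" "x ^ (p ^ k) \<noteq> 1" for x
  proof -
    have "ipoly ?C x * (x ^ (p ^ k) - 1) = x ^ (p ^ Suc k) - 1"
      using arg_cong[OF cyclotomic_prime_power_mult[of p k], of "\<lambda>f. ipoly f x"]
      by (simp add: hom_distribs poly_monom del: power_Suc)
    then show ?thesis using that by simp
  qed
  have Cnz: "?C \<noteq> 0" using degree_cyclotomic_prime_power(2)[OF p, of k] by force
  let ?Z = "\<lambda>m. m \<noteq> 0 \<and> ipoly m \<alpha> = 0"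
  obtain m0 where m0: "?Z m0" "\<And>g. ?Z g \<Longrightarrow> degree m0 \<le> degree g"
    using ex_has_least_nat[of ?Z ?C degree] Cnz C0[OF \<alpha>] by blast
  define m where "m = primitive_part m0"
  have m0m: "m0 = smult (content m0) m" by (simp add: m_def)
  have cont: "content m = 1" using m0 by (simp add: m_def)
  have mnz: "m \<noteq> 0" using m0 by (simp add: m_def)
  have degm: "degree m = degree m0" by (simp add: m_def)
  have m\<alpha>: "ipoly m \<alpha> = 0"
  proof -
    have "ipoly m0 \<alpha> = of_int (content m0) * ipoly m \<alpha>"
      by (subst m0m) (simp add: hom_distribs)
    then show ?thesis using m0 by simp
  qed
  have dvd: "m dvd g" if g: "ipoly g \<alpha> = 0" for g
  proof -
    obtain q r where qr: "pseudo_divmod g m = (q, r)" by fastforce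
    define c where "c = coeff m (degree m) ^ (Suc (degree g) - degree m)"
    have eq: "smult c g = m * q + r" and r: "r = 0 \<or> degree r < degree m"
      using pseudo_divmod[OF mnz qr] by (auto simp: c_def)
    have c: "c \<noteq> 0" using mnz by (simp add: c_def)
    have "ipoly (smult c g) \<alpha> = ipoly (m * q + r) \<alpha>" using eq by simp
    then have "ipoly r \<alpha> = 0" using g m\<alpha> by (simp add: hom_distribs)
    then have "r = 0" using r m0(2)[of r] degm by (metis not_less)
    then have eq: "smult c g = m * q" using eq by simp
    then have "content q = normalize c * content g"
      using cont by (metis content_mult content_smult mult_1)
    then have "c dvd content q" by (metis dvd_triv_left normalize_dvd_iff dvd_mult2 dvd_refl)
    then have "[:c:] dvd q" by (simp add: const_poly_dvd_iff_dvd_content)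
    then obtain q' where "q = smult c q'" by auto
    then have "smult c g = smult c (m * q')" using eq by simp
    then have "g = m * q'" using c by (simp add: smult_cancel)
    then show ?thesis by simp
  qed
  obtain h where h: "?C = m * h" using dvd[OF C0[OF \<alpha>]] by auto
  have "degree m \<noteq> 0"
  proof
    assume "degree m = 0"
    then obtain c where "m = [:c:]" by (auto elim: degree_eq_zeroE)
    then show False using m\<alpha> mnz by simp
  qed
  then have "degree h = 0" using cyclotomic_prime_power_irreducible[OF p h] by simp
  then obtain c where c: "h = [:c:]" by (auto elim: degree_eq_zeroE)
  then have "c \<noteq> 0" using h Cnz by auto
  moreover have "of_int c * ipoly m \<beta> = 0"
    using C0[OF \<beta>] unfolding h c by (simp add: hom_distribs)
  ultimately have "ipoly m \<beta> = 0" by simp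
  moreover obtain f' where "f = m * f'" using dvd[OF f] by auto
  ultimately show ?thesis by (simp add: hom_distribs)
qed

lemma prime_power_root_order:
  fixes \<alpha> :: complex
  assumes p: "prime (p::nat)" and \<alpha>: "\<alpha> ^ (p ^ Suc k) = 1" "\<alpha> ^ (p ^ k) \<noteq> 1" and j: "\<alpha> ^ j = 1"
  shows "p ^ Suc k dvd j"
proof -
  have \<alpha>0: "\<alpha> \<noteq> 0" using \<alpha>(1) p by (metis power_0_left power_eq_0_iff prime_gt_0_nat zero_neq_one not_prime_0)
  have g: "\<alpha> ^ gcd j (p ^ Suc k) = 1"
  proof (cases "j = 0")
    case False
    obtain x y where "j * x = p ^ Suc k * y + gcd j (p ^ Suc k)"
      using bezout_nat[OF False] by blast
    then have "\<alpha> ^ (j * x) = \<alpha> ^ (p ^ Suc k * y) * \<alpha> ^ gcd j (p ^ Suc k)"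
      by (metis power_add)
    then show ?thesis using j \<alpha>(1) by (simp add: power_mult del: power_Suc)
  qed (use \<alpha> in simp)
  obtain i where i: "gcd j (p ^ Suc k) = p ^ i" "i \<le> Suc k"
    using divides_primepow_nat[OF p, of "gcd j (p ^ Suc k)" "Suc k"] by auto
  have "i = Suc k"
  proof (rule ccontr)
    assume "i \<noteq> Suc k"
    then have "p ^ k = p ^ i * p ^ (k - i)" using i by (simp flip: power_add)
    then have "\<alpha> ^ (p ^ k) = 1" using g i by (simp add: power_mult)
    then show False using \<alpha> by simp
  qed
  then show ?thesis using i by (metis gcd_dvd1)
qed

lemma prime_root_of_unity_pow_ne_1:
  fixes \<eta> :: complex
  assumes p: "prime (p::nat)" and \<eta>: "\<eta> ^ p = 1" "\<eta> \<noteq> 1" and l: "0 < l" "l < p"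
  shows "\<eta> ^ l \<noteq> 1"
proof
  assume "\<eta> ^ l = 1"
  then have "p ^ Suc 0 dvd l"
    by (intro prime_power_root_order[OF p]) (use \<eta> in auto)
  then show False using l by (simp add: dvd_imp_le leD)
qed

lemma root_of_unity_pow: "(\<eta>::complex) ^ q = 1 \<Longrightarrow> (\<eta> ^ l) ^ q = 1"
  unfolding power_mult[symmetric] mult.commute[of l] unfolding power_mult by simp

lemma root_of_unity_nonzero: "\<alpha> ^ q = 1 \<Longrightarrow> q > 0 \<Longrightarrow> \<alpha> \<noteq> (0::complex)"
  by (auto simp: power_0_left)

lemma sum_powers_root_of_unity:
  fixes \<omega> :: complex
  assumes "\<omega> ^ n = 1" "\<omega> \<noteq> 1"
  shows "(\<Sum>t<n. \<omega> ^ t) = 0"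
proof -
  have "\<omega> ^ n - 1 = (\<omega> - 1) * (\<Sum>t<n. \<omega> ^ t)" by (rule power_diff_1_eq)
  then show ?thesis using assms by simp
qed

text \<open>
For a root of unity \<open>\<zeta>\<close> this is the field \<open>\<rat>(\<zeta>)\<close>: every element of it is the value of a rational polynomial at
\<open>\<zeta>\<close>, and the common denominator \<open>N\<close> is put on the other side to keep integer coefficients.
\<close>

definition rational_in :: "complex \<Rightarrow> complex set" where
  "rational_in \<zeta> = {x. \<exists>N f. N \<noteq> 0 \<and> of_int N * x = ipoly f \<zeta>}"

text \<open>
Let the sum equal \<open>s(\<zeta>)\<close>. This is a polynomial relation for \<open>\<alpha>\<close>, so it also holds for the conjugates
\<open>\<alpha> ^ (1 + p t)\<close> with \<open>t < p ^ k\<close>, which leave \<open>\<zeta>\<close> fixed. Adding these relations, the left hand side becomes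
\<open>0\<close>, since each term \<open>\<alpha> ^ a\<close> with \<open>a\<close> prime to \<open>p\<close> is multiplied by a full sum of powers of the root of unity
\<open>\<alpha> ^ (p a)\<close>, which is not \<open>1\<close> as \<open>k \<ge> 1\<close>.
\<close>

lemma sum_primitive_roots_eq_0:
  fixes \<alpha> \<zeta> :: complex and n :: "nat \<Rightarrow> nat"
  assumes p: "prime (p::nat)" and k: "k \<ge> 1"
    and \<alpha>: "\<alpha> ^ (p ^ Suc k) = 1" "\<alpha> ^ (p ^ k) \<noteq> 1" and \<zeta>: "\<zeta> = \<alpha> ^ (p ^ k * b)"
    and n: "\<And>a. a < p ^ Suc k \<Longrightarrow> p dvd a \<Longrightarrow> n a = 0"
    and mem: "(\<Sum>a<p ^ Suc k. of_nat (n a) * \<alpha> ^ a) \<in> rational_in \<zeta>"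
  shows "(\<Sum>a<p ^ Suc k. of_nat (n a) * \<alpha> ^ a) = 0"
proof -
  let ?I = "{..<p ^ Suc k}"
  obtain N s where N: "N \<noteq> 0" "of_int N * (\<Sum>a\<in>?I. of_nat (n a) * \<alpha> ^ a) = ipoly s \<zeta>"
    using mem by (auto simp: rational_in_def)
  let ?f = "(\<Sum>a\<in>?I. monom (N * int (n a)) a) - pcompose s (monom 1 (p ^ k * b))"
  have ev: "ipoly ?f x = of_int N * (\<Sum>a\<in>?I. of_nat (n a) * x ^ a) - ipoly s (x ^ (p ^ k * b))" for x
    by (simp add: hom_distribs poly_sum poly_monom sum_distrib_left mult.assoc
        poly_pcompose)
  let ?\<beta> = "\<lambda>t. \<alpha> ^ (1 + p * t)"
  have *: "of_int N * (\<Sum>a\<in>?I. of_nat (n a) * ?\<beta> t ^ a) = ipoly s \<zeta>" for t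
  proof -
    have 1: "?\<beta> t ^ (p ^ k) = \<alpha> ^ (p ^ k)"
    proof -
      have "?\<beta> t ^ (p ^ k) = \<alpha> ^ (p ^ k) * (\<alpha> ^ (p ^ Suc k)) ^ t"
        by (simp flip: power_mult power_add add: algebra_simps)
      then show ?thesis using \<alpha> by simp
    qed
    have 2: "?\<beta> t ^ (p ^ Suc k) = 1"
      using \<alpha>(1) by (metis power_mult power_one mult.commute)
    have "ipoly ?f (?\<beta> t) = 0"
      by (rule ipoly_prime_power_root_conjugate[OF p \<alpha> 2])
        (use 1 \<alpha> N \<zeta> ev[of \<alpha>] in auto)
    moreover have "?\<beta> t ^ (p ^ k * b) = \<zeta>" unfolding \<zeta> power_mult 1 ..
    ultimately show ?thesis using ev[of "?\<beta> t"] by simp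
  qed
  have "of_nat (p ^ k) * ipoly s \<zeta> = (\<Sum>t<p ^ k. of_int N * (\<Sum>a\<in>?I. of_nat (n a) * ?\<beta> t ^ a))"
    unfolding * by simp
  also have "\<dots> = of_int N * (\<Sum>a\<in>?I. of_nat (n a) * (\<Sum>t<p ^ k. ?\<beta> t ^ a))"
    unfolding sum_distrib_left by (subst sum.swap) simp
  also have "(\<Sum>a\<in>?I. of_nat (n a) * (\<Sum>t<p ^ k. ?\<beta> t ^ a)) = 0"
  proof (rule sum.neutral, rule ballI)
    fix a assume a: "a \<in> ?I"
    show "of_nat (n a) * (\<Sum>t<p ^ k. ?\<beta> t ^ a) = 0"
    proof (cases "p dvd a")
      case True
      then show ?thesis using n a by simp
    next
      case False
      let ?\<omega> = "\<alpha> ^ (p * a)"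
      have "?\<omega> \<noteq> 1"
      proof
        assume "?\<omega> = 1"
        then have "p ^ Suc k dvd p * a" by (rule prime_power_root_order[OF p \<alpha>])
        then have "p ^ k dvd a" using p by (simp add: prime_gt_0_nat)
        moreover have "p dvd p ^ k" using k by (cases k) auto
        ultimately show False using False dvd_trans by blast
      qed
      moreover have "?\<omega> ^ (p ^ k) = 1"
      proof -
        have "?\<omega> ^ (p ^ k) = (\<alpha> ^ (p ^ Suc k)) ^ a" by (simp flip: power_mult add: mult_ac)
        then show ?thesis using \<alpha> by simp
      qed
      ultimately have "(\<Sum>t<p ^ k. ?\<omega> ^ t) = 0" by (intro sum_powers_root_of_unity)
      moreover have "?\<beta> t ^ a = \<alpha> ^ a * ?\<omega> ^ t" for t
        by (simp flip: power_mult power_add add: algebra_simps)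
      ultimately show ?thesis by (simp flip: sum_distrib_left)
    qed
  qed
  finally have "ipoly s \<zeta> = 0" using p by (simp add: prime_gt_0_nat)
  then show ?thesis using N by simp
qed

section \<open>Traces of idempotent matrices\<close>

lemma mat_trace_mult_commute:
  fixes A B :: "'a::comm_semiring_0 mat"
  assumes "A \<in> carrier_mat n m" "B \<in> carrier_mat m n"
  shows "mat_trace (A * B) = mat_trace (B * A)"
proof -
  have "mat_trace (A * B) = (\<Sum>i<n. \<Sum>j<m. A $$ (i, j) * B $$ (j, i))"
    using assms by (auto simp: mat_trace_def scalar_prod_def lessThan_atLeast0 intro!: sum.cong)
  also have "\<dots> = (\<Sum>j<m. \<Sum>i<n. B $$ (j, i) * A $$ (i, j))"
    by (subst sum.swap) (simp add: mult.commute)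
  also have "\<dots> = mat_trace (B * A)"
    using assms by (auto simp: mat_trace_def scalar_prod_def lessThan_atLeast0 intro!: sum.cong)
  finally show ?thesis .
qed

text \<open>
The diagonal entries are \<open>0\<close> or \<open>1\<close>. If they are all \<open>0\<close>, an entry at distance \<open>j - i\<close> from the diagonal is a sum
of products of entries closer to the diagonal, and these vanish by induction.
\<close>

lemma idempotent_upper_triangular:
  fixes B :: "complex mat"
  assumes B: "B \<in> carrier_mat n n" and ut: "upper_triangular B" and idem: "B * B = B"
  shows "mat_trace B \<in> \<nat>" and "mat_trace B = 0 \<Longrightarrow> B = 0\<^sub>m n n"
proof -
  have entry: "B $$ (i, j) = (\<Sum>k<n. B $$ (i, k) * B $$ (k, j))" if "i < n" "j < n" for i j
  proof -
    have "B $$ (i, j) = (B * B) $$ (i, j)" using idem by simp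
    also have "\<dots> = (\<Sum>k<n. B $$ (i, k) * B $$ (k, j))"
      using B that by (simp add: scalar_prod_def lessThan_atLeast0)
    finally show ?thesis .
  qed
  have low: "B $$ (i, j) = 0" if "j < i" "i < n" for i j
    using ut B that by auto
  have diag: "B $$ (i, i) = 0 \<or> B $$ (i, i) = 1" if i: "i < n" for i
  proof -
    note entry[OF i i]
    also have "(\<Sum>k<n. B $$ (i, k) * B $$ (k, i)) = (\<Sum>k<n. if k = i then B $$ (i, i) * B $$ (i, i) else 0)"
      by (rule sum.cong) (use low i in \<open>auto simp: neq_iff\<close>)
    finally have "B $$ (i, i) = B $$ (i, i) * B $$ (i, i)" using i by simp
    then show ?thesis by simp
  qed
  have tr: "mat_trace B = of_nat (card {i. i < n \<and> B $$ (i, i) = 1})"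
  proof -
    have "mat_trace B = (\<Sum>i<n. if B $$ (i, i) = 1 then 1 else 0)"
      using B by (auto simp: mat_trace_def intro!: sum.cong dest: diag)
    also have "\<dots> = of_nat (card ({..<n} \<inter> {i. B $$ (i, i) = 1}))"
      by (simp add: sum.If_cases)
    also have "{..<n} \<inter> {i. B $$ (i, i) = 1} = {i. i < n \<and> B $$ (i, i) = 1}" by auto
    finally show ?thesis .
  qed
  then show "mat_trace B \<in> \<nat>" by simp
  assume "mat_trace B = 0"
  then have "{i. i < n \<and> B $$ (i, i) = 1} = {}" using tr by simp
  then have diag0: "B $$ (i, i) = 0" if "i < n" for i using diag[OF that] that by auto
  have zero: "B $$ (i, j) = 0" if "i < n" "j < n" for i j
    using that
  proof (induction "j - i" arbitrary: i j rule: less_induct)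
    case less
    have "B $$ (i, k) * B $$ (k, j) = 0" if "k < n" for k
    proof (cases "i < k \<and> k < j")
      case True
      then show ?thesis using less.hyps[of k i] less.prems that by (simp add: diff_less_mono)
    next
      case False
      then consider "k < i" | "k = i" | "k = j" | "j < k" by linarith
      then show ?thesis by cases (use low diag0 less.prems that in auto)
    qed
    then show ?case using entry[OF less.prems] by (simp add: sum.neutral)
  qed
  show "B = 0\<^sub>m n n" by (rule eq_matI) (use B zero in auto)
qed

lemma idempotent_mat_trace:
  fixes A :: "complex mat"
  assumes A: "A \<in> carrier_mat n n" and idem: "A * A = A"
  shows "mat_trace A \<in> \<nat>" and "mat_trace A = 0 \<Longrightarrow> A = 0\<^sub>m n n"
proof -
  obtain cs where "char_poly A = (\<Prod>c\<leftarrow>cs. [:- c, 1:])"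
    using char_poly_factorized[OF A] by auto
  then obtain B P Q where wit: "similar_mat_wit A B P Q" and ut: "upper_triangular B"
    using schur_decomposition[OF A] by (metis prod_cases3)
  note c = similar_mat_witD2[OF A wit]
  have dims: "A \<in> carrier_mat n n" "B \<in> carrier_mat n n" "P \<in> carrier_mat n n" "Q \<in> carrier_mat n n"
    using c by auto
  note assoc = assoc_mult_mat[of _ n n _ n _ n]
  have Beq: "B = Q * A * P"
  proof -
    have "Q * A * P = Q * (P * B * Q) * P" using c(3) by simp
    also have "\<dots> = (Q * P) * B * (Q * P)" using dims by (simp add: assoc)
    also have "\<dots> = B" unfolding c(2) using dims by simp
    finally show ?thesis ..
  qed
  have Bid: "B * B = B"
  proof -
    have "B * B = Q * A * (P * Q) * A * P" unfolding Beq using dims by (simp add: assoc)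
    also have "\<dots> = Q * (A * A) * P" unfolding c(1) using dims by (simp add: assoc)
    finally show ?thesis using idem Beq by simp
  qed
  have tr: "mat_trace A = mat_trace B"
  proof -
    have "mat_trace A = mat_trace ((P * B) * Q)" using c(3) by simp
    also have "\<dots> = mat_trace (Q * (P * B))"
      by (rule mat_trace_mult_commute[of _ n n]) (use dims in auto)
    also have "Q * (P * B) = Q * P * B" using dims by (simp add: assoc)
    also have "\<dots> = B" unfolding c(2) using dims by simp
    finally show ?thesis .
  qed
  have B: "B \<in> carrier_mat n n" using c by simp
  show "mat_trace A \<in> \<nat>" using idempotent_upper_triangular(1)[OF B ut Bid] tr by simp
  assume "mat_trace A = 0"
  then have "B = 0\<^sub>m n n" using idempotent_upper_triangular(2)[OF B ut Bid] tr by simp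
  then show "A = 0\<^sub>m n n" using c(3) dims by simp
qed

text \<open>
Square matrices of all sizes are embedded in one ring, so that finite sums and the ring laws of the type
class are available. The ring has no unit; a representation maps \<open>\<one>\<close> to an idempotent, and a
subrepresentation is obtained by multiplication with a smaller idempotent.
\<close>

typedef fin_mat = "{f :: nat \<Rightarrow> nat \<Rightarrow> complex. \<exists>d. \<forall>i j. f i j \<noteq> 0 \<longrightarrow> i < d \<and> j < d}"
  morphisms entry Abs_fin_mat
  by (rule exI[of _ "\<lambda>_ _. 0"]) auto

setup_lifting type_definition_fin_mat

definition fits :: "nat \<Rightarrow> (nat \<Rightarrow> nat \<Rightarrow> complex) \<Rightarrow> bool" where
  "fits d f \<longleftrightarrow> (\<forall>i j. f i j \<noteq> 0 \<longrightarrow> i < d \<and> j < d)"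

lemma fits_mono: "fits d f \<Longrightarrow> d \<le> d' \<Longrightarrow> fits d' f"
  unfolding fits_def by (meson less_le_trans)

lemma fits_sum_mult:
  assumes "fits d f"
  shows "(\<Sum>k\<in>{k. f i k \<noteq> 0}. f i k * g k) = (\<Sum>k<d. f i k * g k)"
  by (rule sum.mono_neutral_left) (use assms in \<open>auto simp: fits_def\<close>)

instantiation fin_mat :: ring
begin

lift_definition zero_fin_mat :: fin_mat is "\<lambda>_ _. 0" by auto

lift_definition plus_fin_mat :: "fin_mat \<Rightarrow> fin_mat \<Rightarrow> fin_mat" is "\<lambda>f g i j. f i j + g i j"
proof -
  fix f g :: "nat \<Rightarrow> nat \<Rightarrow> complex"
  assume "\<exists>d. \<forall>i j. f i j \<noteq> 0 \<longrightarrow> i < d \<and> j < d" "\<exists>d. \<forall>i j. g i j \<noteq> 0 \<longrightarrow> i < d \<and> j < d"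
  then obtain d e where "fits d f" "fits e g" unfolding fits_def by blast
  then have "fits (max d e) f" "fits (max d e) g" using fits_mono by auto
  then show "\<exists>d. \<forall>i j. f i j + g i j \<noteq> 0 \<longrightarrow> i < d \<and> j < d"
    unfolding fits_def by (metis add.right_neutral)
qed

lift_definition uminus_fin_mat :: "fin_mat \<Rightarrow> fin_mat" is "\<lambda>f i j. - f i j" by auto

definition minus_fin_mat :: "fin_mat \<Rightarrow> fin_mat \<Rightarrow> fin_mat" where
  "minus_fin_mat x y = x + (- y)"

lift_definition times_fin_mat :: "fin_mat \<Rightarrow> fin_mat \<Rightarrow> fin_mat" is
  "\<lambda>f g i j. \<Sum>k\<in>{k. f i k \<noteq> 0}. f i k * g k j"
proof -
  fix f g :: "nat \<Rightarrow> nat \<Rightarrow> complex"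
  assume "\<exists>d. \<forall>i j. f i j \<noteq> 0 \<longrightarrow> i < d \<and> j < d" "\<exists>d. \<forall>i j. g i j \<noteq> 0 \<longrightarrow> i < d \<and> j < d"
  then obtain d e where "fits d f" "fits e g" unfolding fits_def by blast
  then have *: "fits (max d e) f" "fits (max d e) g" using fits_mono by auto
  show "\<exists>d. \<forall>i j. (\<Sum>k\<in>{k. f i k \<noteq> 0}. f i k * g k j) \<noteq> 0 \<longrightarrow> i < d \<and> j < d"
  proof (intro exI allI impI)
    fix i j assume "(\<Sum>k\<in>{k. f i k \<noteq> 0}. f i k * g k j) \<noteq> 0"
    then obtain k where "f i k * g k j \<noteq> 0" by (meson sum.neutral)
    then show "i < max d e \<and> j < max d e" using * unfolding fits_def by (metis mult_eq_0_iff)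
  qed
qed

lemma entry_fits: "\<exists>d. fits d (entry x)"
  using entry[of x] by (auto simp: fits_def)

lemma entry_simps:
  "entry 0 i j = 0" "entry (x + y) i j = entry x i j + entry y i j" "entry (- x) i j = - entry x i j"
  by (transfer, simp)+

lemma entry_times:
  "fits d (entry x) \<Longrightarrow> entry (x * y) i j = (\<Sum>k<d. entry x i k * entry y k j)"
  using fits_sum_mult[of d "entry x" i "\<lambda>k. entry y k j"] by (simp add: times_fin_mat.rep_eq)

lemma fin_mat_eqI: "(\<And>i j. entry x i j = entry y i j) \<Longrightarrow> x = y"
  by (simp add: entry_inject[symmetric] fun_eq_iff)

lemma fits_times:
  assumes "fits d (entry x)" "fits d (entry y)"
  shows "fits d (entry (x * y))"
  unfolding fits_def entry_times[OF assms(1)]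
proof (intro allI impI)
  fix i j assume "(\<Sum>k<d. entry x i k * entry y k j) \<noteq> 0"
  then obtain k where "entry x i k * entry y k j \<noteq> 0" by (meson sum.neutral)
  then show "i < d \<and> j < d" using assms unfolding fits_def by (metis mult_eq_0_iff)
qed

instance
proof
  fix x y z :: fin_mat
  obtain a b c where "fits a (entry x)" "fits b (entry y)" "fits c (entry z)"
    using entry_fits by meson
  then obtain d where d: "fits d (entry x)" "fits d (entry y)" "fits d (entry z)"
    by (meson fits_mono max.cobounded1 max.cobounded2 order_trans)
  show "x * y * z = x * (y * z)"
  proof (rule fin_mat_eqI)
    fix i j
    have "entry (x * y * z) i j = (\<Sum>k<d. \<Sum>l<d. entry x i l * entry y l k * entry z k j)"
      by (simp add: entry_times[OF fits_times[OF d(1,2)]] entry_times[OF d(1)] sum_distrib_right)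
    also have "\<dots> = (\<Sum>l<d. entry x i l * (\<Sum>k<d. entry y l k * entry z k j))"
      by (subst sum.swap) (simp add: sum_distrib_left mult.assoc)
    also have "\<dots> = entry (x * (y * z)) i j"
      by (simp add: entry_times[OF d(1)] entry_times[OF d(2)])
    finally show "entry (x * y * z) i j = entry (x * (y * z)) i j" .
  qed
  have dxy: "fits d (entry (x + y))"
    using d unfolding fits_def entry_simps by (metis add.right_neutral)
  show "(x + y) * z = x * z + y * z"
    by (rule fin_mat_eqI)
      (simp add: entry_times[OF d(1)] entry_times[OF d(2)] entry_times[OF dxy] entry_simps
        distrib_right sum.distrib)
  show "x * (y + z) = x * y + x * z"
    by (rule fin_mat_eqI)
      (simp add: entry_times[OF d(1)] entry_simps distrib_left sum.distrib)
qed (auto intro!: fin_mat_eqI simp: entry_simps minus_fin_mat_def)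

end

lift_definition scale :: "complex \<Rightarrow> fin_mat \<Rightarrow> fin_mat" is "\<lambda>c f i j. c * f i j" by auto

definition trace :: "fin_mat \<Rightarrow> complex" where
  "trace x = (\<Sum>i\<in>{i. entry x i i \<noteq> 0}. entry x i i)"

lemma entry_scale: "entry (scale c x) i j = c * entry x i j"
  by transfer simp

lemma trace_eq: "fits d (entry x) \<Longrightarrow> trace x = (\<Sum>i<d. entry x i i)"
  unfolding trace_def by (rule sum.mono_neutral_left) (auto simp: fits_def)

lemma fits_scale: "fits d (entry x) \<Longrightarrow> fits d (entry (scale c x))"
  by (auto simp: fits_def entry_scale)

lemma common_fits: obtains d where "fits d (entry x)" "fits d (entry y)"
  by (meson entry_fits fits_mono max.cobounded1 max.cobounded2)

lemma scale_mult_left: "scale c x * y = scale c (x * y)"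
proof -
  obtain d where d: "fits d (entry x)" using entry_fits by blast
  show ?thesis
    by (rule fin_mat_eqI)
      (simp add: entry_times[OF d] entry_times[OF fits_scale[OF d]] entry_scale sum_distrib_left mult.assoc)
qed

lemma scale_mult_right: "x * scale c y = scale c (x * y)"
proof -
  obtain d where d: "fits d (entry x)" using entry_fits by blast
  show ?thesis
    by (rule fin_mat_eqI) (simp add: entry_times[OF d] entry_scale sum_distrib_left mult_ac)
qed

lemma trace_scale: "trace (scale c x) = c * trace x"
proof -
  obtain d where d: "fits d (entry x)" using entry_fits by blast
  show ?thesis by (simp add: trace_eq[OF d] trace_eq[OF fits_scale[OF d]] entry_scale sum_distrib_left)
qed

lemma trace_add: "trace (x + y) = trace x + trace y"
proof -
  obtain d where d: "fits d (entry x)" "fits d (entry y)" using common_fits by blast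
  then have "fits d (entry (x + y))" unfolding fits_def entry_simps by (metis add.right_neutral)
  then show ?thesis by (simp add: trace_eq[OF d(1)] trace_eq[OF d(2)] trace_eq entry_simps sum.distrib)
qed

lemma trace_mult_commute: "trace (x * y) = trace (y * x)"
proof -
  obtain d where d: "fits d (entry x)" "fits d (entry y)" using common_fits by blast
  have "trace (x * y) = (\<Sum>i<d. \<Sum>k<d. entry x i k * entry y k i)"
    by (simp add: trace_eq[OF fits_times[OF d]] entry_times[OF d(1)])
  also have "\<dots> = (\<Sum>k<d. \<Sum>i<d. entry y k i * entry x i k)"
    by (subst sum.swap) (simp add: mult.commute)
  also have "\<dots> = trace (y * x)"
    by (simp add: trace_eq[OF fits_times[OF d(2,1)]] entry_times[OF d(2)])
  finally show ?thesis .
qed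

lift_definition of_mat :: "complex mat \<Rightarrow> fin_mat" is
  "\<lambda>A i j. if i < dim_row A \<and> j < dim_col A then A $$ (i, j) else 0"
proof -
  fix A :: "complex mat"
  show "\<exists>d. \<forall>i j. (if i < dim_row A \<and> j < dim_col A then A $$ (i, j) else 0) \<noteq> 0 \<longrightarrow> i < d \<and> j < d"
    by (rule exI[of _ "max (dim_row A) (dim_col A)"]) auto
qed

lemma entry_of_mat:
  "A \<in> carrier_mat n n \<Longrightarrow> entry (of_mat A) i j = (if i < n \<and> j < n then A $$ (i, j) else 0)"
  by (simp add: of_mat.rep_eq carrier_matD[of A n n])

lemma fits_of_mat: "A \<in> carrier_mat n n \<Longrightarrow> fits n (entry (of_mat A))"
  by (simp add: fits_def entry_of_mat)

lemma of_mat_mult: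
  assumes "A \<in> carrier_mat n n" "B \<in> carrier_mat n n"
  shows "of_mat (A * B) = of_mat A * of_mat B"
proof (rule fin_mat_eqI)
  fix i j
  have AB: "A * B \<in> carrier_mat n n" using assms by simp
  show "entry (of_mat (A * B)) i j = entry (of_mat A * of_mat B) i j"
    using assms
    by (auto simp: entry_of_mat[OF AB] entry_times[OF fits_of_mat[OF assms(1)]] entry_of_mat
        scalar_prod_def lessThan_atLeast0 intro!: sum.cong)
qed

lemma of_mat_eq_iff:
  assumes "A \<in> carrier_mat n n" "B \<in> carrier_mat n n"
  shows "of_mat A = of_mat B \<longleftrightarrow> A = B"
proof
  assume "of_mat A = of_mat B"
  then have *: "entry (of_mat A) i j = entry (of_mat B) i j" for i j by simp
  show "A = B"
  proof (rule eq_matI)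
    fix i j assume "i < dim_row B" "j < dim_col B"
    then show "A $$ (i, j) = B $$ (i, j)" using *[of i j] assms by (simp add: entry_of_mat)
  qed (use assms in auto)
qed simp

lemma trace_of_mat: "A \<in> carrier_mat n n \<Longrightarrow> trace (of_mat A) = mat_trace A"
  by (simp add: trace_eq[OF fits_of_mat] entry_of_mat mat_trace_def)

lemma of_mat_surj: "\<exists>n A. A \<in> carrier_mat n n \<and> x = of_mat A"
proof -
  obtain d where d: "fits d (entry x)" using entry_fits by blast
  let ?A = "mat d d (\<lambda>(i, j). entry x i j)"
  have A: "?A \<in> carrier_mat d d" by simp
  have "x = of_mat ?A"
    by (rule fin_mat_eqI, unfold entry_of_mat[OF A]) (use d in \<open>auto simp: fits_def\<close>)
  then show ?thesis using A by blast
qed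

text \<open>
The trace of an idempotent is the dimension of its image.
\<close>

lemma idempotent_trace:
  assumes "x * x = x"
  shows "trace x \<in> \<nat>" and "trace x = 0 \<Longrightarrow> x = 0"
proof -
  obtain n A where A: "A \<in> carrier_mat n n" and x: "x = of_mat A" using of_mat_surj by blast
  have AA: "A * A \<in> carrier_mat n n" using A by simp
  have idem: "A * A = A" using assms of_mat_mult[OF A A] of_mat_eq_iff[OF AA A] x by simp
  show "trace x \<in> \<nat>" using idempotent_mat_trace(1)[OF A idem] trace_of_mat[OF A] x by simp
  assume "trace x = 0"
  then have "A = 0\<^sub>m n n" using idempotent_mat_trace(2)[OF A idem] trace_of_mat[OF A] x by simp
  then show "x = 0"
    unfolding x by (intro fin_mat_eqI) (simp add: entry_of_mat[of _ n] entry_simps)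
qed

section \<open>Eigenprojections in matrix representations\<close>

lemma scale_simps:
  "scale 1 x = x" "scale 0 x = 0" "scale c (0::fin_mat) = 0" "scale c (scale d x) = scale (c * d) x"
  "scale c (x + y) = scale c x + scale c y" "scale (c + d) x = scale c x + scale d x"
  by (rule fin_mat_eqI, simp add: entry_scale entry_simps algebra_simps)+

lemma scale_sum: "scale c (\<Sum>i\<in>I. f i) = (\<Sum>i\<in>I. scale c (f i))"
  by (induction I rule: infinite_finite_induct) (simp_all add: scale_simps)

lemma scale_sum_left: "scale (\<Sum>i\<in>I. c i) x = (\<Sum>i\<in>I. scale (c i) x)"
  by (induction I rule: infinite_finite_induct) (simp_all add: scale_simps)

lemma scale_eq_0_iff: "scale c x = 0 \<longleftrightarrow> c = 0 \<or> x = 0"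
proof
  assume *: "scale c x = 0"
  have "x = 0" if "c \<noteq> 0"
  proof -
    have "x = scale (inverse c) (scale c x)" using that by (simp add: scale_simps)
    then show ?thesis using * by (simp add: scale_simps)
  qed
  then show "c = 0 \<or> x = 0" by blast
qed (auto simp: scale_simps)

lemma scale_eq_scale_iff: "scale c x = scale d x \<longleftrightarrow> c = d \<or> x = 0"
proof
  assume "scale c x = scale d x"
  have "scale (c + - d) x = scale c x + scale (- d) x" by (rule scale_simps(6))
  also have "\<dots> = scale d x + scale (- d) x" using \<open>scale c x = scale d x\<close> by simp
  also have "\<dots> = scale (d + - d) x" by (rule scale_simps(6)[symmetric])
  also have "\<dots> = 0" by (simp add: scale_simps(2))
  finally have "scale (c - d) x = 0" by simp
  then show "c = d \<or> x = 0" by (simp add: scale_eq_0_iff)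
qed (auto simp: scale_simps)

lemma trace_sum: "trace (\<Sum>i\<in>I. f i) = (\<Sum>i\<in>I. trace (f i))"
proof -
  have "trace 0 = 0" by (simp add: trace_def entry_simps)
  then show ?thesis by (induction I rule: infinite_finite_induct) (simp_all add: trace_add)
qed

text \<open>
A representation of \<open>H\<close> on the image of the idempotent \<open>\<phi> \<one>\<close>. The subgroup \<open>H\<close> is a parameter, separate from
the group \<open>G\<close>, because the induction below passes to smaller subgroups of a fixed group.
\<close>

locale matrix_rep = group G for G (structure) +
  fixes H :: "'a set" and \<phi> :: "'a \<Rightarrow> fin_mat"
  assumes subgroup_H: "subgroup H G"
    and rep_mult: "\<And>x y. x \<in> H \<Longrightarrow> y \<in> H \<Longrightarrow> \<phi> (x \<otimes> y) = \<phi> x * \<phi> y"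
begin

lemma cut_by_idempotent:
  assumes idem: "E * E = E" and H': "subgroup H' G" "H' \<subseteq> H"
    and comm: "\<And>x. x \<in> H' \<Longrightarrow> \<phi> x * E = E * \<phi> x"
  shows "matrix_rep G H' (\<lambda>x. E * \<phi> x)"
proof (intro matrix_rep.intro matrix_rep_axioms.intro)
  fix x y assume x: "x \<in> H'" and y: "y \<in> H'"
  have "E * \<phi> x * (E * \<phi> y) = E * (\<phi> x * E) * \<phi> y" by (simp add: mult.assoc)
  also have "\<dots> = (E * E) * (\<phi> x * \<phi> y)" unfolding comm[OF x] by (simp add: mult.assoc)
  finally show "E * \<phi> (x \<otimes> y) = E * \<phi> x * (E * \<phi> y)"
    unfolding idem using x y H'(2) by (simp add: rep_mult subset_iff)
qed (use H' is_group in auto)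

text \<open>
If \<open>\<phi> (g [^] q) = \<phi> \<one>\<close> and \<open>\<alpha> ^ q = 1\<close>, this is the projection onto the eigenspace of \<open>\<phi> g\<close> for the
eigenvalue \<open>\<alpha>\<close>.
\<close>

definition eproj :: "nat \<Rightarrow> 'a \<Rightarrow> complex \<Rightarrow> fin_mat" where
  "eproj q g \<alpha> = scale (1 / of_nat q) (\<Sum>i<q. scale (inverse \<alpha> ^ i) (\<phi> (g [^] i)))"

lemma H_one: "\<one> \<in> H" and H_pow: "g \<in> H \<Longrightarrow> g [^] (n::nat) \<in> H" and H_carrier: "g \<in> H \<Longrightarrow> g \<in> carrier G"
  and H_inv: "g \<in> H \<Longrightarrow> inv g \<in> H" and H_mult: "g \<in> H \<Longrightarrow> h \<in> H \<Longrightarrow> g \<otimes> h \<in> H"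
proof -
  show one: "\<one> \<in> H" using subgroup.one_closed[OF subgroup_H] .
  show "g \<in> H \<Longrightarrow> g [^] (n::nat) \<in> H"
    by (induction n) (auto simp: one subgroup.m_closed[OF subgroup_H])
  show "g \<in> H \<Longrightarrow> g \<in> carrier G" using subgroup.mem_carrier[OF subgroup_H] .
  show "g \<in> H \<Longrightarrow> inv g \<in> H" using subgroup.m_inv_closed[OF subgroup_H] .
  show "g \<in> H \<Longrightarrow> h \<in> H \<Longrightarrow> g \<otimes> h \<in> H" using subgroup.m_closed[OF subgroup_H] .
qed

lemma rep_one_mult: "x \<in> H \<Longrightarrow> \<phi> \<one> * \<phi> x = \<phi> x" "x \<in> H \<Longrightarrow> \<phi> x * \<phi> \<one> = \<phi> x"
  by (simp_all flip: rep_mult add: H_one H_carrier)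

lemma eproj_trace_mult:
  "g \<in> H \<Longrightarrow> x \<in> H \<Longrightarrow>
    trace (eproj q g \<alpha> * \<phi> x) = 1 / of_nat q * (\<Sum>i<q. inverse \<alpha> ^ i * trace (\<phi> (g [^] i \<otimes> x)))"
  by (simp add: eproj_def scale_mult_left sum_distrib_right trace_scale trace_sum rep_mult H_pow)

lemma eproj_trace:
  "trace (eproj q g \<alpha>) = 1 / of_nat q * (\<Sum>i<q. inverse \<alpha> ^ i * trace (\<phi> (g [^] i)))"
  by (simp add: eproj_def trace_scale trace_sum)

lemma eproj_one: "g \<in> H \<Longrightarrow> \<phi> \<one> * eproj q g \<alpha> = eproj q g \<alpha>" "g \<in> H \<Longrightarrow> eproj q g \<alpha> * \<phi> \<one> = eproj q g \<alpha>"
  by (simp_all add: eproj_def scale_mult_left scale_mult_right sum_distrib_left sum_distrib_right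
      rep_one_mult H_pow)

lemma eproj_eigen:
  assumes g: "g \<in> H" and q: "q > 0" and gq: "\<phi> (g [^] q) = \<phi> \<one>" and \<alpha>: "\<alpha> ^ q = 1"
  shows "\<phi> g * eproj q g \<alpha> = scale \<alpha> (eproj q g \<alpha>)"
proof -
  have \<alpha>0: "\<alpha> \<noteq> 0" using root_of_unity_nonzero[OF \<alpha> q] .
  let ?c = "\<lambda>i. scale (inverse \<alpha> ^ i) (\<phi> (g [^] i))"
  have step: "\<phi> g * ?c i = scale \<alpha> (?c (Suc i))" for i
  proof -
    have "\<phi> g * \<phi> (g [^] i) = \<phi> (g [^] Suc i)"
      unfolding nat_pow_Suc2[OF H_carrier[OF g]] using g by (simp add: rep_mult H_pow)
    then show ?thesis using \<alpha>0 by (simp add: scale_mult_right scale_simps mult.assoc[symmetric] del: nat_pow_Suc)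
  qed
  have "(\<Sum>i<q. ?c (Suc i)) + ?c 0 = (\<Sum>i<q. ?c i) + ?c q"
    by (subst sum.lessThan_Suc[symmetric], subst sum.lessThan_Suc_shift) simp
  moreover have "?c q = ?c 0" using gq \<alpha> by (simp add: power_inverse)
  ultimately have "(\<Sum>i<q. ?c (Suc i)) = (\<Sum>i<q. ?c i)" by simp
  then have "\<phi> g * (\<Sum>i<q. ?c i) = scale \<alpha> (\<Sum>i<q. ?c i)"
    by (simp only: sum_distrib_left step scale_sum[symmetric])
  then show ?thesis
    unfolding eproj_def by (simp add: scale_mult_right scale_simps mult.commute)
qed

lemma eproj_eigen_pow:
  assumes g: "g \<in> H" and q: "q > 0" and gq: "\<phi> (g [^] q) = \<phi> \<one>" and \<alpha>: "\<alpha> ^ q = 1"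
  shows "\<phi> (g [^] (n::nat)) * eproj q g \<alpha> = scale (\<alpha> ^ n) (eproj q g \<alpha>)"
proof (induction n)
  case 0
  then show ?case using g by (simp add: eproj_one scale_simps)
next
  case (Suc n)
  have "\<phi> (g [^] Suc n) * eproj q g \<alpha> = \<phi> (g [^] n) * (\<phi> g * eproj q g \<alpha>)"
    using g by (simp add: rep_mult H_pow mult.assoc)
  then show ?case unfolding eproj_eigen[OF assms] using Suc by (simp add: scale_mult_right scale_simps)
qed

lemma eproj_idempotent:
  assumes g: "g \<in> H" and q: "q > 0" and gq: "\<phi> (g [^] q) = \<phi> \<one>" and \<alpha>: "\<alpha> ^ q = 1"
  shows "eproj q g \<alpha> * eproj q g \<alpha> = eproj q g \<alpha>"
proof -
  have \<alpha>0: "\<alpha> \<noteq> 0" using root_of_unity_nonzero[OF \<alpha> q] .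
  let ?E = "eproj q g \<alpha>"
  have "?E * ?E = scale (1 / of_nat q) (\<Sum>i<q. scale (inverse \<alpha> ^ i) (\<phi> (g [^] i) * ?E))"
    by (subst (1) eproj_def) (simp add: scale_mult_left sum_distrib_right)
  also have "\<dots> = scale (1 / of_nat q) (\<Sum>i<q. ?E)"
    using \<alpha>0 by (simp add: eproj_eigen_pow[OF assms] scale_simps power_mult_distrib[symmetric])
  also have "(\<Sum>i<q. ?E) = scale (of_nat q) ?E"
    using scale_sum_left[of "\<lambda>_. 1" "{..<q}" ?E] by (simp add: scale_simps)
  finally show ?thesis using q by (simp add: scale_simps)
qed

lemma eproj_nat_trace:
  assumes g: "g \<in> H" and q: "q > 0" and gq: "\<phi> (g [^] q) = \<phi> \<one>" and \<alpha>: "\<alpha> ^ q = 1"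
  obtains n where "trace (eproj q g \<alpha>) = of_nat n" "n = 0 \<longleftrightarrow> eproj q g \<alpha> = 0"
proof -
  note idem = idempotent_trace[OF eproj_idempotent[OF assms]]
  obtain n where n: "trace (eproj q g \<alpha>) = of_nat n" using idem(1) by (auto simp: Nats_def)
  have "trace 0 = 0" by (simp add: trace_def entry_simps)
  then have "n = 0 \<longleftrightarrow> eproj q g \<alpha> = 0" using idem(2) n by fastforce
  then show ?thesis using that n by blast
qed

text \<open>
An element that conjugates \<open>\<phi> g\<close> to a scalar multiple of itself permutes the eigenspaces of \<open>\<phi> g\<close>. With
\<open>\<gamma> = 1\<close> this says that elements commuting with \<open>\<phi> g\<close> preserve them.
\<close>

lemma eproj_intertwine:
  assumes g: "g \<in> H" and x: "x \<in> H" and comm: "\<phi> x * \<phi> g = scale \<gamma> (\<phi> g * \<phi> x)" and \<gamma>: "\<gamma> \<noteq> 0"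
  shows "\<phi> x * eproj q g \<alpha> = eproj q g (\<alpha> / \<gamma>) * \<phi> x"
proof -
  have *: "\<phi> x * \<phi> (g [^] i) = scale (\<gamma> ^ i) (\<phi> (g [^] i) * \<phi> x)" for i :: nat
  proof (induction i)
    case 0
    then show ?case using x by (simp add: rep_one_mult scale_simps)
  next
    case (Suc i)
    have "\<phi> x * \<phi> (g [^] Suc i) = (\<phi> x * \<phi> (g [^] i)) * \<phi> g"
      using g by (simp add: rep_mult H_pow mult.assoc)
    also have "\<dots> = scale (\<gamma> ^ i) (\<phi> (g [^] i) * (\<phi> x * \<phi> g))"
      unfolding Suc by (simp add: scale_mult_left mult.assoc)
    also have "\<dots> = scale (\<gamma> ^ Suc i) (\<phi> (g [^] Suc i) * \<phi> x)"
      unfolding comm using g by (simp add: scale_mult_right scale_simps rep_mult H_pow mult.assoc mult.commute[of \<gamma>])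
    finally show ?case .
  qed
  show ?thesis
    unfolding eproj_def
    by (simp add: scale_mult_left scale_mult_right sum_distrib_left sum_distrib_right * scale_simps
        power_mult_distrib[symmetric] divide_inverse mult.commute)
qed

text \<open>
The values \<open>\<beta> * \<eta> ^ l\<close> with \<open>l < q\<close> run through a coset of the \<open>q\<close>-th roots of unity, so by orthogonality only the
term of \<open>\<phi> \<one>\<close> survives in the double sum.
\<close>

lemma eproj_sum:
  assumes g: "g \<in> H" and q: "q > 0" and \<eta>: "\<eta> ^ q = 1" and prim: "\<And>i. 0 < i \<Longrightarrow> i < q \<Longrightarrow> \<eta> ^ i \<noteq> 1"
  shows "(\<Sum>l<q. eproj q g (\<beta> * \<eta> ^ l)) = \<phi> \<one>"
proof -
  have coeff: "(\<Sum>l<q. inverse (\<beta> * \<eta> ^ l) ^ i) = (if i = 0 then of_nat q else 0)" if i: "i < q" for i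
  proof (cases "i = 0")
    case False
    have \<eta>0: "\<eta> \<noteq> 0" using root_of_unity_nonzero[OF \<eta> q] .
    have "(\<Sum>l<q. inverse (\<beta> * \<eta> ^ l) ^ i) = inverse \<beta> ^ i * (\<Sum>l<q. (inverse (\<eta> ^ i)) ^ l)"
      by (simp add: sum_distrib_left power_mult_distrib power_inverse mult.commute flip: power_mult)
    also have "(\<Sum>l<q. (inverse (\<eta> ^ i)) ^ l) = 0"
    proof (rule sum_powers_root_of_unity)
      show "inverse (\<eta> ^ i) ^ q = 1" using \<eta> by (metis inverse_1 mult.commute power_inverse power_mult power_one)
      show "inverse (\<eta> ^ i) \<noteq> 1" using prim[of i] False i by (metis inverse_1 inverse_inverse_eq neq0_conv)
    qed
    finally show ?thesis using False by simp
  qed simp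
  have "(\<Sum>l<q. eproj q g (\<beta> * \<eta> ^ l)) =
    scale (1 / of_nat q) (\<Sum>l<q. \<Sum>i<q. scale (inverse (\<beta> * \<eta> ^ l) ^ i) (\<phi> (g [^] i)))"
    by (simp add: eproj_def scale_sum)
  also have "(\<Sum>l<q. \<Sum>i<q. scale (inverse (\<beta> * \<eta> ^ l) ^ i) (\<phi> (g [^] i))) =
    (\<Sum>i<q. scale (\<Sum>l<q. inverse (\<beta> * \<eta> ^ l) ^ i) (\<phi> (g [^] i)))"
    by (subst sum.swap) (simp add: scale_sum_left)
  also have "\<dots> = (\<Sum>i<q. if i = 0 then scale (of_nat q) (\<phi> \<one>) else 0)"
  proof (rule sum.cong)
    fix i assume "i \<in> {..<q}"
    then have "i < q" by simp
    show "scale (\<Sum>l<q. inverse (\<beta> * \<eta> ^ l) ^ i) (\<phi> (g [^] i)) =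
        (if i = 0 then scale (of_nat q) (\<phi> \<one>) else 0)"
      unfolding coeff[OF \<open>i < q\<close>] by (simp add: scale_simps)
  qed simp
  also have "\<dots> = scale (of_nat q) (\<phi> \<one>)" using q by simp
  finally show ?thesis using q by (simp add: scale_simps)
qed

text \<open>
The trace of a power as the sum of the powers of the eigenvalues, counted with multiplicity.
\<close>

lemma rep_pow_trace:
  assumes g: "g \<in> H" and q: "q > 0" and gq: "\<phi> (g [^] q) = \<phi> \<one>"
    and \<eta>: "\<eta> ^ q = 1" and prim: "\<And>i. 0 < i \<Longrightarrow> i < q \<Longrightarrow> \<eta> ^ i \<noteq> 1"
  shows "trace (\<phi> (g [^] (n::nat))) = (\<Sum>l<q. trace (eproj q g (\<eta> ^ l)) * (\<eta> ^ l) ^ n)"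
proof -
  have sum1: "(\<Sum>l<q. eproj q g (1 * \<eta> ^ l)) = \<phi> \<one>" by (rule eproj_sum[OF g q \<eta> prim])
  have "\<phi> (g [^] n) = \<phi> (g [^] n) * (\<Sum>l<q. eproj q g (1 * \<eta> ^ l))"
    unfolding sum1 using g by (simp add: rep_one_mult H_pow)
  also have "\<dots> = (\<Sum>l<q. scale ((\<eta> ^ l) ^ n) (eproj q g (\<eta> ^ l)))"
    unfolding sum_distrib_left
  proof (rule sum.cong)
    fix l
    have "(\<eta> ^ l) ^ q = 1" using \<eta> by (metis mult.commute power_mult power_one)
    from eproj_eigen_pow[OF g q gq this]
    show "\<phi> (g [^] n) * eproj q g (1 * \<eta> ^ l) = scale ((\<eta> ^ l) ^ n) (eproj q g (\<eta> ^ l))" by simp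
  qed simp
  finally have "trace (\<phi> (g [^] n)) = trace (\<Sum>l<q. scale ((\<eta> ^ l) ^ n) (eproj q g (\<eta> ^ l)))" by simp
  then show ?thesis by (simp add: trace_sum trace_scale mult.commute)
qed

end

lemma rational_inI: "N \<noteq> 0 \<Longrightarrow> of_int N * x = ipoly f \<zeta> \<Longrightarrow> x \<in> rational_in \<zeta>"
  unfolding rational_in_def by blast

lemma rational_in_add: "x \<in> rational_in \<zeta> \<Longrightarrow> y \<in> rational_in \<zeta> \<Longrightarrow> x + y \<in> rational_in \<zeta>"
proof -
  assume "x \<in> rational_in \<zeta>" "y \<in> rational_in \<zeta>"
  then obtain N f M g where *: "N \<noteq> 0" "of_int N * x = ipoly f \<zeta>" "M \<noteq> 0" "of_int M * y = ipoly g \<zeta>"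
    by (auto simp: rational_in_def)
  have "of_int (N * M) * (x + y) = of_int M * (of_int N * x) + of_int N * (of_int M * y)"
    by (simp add: algebra_simps)
  also have "\<dots> = ipoly (smult M f + smult N g) \<zeta>"
    unfolding * by (simp add: hom_distribs)
  finally have "of_int (N * M) * (x + y) = ipoly (smult M f + smult N g) \<zeta>" .
  moreover have "N * M \<noteq> 0" using * by simp
  ultimately show ?thesis by (intro rational_inI)
qed

lemma rational_in_0: "0 \<in> rational_in \<zeta>"
proof -
  have "of_int 1 * 0 = ipoly 0 \<zeta>" by simp
  then show ?thesis by (rule rational_inI[OF one_neq_zero])
qed

lemma rational_in_of_nat: "of_nat n \<in> rational_in \<zeta>"
proof -
  have "of_int 1 * of_nat n = ipoly (monom (int n) 0) \<zeta>" by (simp add: hom_distribs poly_monom)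
  then show ?thesis by (rule rational_inI[OF one_neq_zero])
qed

lemma rational_in_sum: "(\<And>i. i \<in> I \<Longrightarrow> f i \<in> rational_in \<zeta>) \<Longrightarrow> (\<Sum>i\<in>I. f i) \<in> rational_in \<zeta>"
  by (induction I rule: infinite_finite_induct) (auto simp: rational_in_0 rational_in_add)

lemma rational_in_power_mult: "x \<in> rational_in \<zeta> \<Longrightarrow> \<zeta> ^ n * x \<in> rational_in \<zeta>"
proof -
  assume "x \<in> rational_in \<zeta>"
  then obtain N f where *: "N \<noteq> 0" "of_int N * x = ipoly f \<zeta>"
    by (auto simp: rational_in_def)
  have "of_int N * (\<zeta> ^ n * x) = \<zeta> ^ n * (of_int N * x)" by simp
  also have "\<dots> = ipoly (monom 1 n * f) \<zeta>" unfolding * by (simp add: hom_distribs poly_monom)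
  finally show ?thesis using * by (intro rational_inI)
qed

lemma rational_in_divide: "x \<in> rational_in \<zeta> \<Longrightarrow> q > 0 \<Longrightarrow> 1 / of_nat q * x \<in> rational_in \<zeta>"
proof -
  assume "x \<in> rational_in \<zeta>" and q: "q > 0"
  then obtain N f where *: "N \<noteq> 0" "of_int N * x = ipoly f \<zeta>"
    by (auto simp: rational_in_def)
  have "of_int (N * int q) * (1 / of_nat q * x) = ipoly f \<zeta>" using * q by simp
  moreover have "N * int q \<noteq> 0" using * q by simp
  ultimately show ?thesis by (intro rational_inI)
qed

lemma (in matrix_rep) eproj_trace_rational:
  assumes g: "g \<in> H" and x: "x \<in> H" and q: "q > 0" and \<alpha>: "(\<zeta> ^ m) ^ q = 1"
    and rat: "\<And>x. x \<in> H \<Longrightarrow> trace (\<phi> x) \<in> rational_in \<zeta>"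
  shows "trace (eproj q g (\<zeta> ^ m) * \<phi> x) \<in> rational_in \<zeta>"
proof -
  have "inverse (\<zeta> ^ m) = \<zeta> ^ (m * (q - 1))"
  proof (rule inverse_unique)
    have mq: "m + m * (q - 1) = m * q" using q by (cases q) auto
    have "\<zeta> ^ m * \<zeta> ^ (m * (q - 1)) = \<zeta> ^ (m * q)" unfolding power_add[symmetric] mq ..
    then show "\<zeta> ^ m * \<zeta> ^ (m * (q - 1)) = 1" using \<alpha> by (simp only: power_mult)
  qed
  then have inv: "inverse (\<zeta> ^ m) ^ i = \<zeta> ^ (m * (q - 1) * i)" for i
    by (simp only: power_mult)
  show ?thesis
    unfolding eproj_trace_mult[OF g x] inv
    by (intro rational_in_divide[OF _ q] rational_in_sum rational_in_power_mult rat H_mult H_pow g x)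
qed

section \<open>Representations with traces in a prime cyclotomic field\<close>

lemma exists_complex_root:
  assumes "n > 0" "w \<noteq> (0::complex)"
  obtains \<alpha> where "\<alpha> ^ n = w"
proof -
  let ?p = "monom 1 n + [:- w:]"
  have "degree ?p = n"
  proof -
    have "degree (monom 1 n + [:- w:]) = degree (monom (1::complex) n)"
      by (rule degree_add_eq_left) (use assms in \<open>simp add: degree_monom_eq\<close>)
    then show ?thesis by (simp add: degree_monom_eq)
  qed
  then have "\<not> constant (poly ?p)" using assms by (simp add: constant_degree)
  then obtain \<alpha> where "poly ?p \<alpha> = 0" using fundamental_theorem_of_algebra by blast
  then show ?thesis using that by (simp add: poly_monom)
qed

lemma card_hom_image:
  fixes G (structure)
  assumes G: "group G" and fin: "finite (carrier G)" and I: "group I" and h: "h \<in> hom G I"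
  shows "card (carrier G) = card {x \<in> carrier G. h x = \<one>\<^bsub>I\<^esub>} * card (h ` carrier G)"
proof -
  interpret group_hom G I h using G I h by (simp add: group_hom_def group_hom_axioms_def)
  let ?K = "kernel G I h"
  have "card (rcosets ?K) = card (h ` carrier G)"
  proof -
    let ?I = "I\<lparr>carrier := h ` carrier G\<rparr>"
    have "subgroup (h ` carrier G) I" by (rule img_is_subgroup)
    then have "group ?I" using I by (rule subgroup.subgroup_is_group)
    then interpret h': group_hom G ?I h
      using G h by (simp add: group_hom_def group_hom_axioms_def hom_def Pi_def)
    have "G Mod (kernel G ?I h) \<cong> ?I" by (rule h'.FactGroup_iso) simp
    then have "card (carrier (G Mod (kernel G ?I h))) = card (h ` carrier G)"
      using iso_same_card by fastforce
    then show ?thesis by (simp add: FactGroup_def kernel_def)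
  qed
  moreover have "card (rcosets ?K) * card ?K = card (carrier G)"
    using G.lagrange[OF subgroup_kernel] by (simp add: Coset.order_def)
  ultimately show ?thesis by (simp add: kernel_def mult.commute)
qed

text \<open>
The situation of the induction: a \<open>p\<close>-group acts on a nonzero space, \<open>z\<close> acts as a primitive \<open>p\<close>-th root of
unity \<open>\<zeta>\<close>, and all traces lie in \<open>\<rat>(\<zeta>)\<close>.
\<close>

locale p_matrix_rep = matrix_rep G H \<phi> for G (structure) and H and \<phi> +
  fixes p N :: nat and \<zeta> :: complex and z :: 'a
  assumes prime_p: "prime p" and p3: "p \<ge> 3" and card_G: "Coset.order G = p ^ N"
    and \<zeta>_pow: "\<zeta> ^ p = 1" and \<zeta>_ne: "\<zeta> \<noteq> 1"
    and zH: "z \<in> H" and nonzero: "\<phi> \<one> \<noteq> 0" and rep_z: "\<phi> z = scale \<zeta> (\<phi> \<one>)"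
    and rational: "\<And>x. x \<in> H \<Longrightarrow> trace (\<phi> x) \<in> rational_in \<zeta>"
begin

definition image_group :: "fin_mat monoid" where
  "image_group = \<lparr>carrier = \<phi> ` H, mult = (*), one = \<phi> \<one>\<rparr>"

lemma image_group_simps [simp]:
  "carrier image_group = \<phi> ` H" "x \<otimes>\<^bsub>image_group\<^esub> y = x * y" "\<one>\<^bsub>image_group\<^esub> = \<phi> \<one>"
  by (simp_all add: image_group_def)

lemma group_image_group: "group image_group"
proof -
  let ?H = "G\<lparr>carrier := H\<rparr>"
  let ?M = "\<lparr>carrier = UNIV, mult = (*), one = \<phi> \<one>\<rparr> :: fin_mat monoid"
  have "\<phi> \<in> hom ?H ?M" by (simp add: hom_def rep_mult)
  from group.hom_imp_img_group[OF subgroup.subgroup_is_group[OF subgroup_H is_group] this]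
  show ?thesis by (simp add: image_group_def)
qed

lemma finite_G: "finite (carrier G)"
  by (rule finite_carrier_if_prime_power_order[OF prime_p card_G])

lemma finite_H: "finite H"
  using finite_G subgroup.subset[OF subgroup_H] finite_subset by blast

lemma hom_image_group: "\<phi> \<in> hom (G\<lparr>carrier := H\<rparr>) image_group"
  by (simp add: hom_def rep_mult)

lemma card_H: "card H = card {x \<in> H. \<phi> x = \<phi> \<one>} * card (\<phi> ` H)"
  using card_hom_image[OF subgroup.subgroup_is_group[OF subgroup_H is_group] _ group_image_group hom_image_group]
    finite_H by simp

lemma card_image: obtains k where "card (\<phi> ` H) = p ^ Suc k"
proof -
  have "card H dvd p ^ N" using lagrange[OF subgroup_H] card_G by (metis dvd_triv_right)
  then have "card (\<phi> ` H) dvd p ^ N" using card_H by (metis dvd_trans dvd_triv_right)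
  then obtain j where j: "card (\<phi> ` H) = p ^ j" using prime_p divides_primepow_nat by blast
  have "\<phi> z \<noteq> \<phi> \<one>"
    using rep_z nonzero \<zeta>_ne scale_eq_scale_iff[of \<zeta> "\<phi> \<one>" 1] by (simp add: scale_simps)
  moreover have "\<phi> z \<in> \<phi> ` H" "\<phi> \<one> \<in> \<phi> ` H" using zH H_one by auto
  ultimately have "card (\<phi> ` H) \<noteq> 1" by (metis card_1_singletonE singletonD)
  then have "j \<noteq> 0" using j by (cases j) auto
  then show ?thesis using that j by (cases j) auto
qed

lemma rep_pow: "x \<in> H \<Longrightarrow> \<phi> (x [^] (n::nat)) = \<phi> x [^]\<^bsub>image_group\<^esub> n"
proof (induction n)
  case (Suc n)
  then show ?case by (simp add: rep_mult H_pow)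
qed simp

lemma rep_z_pow: "\<phi> (z [^] (n::nat)) = scale (\<zeta> ^ n) (\<phi> \<one>)"
proof (induction n)
  case (Suc n)
  then show ?case
    using zH rep_one_mult[OF H_one] by (simp add: rep_mult H_pow rep_z scale_mult_left scale_mult_right scale_simps mult.commute)
qed (simp add: scale_simps)

lemma scale_one_inj: "scale c (\<phi> \<one>) = scale d (\<phi> \<one>) \<longleftrightarrow> c = d"
  using nonzero by (simp add: scale_eq_scale_iff)

lemma \<zeta>_prim: "0 < i \<Longrightarrow> i < p \<Longrightarrow> \<zeta> ^ i \<noteq> 1"
  by (rule prime_root_of_unity_pow_ne_1[OF prime_p \<zeta>_pow \<zeta>_ne])

lemma root_over_\<zeta>_power:
  obtains \<alpha> where "\<alpha> ^ (p ^ k) = \<zeta> ^ b" "\<alpha> ^ (p ^ Suc k) = 1"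
proof -
  have p0: "p > 0" using prime_p prime_gt_0_nat by blast
  then have "p ^ k > 0" "\<zeta> ^ b \<noteq> 0" using root_of_unity_nonzero[OF \<zeta>_pow] by auto
  then obtain \<alpha> where \<alpha>: "\<alpha> ^ (p ^ k) = \<zeta> ^ b" using exists_complex_root by blast
  have "\<alpha> ^ (p ^ Suc k) = (\<alpha> ^ (p ^ k)) ^ p" by (simp flip: power_mult add: mult.commute)
  then have "\<alpha> ^ (p ^ Suc k) = 1" unfolding \<alpha> root_of_unity_pow[OF \<zeta>_pow] .
  then show ?thesis using that \<alpha> by blast
qed

lemma trace_nat: obtains t where "trace (\<phi> \<one>) = of_nat t" "t > 0"
proof -
  have "\<phi> \<one> * \<phi> \<one> = \<phi> \<one>" using rep_one_mult(1)[OF H_one] .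
  from idempotent_trace[OF this] nonzero
  show ?thesis using that by (metis Nats_cases gr0I of_nat_0)
qed

text \<open>
The hypotheses say that \<open>\<phi> h\<close> has order \<open>p ^ Suc k\<close> with \<open>k \<ge> 1\<close> and that its power of order \<open>p\<close> is the scalar
\<open>\<zeta> ^ b\<close>. So all eigenvalues of \<open>\<phi> h\<close> are primitive roots of unity of order \<open>p ^ Suc k\<close>, and their sum lies in
\<open>\<rat>(\<zeta>)\<close>.
\<close>

lemma trace_eq_0_outside:
  assumes h: "h \<in> H" and k: "k \<ge> 1" and hz: "\<phi> (h [^] (p ^ k)) = scale (\<zeta> ^ b) (\<phi> \<one>)" and b: "\<not> p dvd b"
  shows "trace (\<phi> h) = 0"
proof -
  obtain \<alpha> where \<alpha>k: "\<alpha> ^ (p ^ k) = \<zeta> ^ b" and \<alpha>q: "\<alpha> ^ (p ^ Suc k) = 1"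
    using root_over_\<zeta>_power by blast
  let ?q = "p ^ Suc k"
  have q: "?q > 0" using prime_p prime_gt_0_nat by simp
  have \<zeta>b: "\<zeta> ^ b \<noteq> 1"
    using prime_power_root_order[OF prime_p, of \<zeta> 0 b] \<zeta>_pow \<zeta>_ne b by auto
  then have \<alpha>k1: "\<alpha> ^ (p ^ k) \<noteq> 1" using \<alpha>k by simp
  have \<alpha>prim: "\<alpha> ^ i \<noteq> 1" if "0 < i" "i < ?q" for i
  proof
    assume "\<alpha> ^ i = 1"
    then have "?q dvd i" by (rule prime_power_root_order[OF prime_p \<alpha>q \<alpha>k1])
    then show False using that by (simp add: dvd_imp_le leD)
  qed
  have bp: "coprime b p" using b prime_p prime_imp_coprime coprime_commute by blast
  obtain b' where b': "[b * b' = 1] (mod p)" using cong_solve_coprime_nat[OF bp] by auto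
  have \<zeta>\<alpha>: "\<zeta> = \<alpha> ^ (p ^ k * b')"
  proof -
    have "\<alpha> ^ (p ^ k * b') = \<zeta> ^ (b * b')" by (simp add: power_mult \<alpha>k)
    also have "\<dots> = \<zeta> ^ ((b * b') mod p)"
    proof -
      have "\<zeta> ^ (b * b') = \<zeta> ^ (p * (b * b' div p) + (b * b') mod p)" by simp
      also have "\<dots> = \<zeta> ^ ((b * b') mod p)" unfolding power_add power_mult \<zeta>_pow by simp
      finally show ?thesis .
    qed
    also have "(b * b') mod p = 1" using b' p3 by (simp add: cong_def)
    finally show ?thesis by simp
  qed
  have hq: "\<phi> (h [^] ?q) = \<phi> \<one>"
  proof -
    have "h [^] ?q = (h [^] (p ^ k)) [^] p" using H_carrier[OF h] by (simp add: nat_pow_pow mult.commute)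
    then have "\<phi> (h [^] ?q) = \<phi> (h [^] (p ^ k)) [^]\<^bsub>image_group\<^esub> p" using rep_pow h by (simp add: H_pow)
    also have "\<phi> (h [^] (p ^ k)) = \<phi> (z [^] b)" using hz rep_z_pow by simp
    also have "\<phi> (z [^] b) [^]\<^bsub>image_group\<^esub> p = \<phi> (z [^] (b * p))"
      using rep_pow[of "z [^] b" p] zH H_carrier by (simp add: H_pow nat_pow_pow)
    also have "\<dots> = scale ((\<zeta> ^ p) ^ b) (\<phi> \<one>)" unfolding rep_z_pow by (simp flip: power_mult add: mult.commute)
    finally show ?thesis using \<zeta>_pow by (simp add: scale_simps)
  qed
  note \<alpha>aq = root_of_unity_pow[OF \<alpha>q]
  obtain n where n: "\<And>a. trace (eproj ?q h (\<alpha> ^ a)) = of_nat (n a)" "\<And>a. n a = 0 \<longleftrightarrow> eproj ?q h (\<alpha> ^ a) = 0"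
  proof -
    have "\<exists>m. trace (eproj ?q h (\<alpha> ^ a)) = of_nat m \<and> (m = 0 \<longleftrightarrow> eproj ?q h (\<alpha> ^ a) = 0)" for a
      using eproj_nat_trace[OF h q hq \<alpha>aq[of a]] by blast
    then show ?thesis using that by metis
  qed
  have trh: "trace (\<phi> h) = (\<Sum>a<?q. of_nat (n a) * \<alpha> ^ a)"
    using rep_pow_trace[OF h q hq \<alpha>q \<alpha>prim, of 1] H_carrier[OF h] n(1) by (simp del: power_Suc)
  moreover have "(\<Sum>a<?q. of_nat (n a) * \<alpha> ^ a) = 0"
  proof (rule sum_primitive_roots_eq_0[OF prime_p k \<alpha>q \<alpha>k1 \<zeta>\<alpha>])
    fix a assume "p dvd a"
    then obtain c where c: "a = p * c" by auto
    let ?E = "eproj ?q h (\<alpha> ^ a)"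
    have "\<phi> (h [^] (p ^ k)) * ?E = scale ((\<alpha> ^ a) ^ (p ^ k)) ?E"
      by (rule eproj_eigen_pow[OF h q hq \<alpha>aq])
    also have "(\<alpha> ^ a) ^ (p ^ k) = 1"
    proof -
      have "(\<alpha> ^ a) ^ (p ^ k) = (\<alpha> ^ ?q) ^ c" unfolding c by (simp flip: power_mult add: mult_ac)
      then show ?thesis using \<alpha>q by simp
    qed
    also have "\<phi> (h [^] (p ^ k)) * ?E = scale (\<zeta> ^ b) ?E"
      unfolding hz using h by (simp add: scale_mult_left eproj_one)
    finally have "?E = 0" using \<zeta>b by (simp add: scale_eq_scale_iff)
    then show "n a = 0" using n(2) by simp
  qed (use rational[OF h] trh in simp)
  ultimately show ?thesis by simp
qed

text \<open>
Let \<open>\<phi> g\<close> generate the image, of order \<open>q\<close>. The powers of \<open>\<phi> g\<close> that are not scalar have trace \<open>0\<close>, so in the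
trace of the projection onto an eigenspace of \<open>\<phi> g\<close> only the \<open>p\<close> scalar powers contribute. If the eigenvalue \<open>\<alpha>\<close> is
compatible with these scalars, each of them contributes \<open>t / q\<close>. The dimension \<open>p t / q\<close> of the eigenspace
is an integer and not zero, hence \<open>q \<le> p t\<close>.
\<close>

lemma cyclic_image_bound:
  assumes cyc: "cyclic_group image_group" and t: "trace (\<phi> \<one>) = of_nat t"
  shows "card (\<phi> ` H) \<le> p * t"
proof -
  interpret I: group image_group by (rule group_image_group)
  have finI: "finite (carrier image_group)" using finite_H by simp
  obtain k where cardI: "card (\<phi> ` H) = p ^ Suc k" using card_image by blast
  let ?q = "p ^ Suc k"
  have p0: "p > 0" using prime_p prime_gt_0_nat by blast
  have q: "?q > 0" using p0 by simp
  obtain w where "w \<in> carrier image_group"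
    and w2: "carrier image_group = range (\<lambda>n::int. w [^]\<^bsub>image_group\<^esub> n)"
    using cyc unfolding I.cyclic_group by blast
  then have w: "w \<in> \<phi> ` H" by simp
  have ordw: "I.ord w = ?q" and gen: "\<And>y. y \<in> \<phi> ` H \<Longrightarrow> \<exists>i::nat. y = w [^]\<^bsub>image_group\<^esub> i"
  proof -
    have wc: "w \<in> carrier image_group" using w by simp
    have 1: "generate image_group {w} = carrier image_group"
      unfolding w2 I.generate_pow[OF wc] by auto
    then show "I.ord w = ?q" using I.generate_pow_card[OF wc] cardI by simp
    show "\<exists>i::nat. y = w [^]\<^bsub>image_group\<^esub> i" if "y \<in> \<phi> ` H" for y
      using that 1 I.generate_pow_on_finite_carrier[OF finI wc] by auto
  qed
  obtain g where g: "g \<in> H" "w = \<phi> g" using w by auto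
  have rp: "\<phi> (g [^] i) = w [^]\<^bsub>image_group\<^esub> i" for i :: nat using rep_pow g by simp
  have wc: "w \<in> carrier image_group" using w by simp
  have gq: "\<phi> (g [^] ?q) = \<phi> \<one>" unfolding rp using I.pow_ord_eq_1[OF wc] ordw by simp
  define u where "u = w [^]\<^bsub>image_group\<^esub> (p ^ k)"
  obtain l where l: "\<phi> z = w [^]\<^bsub>image_group\<^esub> (l::nat)" using gen zH by blast
  have zp: "\<phi> z [^]\<^bsub>image_group\<^esub> p = \<phi> \<one>"
    using rep_pow[OF zH, of p] rep_z_pow[of p] \<zeta>_pow by (simp add: scale_simps)
  have zne: "\<phi> z \<noteq> \<phi> \<one>"
    using rep_z nonzero \<zeta>_ne scale_eq_scale_iff[of \<zeta> "\<phi> \<one>" 1] by (simp add: scale_simps)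
  have up: "u [^]\<^bsub>image_group\<^esub> p = \<phi> \<one>"
    using I.pow_ord_eq_1[OF wc] ordw wc unfolding u_def by (simp add: I.nat_pow_pow mult.commute)
  have "\<exists>b::nat. u = \<phi> z [^]\<^bsub>image_group\<^esub> b"
    using I.cyclic_p_torsion[OF prime_p wc ordw l _ _ u_def] zp zne up by simp
  then obtain b where b: "\<phi> (g [^] (p ^ k)) = scale (\<zeta> ^ b) (\<phi> \<one>)"
    using rep_pow[OF zH] rep_z_pow rp u_def by metis
  have pb: "\<not> p dvd b"
  proof
    assume "p dvd b"
    then have "\<zeta> ^ b = 1" using \<zeta>_pow by (auto simp: power_mult)
    then have "u = \<one>\<^bsub>image_group\<^esub>" using b rp u_def by (simp add: scale_simps)
    then have "?q dvd p ^ k" using I.pow_eq_id[OF wc] ordw u_def by simp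
    then have "p ^ Suc k \<le> p ^ k" using p0 by (intro dvd_imp_le) auto
    then show False using prime_gt_1_nat[OF prime_p] by simp
  qed
  \<comment> \<open>Every eigenvalue \<open>\<alpha>\<close> of \<open>\<phi> g\<close> satisfies this equation, so it is the condition to impose on \<open>\<alpha>\<close>.\<close>
  obtain \<alpha> where \<alpha>k: "\<alpha> ^ (p ^ k) = \<zeta> ^ b" and \<alpha>q: "\<alpha> ^ ?q = 1"
    using root_over_\<zeta>_power by blast
  have \<alpha>0: "\<alpha> \<noteq> 0" using root_of_unity_nonzero[OF \<alpha>q q] .
  have tr0: "trace (\<phi> (g [^] i)) = 0" if i: "\<not> p ^ k dvd i" for i
  proof -
    define j where "j = multiplicity p i"
    have i0: "i \<noteq> 0" using i by (metis dvd_0_right)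
    obtain i' where i': "i = p ^ j * i'" "\<not> p dvd i'"
      using multiplicity_decompose'[of i p] i0 prime_p not_prime_unit unfolding j_def by metis
    have jk: "j < k"
    proof (rule ccontr)
      assume "\<not> j < k"
      then have "p ^ k dvd p ^ j" by (simp add: le_imp_power_dvd)
      then show False using i i' by (metis dvd_mult2)
    qed
    show ?thesis
    proof (rule trace_eq_0_outside)
      show "g [^] i \<in> H" using g by (simp add: H_pow)
      show "k - j \<ge> 1" using jk by simp
      have "p ^ j * p ^ (k - j) = p ^ k" using jk by (simp flip: power_add)
      then have "i * p ^ (k - j) = p ^ k * i'" unfolding i'(1) by (metis mult.assoc mult.commute)
      then have "(g [^] i) [^] (p ^ (k - j)) = (g [^] (p ^ k)) [^] i'"
        using H_carrier[OF g(1)] by (simp add: nat_pow_pow)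
      also have "\<phi> \<dots> = \<phi> (g [^] (p ^ k)) [^]\<^bsub>image_group\<^esub> i'" using g by (simp add: rep_pow H_pow)
      also have "\<phi> (g [^] (p ^ k)) = \<phi> (z [^] b)" using b rep_z_pow by simp
      also have "\<phi> (z [^] b) [^]\<^bsub>image_group\<^esub> i' = \<phi> (z [^] (b * i'))"
        using zH H_carrier by (simp add: rep_pow[symmetric] H_pow nat_pow_pow)
      finally show "\<phi> ((g [^] i) [^] (p ^ (k - j))) = scale (\<zeta> ^ (b * i')) (\<phi> \<one>)"
        using rep_z_pow by simp
      show "\<not> p dvd b * i'" using pb i' prime_p by (simp add: prime_dvd_mult_iff)
    qed
  qed
  have "trace (eproj ?q g \<alpha>) = 1 / of_nat ?q * (\<Sum>i<?q. inverse \<alpha> ^ i * trace (\<phi> (g [^] i)))"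
    by (rule eproj_trace)
  also have "(\<Sum>i<?q. inverse \<alpha> ^ i * trace (\<phi> (g [^] i))) =
    (\<Sum>i\<in>(\<lambda>j. p ^ k * j) ` {..<p}. inverse \<alpha> ^ i * trace (\<phi> (g [^] i)))"
  proof (rule sum.mono_neutral_right)
    show "(\<lambda>j. p ^ k * j) ` {..<p} \<subseteq> {..<?q}" using p0 by auto
    show "\<forall>i\<in>{..<?q} - (\<lambda>j. p ^ k * j) ` {..<p}. inverse \<alpha> ^ i * trace (\<phi> (g [^] i)) = 0"
    proof
      fix i assume i: "i \<in> {..<?q} - (\<lambda>j. p ^ k * j) ` {..<p}"
      have "\<not> p ^ k dvd i"
      proof
        assume "p ^ k dvd i"
        then obtain j where j: "i = p ^ k * j" by auto
        then have "j < p" using i p0 by (auto simp: mult.commute)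
        then show False using i j by auto
      qed
      then show "inverse \<alpha> ^ i * trace (\<phi> (g [^] i)) = 0" using tr0 by simp
    qed
  qed simp
  also have "\<dots> = (\<Sum>j<p. inverse \<alpha> ^ (p ^ k * j) * trace (\<phi> (g [^] (p ^ k * j))))"
    by (subst sum.reindex) (use p0 in \<open>auto simp: inj_on_def\<close>)
  also have "\<dots> = (\<Sum>j<p. of_nat t)"
  proof (rule sum.cong)
    fix j
    have "g [^] (p ^ k * j) = (g [^] (p ^ k)) [^] j" using H_carrier[OF g(1)] by (simp add: nat_pow_pow)
    then have "\<phi> (g [^] (p ^ k * j)) = \<phi> (g [^] (p ^ k)) [^]\<^bsub>image_group\<^esub> j" using g by (simp add: rep_pow H_pow)
    also have "\<phi> (g [^] (p ^ k)) = \<phi> (z [^] b)" using b rep_z_pow by simp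
    also have "\<phi> (z [^] b) [^]\<^bsub>image_group\<^esub> j = \<phi> (z [^] (b * j))"
      using zH H_carrier by (simp add: rep_pow[symmetric] H_pow nat_pow_pow)
    also have "\<dots> = scale (\<alpha> ^ (p ^ k * j)) (\<phi> \<one>)" unfolding rep_z_pow by (simp add: power_mult \<alpha>k)
    finally have "trace (\<phi> (g [^] (p ^ k * j))) = \<alpha> ^ (p ^ k * j) * of_nat t" using t by (simp add: trace_scale)
    then show "inverse \<alpha> ^ (p ^ k * j) * trace (\<phi> (g [^] (p ^ k * j))) = of_nat t"
      using \<alpha>0 by (simp add: power_inverse mult.assoc[symmetric])
  qed simp
  finally have trE: "trace (eproj ?q g \<alpha>) = 1 / of_nat ?q * of_nat (p * t)" by simp
  obtain m where "trace (eproj ?q g \<alpha>) = of_nat m" using eproj_nat_trace[OF g(1) q gq \<alpha>q] by blast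
  then have "of_nat ?q * of_nat m = (of_nat (p * t) :: complex)" using trE q by (simp add: field_simps)
  then have "?q * m = p * t" by (metis of_nat_eq_iff of_nat_mult)
  moreover have "t > 0"
  proof -
    obtain t' where "trace (\<phi> \<one>) = of_nat t'" "t' > 0" using trace_nat by blast
    then show ?thesis using t by simp
  qed
  ultimately have "?q dvd p * t" "p * t > 0" using p0 by (metis dvd_triv_left, simp)
  then show ?thesis unfolding cardI by (rule dvd_imp_le)
qed

end

section \<open>An index bounded by the degree of a representation\<close>

text \<open>
The induction is on the order of the image. For a cyclic image the kernel of \<open>\<phi>\<close> serves as \<open>L\<close>. Otherwise there is
an element \<open>g\<close> such that \<open>\<phi> g\<close> is not a scalar, has order \<open>p\<close>, and is multiplied by powers of \<open>\<zeta>\<close> under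
conjugation. The induction hypothesis is applied to the elements \<open>H'\<close> that commute with \<open>\<phi> g\<close>, acting on an
eigenspace of \<open>\<phi> g\<close> of dimension \<open>t'\<close>. The image shrinks because \<open>\<phi> g\<close> becomes a scalar there. The bound is
inherited because of \<open>card H * t' \<le> card H' * t\<close>: either \<open>H' = H\<close>, or the \<open>p\<close> eigenspaces are permuted
transitively, so that \<open>t = p t'\<close>, while \<open>H'\<close> has index at most \<open>p\<close>.
\<close>

lemma representation_degree_bound:
  fixes G (structure) and \<phi> :: "'a \<Rightarrow> fin_mat"
  assumes "p_matrix_rep G H \<phi> p N \<zeta> z"
  shows "\<exists>L t. subgroup L G \<and> L \<subseteq> H \<and> z \<notin> L \<and> trace (\<phi> \<one>) = of_nat t \<and> card H \<le> card L * (p * t)"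
  using assms
proof (induction "card (\<phi> ` H)" arbitrary: H \<phi> rule: less_induct)
  case less
  interpret p_matrix_rep G H \<phi> p N \<zeta> z by fact
  interpret I: group image_group by (rule group_image_group)
  obtain t where t: "trace (\<phi> \<one>) = of_nat t" "t > 0" using trace_nat by blast
  have p0: "p > 0" using prime_p prime_gt_0_nat by blast
  have \<zeta>0: "\<zeta> \<noteq> 0" using root_of_unity_nonzero[OF \<zeta>_pow p0] .
  show ?case
  proof (cases "cyclic_group image_group")
    case True
    let ?L = "{x \<in> H. \<phi> x = \<phi> \<one>}"
    interpret h: group_hom "G\<lparr>carrier := H\<rparr>" image_group \<phi>
      using subgroup.subgroup_is_group[OF subgroup_H is_group] group_image_group hom_image_group
      by (simp add: group_hom_def group_hom_axioms_def)
    have "subgroup ?L G"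
      using incl_subgroup[OF subgroup_H h.subgroup_kernel] by (simp add: kernel_def)
    moreover have "z \<notin> ?L"
      using rep_z \<zeta>_ne scale_one_inj[of \<zeta> 1] by (simp add: scale_simps)
    moreover have "card H \<le> card ?L * (p * t)"
      using card_H cyclic_image_bound[OF True t(1)] by (metis mult_le_mono2)
    ultimately show ?thesis using t(1) by blast
  next
    case False
    obtain k where "card (\<phi> ` H) = p ^ Suc k" using card_image by blast
    then have ord: "Coset.order image_group = p ^ Suc k" by (simp add: Coset.order_def)
    have zc: "\<phi> z \<in> group_center image_group"
    proof -
      have "\<phi> z * \<phi> x = \<phi> x * \<phi> z" if "x \<in> H" for x
        using that by (simp add: rep_z scale_mult_left scale_mult_right rep_one_mult)
      moreover have "\<phi> z \<in> \<phi> ` H" using zH by blast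
      ultimately show ?thesis by (auto simp: group_center_def)
    qed
    have z1: "\<phi> z \<noteq> \<one>\<^bsub>image_group\<^esub>"
      using rep_z \<zeta>_ne scale_one_inj[of \<zeta> 1] by (simp add: scale_simps)
    have zp: "\<phi> z [^]\<^bsub>image_group\<^esub> p = \<one>\<^bsub>image_group\<^esub>"
      using rep_pow[OF zH, of p] rep_z_pow[of p] \<zeta>_pow by (simp add: scale_simps)
    from noncyclic_p_group_normal_rank_two[OF group_image_group prime_p p3 ord False zc z1 zp]
    obtain w where w: "w \<in> \<phi> ` H" "w \<notin> range (\<lambda>i::nat. \<phi> z [^]\<^bsub>image_group\<^esub> i)"
        "w [^]\<^bsub>image_group\<^esub> p = \<one>\<^bsub>image_group\<^esub>"
      and wn: "\<And>X. X \<in> \<phi> ` H \<Longrightarrow> \<exists>i::nat. X * w * inv\<^bsub>image_group\<^esub> X = w * \<phi> z [^]\<^bsub>image_group\<^esub> i"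
      by auto
    obtain g where g: "g \<in> H" "w = \<phi> g" using w by auto
    have gz: "\<phi> g \<noteq> \<phi> (z [^] (i::nat))" for i using w(2) g rep_pow[OF zH] by auto
    have gp: "\<phi> (g [^] p) = \<phi> \<one>" using w(3) g rep_pow by simp
    have gcomm: "\<exists>i::nat. \<phi> x * \<phi> g = scale (\<zeta> ^ i) (\<phi> g * \<phi> x)" if x: "x \<in> H" for x
    proof -
      obtain i :: nat where "\<phi> x * w * inv\<^bsub>image_group\<^esub> \<phi> x = w * \<phi> z [^]\<^bsub>image_group\<^esub> i"
        using wn x by blast
      moreover have "\<phi> z [^]\<^bsub>image_group\<^esub> i = scale (\<zeta> ^ i) (\<phi> \<one>)"
        using rep_pow[OF zH, of i] rep_z_pow[of i] by simp
      ultimately have i: "\<phi> x * w * inv\<^bsub>image_group\<^esub> \<phi> x = scale (\<zeta> ^ i) w"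
        using rep_one_mult g by (simp add: scale_mult_right)
      have iX: "inv\<^bsub>image_group\<^esub> \<phi> x * \<phi> x = \<phi> \<one>" using I.l_inv[of "\<phi> x"] x by simp
      have "\<phi> x * w = \<phi> x * w * (inv\<^bsub>image_group\<^esub> \<phi> x * \<phi> x)"
        unfolding iX using g by (simp add: mult.assoc rep_one_mult)
      also have "\<dots> = scale (\<zeta> ^ i) w * \<phi> x" unfolding i[symmetric] by (simp add: mult.assoc)
      finally show ?thesis using g by (auto simp: scale_mult_left)
    qed
    note \<zeta>j = root_of_unity_pow[OF \<zeta>_pow]
    have sum: "(\<Sum>l<p. eproj p g (\<zeta> ^ l)) = \<phi> \<one>"
      using eproj_sum[OF g(1) p0 \<zeta>_pow \<zeta>_prim, of 1] by simp
    then obtain j where j: "j < p" "eproj p g (\<zeta> ^ j) \<noteq> 0"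
      using nonzero by (metis lessThan_iff sum.neutral)
    let ?E = "eproj p g (\<zeta> ^ j)"
    note idem = eproj_idempotent[OF g(1) p0 gp \<zeta>j]
    obtain t' where t': "trace ?E = of_nat t'" "t' \<noteq> 0"
      using eproj_nat_trace[OF g(1) p0 gp \<zeta>j[of j]] j(2) by metis
    define H' where "H' = {x \<in> H. \<phi> x * \<phi> g = \<phi> g * \<phi> x}"
    let ?\<phi>' = "\<lambda>x. ?E * \<phi> x"
    have H'H: "H' \<subseteq> H" by (auto simp: H'_def)
    have gH': "g \<in> H'" and zH': "z \<in> H'" and oneH': "\<one> \<in> H'"
      using g zH H_one by (auto simp: H'_def rep_z scale_mult_left scale_mult_right rep_one_mult)
    have subH': "subgroup H' G"
    proof (rule subgroupI)
      show "H' \<noteq> {}" using gH' by auto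
      fix x assume x: "x \<in> H'"
      then have xH: "x \<in> H" and xg: "\<phi> x * \<phi> g = \<phi> g * \<phi> x" by (auto simp: H'_def)
      have ix: "\<phi> (inv x) * \<phi> x = \<phi> \<one>" "\<phi> x * \<phi> (inv x) = \<phi> \<one>"
        using xH H_inv H_carrier by (simp_all flip: rep_mult)
      have "\<phi> (inv x) * \<phi> g = \<phi> (inv x) * (\<phi> g * (\<phi> x * \<phi> (inv x)))"
        unfolding ix using g by (simp add: rep_one_mult)
      also have "\<dots> = \<phi> (inv x) * (\<phi> x * \<phi> g) * \<phi> (inv x)" unfolding xg by (simp add: mult.assoc)
      also have "\<dots> = (\<phi> (inv x) * \<phi> x) * \<phi> g * \<phi> (inv x)" by (simp add: mult.assoc)
      also have "\<dots> = \<phi> g * \<phi> (inv x)" unfolding ix using g by (simp add: rep_one_mult)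
      finally show "inv x \<in> H'" using xH H_inv by (simp add: H'_def)
      fix y assume y: "y \<in> H'"
      then have "\<phi> (x \<otimes> y) * \<phi> g = \<phi> x * (\<phi> g * \<phi> y)" using x by (simp add: H'_def rep_mult mult.assoc)
      also have "\<dots> = \<phi> g * \<phi> (x \<otimes> y)" using x y by (simp add: H'_def rep_mult mult.assoc[symmetric])
      finally show "x \<otimes> y \<in> H'" using x y H_mult by (simp add: H'_def)
    qed (use H'H H_carrier in auto)
    have E_comm: "\<phi> x * ?E = ?E * \<phi> x" if "x \<in> H'" for x
      using eproj_intertwine[OF g(1), of x 1 p "\<zeta> ^ j"] that by (simp add: H'_def scale_simps)
    have rep': "p_matrix_rep G H' ?\<phi>' p N \<zeta> z"
    proof (intro p_matrix_rep.intro p_matrix_rep_axioms.intro)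
      show "matrix_rep G H' ?\<phi>'" by (rule cut_by_idempotent[OF idem subH' H'H E_comm])
      show "?E * \<phi> \<one> \<noteq> 0" using j g by (simp add: eproj_one)
      show "?E * \<phi> z = scale \<zeta> (?E * \<phi> \<one>)" by (simp add: rep_z scale_mult_right)
      fix x assume "x \<in> H'"
      then show "trace (?E * \<phi> x) \<in> rational_in \<zeta>"
        by (intro eproj_trace_rational[OF g(1) _ p0 \<zeta>j rational]) (use H'H in auto)
    qed (use prime_p p3 card_G \<zeta>_pow \<zeta>_ne zH' is_group in auto)
    \<comment> \<open>\<open>\<phi> g\<close> and the scalar \<open>\<phi> (z [^] j)\<close> are different but agree on the eigenspace.\<close>
    have smaller: "card (?\<phi>' ` H') < card (\<phi> ` H)"
    proof -
      have fin: "finite (\<phi> ` H')" using finite_H H'H finite_subset by blast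
      have zj: "z [^] j \<in> H'"
        using zH H_pow rep_one_mult g by (auto simp: H'_def rep_z_pow scale_mult_left scale_mult_right)
      have "?E * \<phi> g = scale (\<zeta> ^ j) ?E"
        using E_comm[OF gH'] eproj_eigen[OF g(1) p0 gp \<zeta>j[of j]] by simp
      also have "\<dots> = ?E * \<phi> (z [^] j)"
        using g by (simp add: rep_z_pow scale_mult_right eproj_one)
      finally have "\<not> inj_on ((*) ?E) (\<phi> ` H')"
        using gz[of j] gH' zj by (auto simp: inj_on_def)
      then have "card ((*) ?E ` \<phi> ` H') \<noteq> card (\<phi> ` H')" using fin inj_on_iff_eq_card by blast
      then have "card ((*) ?E ` \<phi> ` H') < card (\<phi> ` H')" using card_image_le[OF fin] by (metis le_neq_implies_less)
      also have "\<dots> \<le> card (\<phi> ` H)" using finite_H H'H by (intro card_mono) auto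
      finally show ?thesis by (simp add: image_image)
    qed
    obtain L s where L: "subgroup L G" "L \<subseteq> H'" "z \<notin> L" "trace (?E * \<phi> \<one>) = of_nat s"
      "card H' \<le> card L * (p * s)"
      using less.hyps[OF smaller rep'] by auto
    have s: "s = t'" using L(4) t' g by (simp add: eproj_one)
    have key: "card H * t' \<le> card H' * t"
    proof (cases "H' = H")
      case True
      have "\<exists>m. trace (eproj p g (\<zeta> ^ l)) = of_nat m" for l
        using eproj_nat_trace[OF g(1) p0 gp \<zeta>j[of l]] by blast
      then obtain m where m: "\<And>l. trace (eproj p g (\<zeta> ^ l)) = of_nat (m l)" by metis
      have "of_nat t = (\<Sum>l<p. trace (eproj p g (\<zeta> ^ l)))" using sum t(1) by (metis trace_sum)
      also have "\<dots> = of_nat (\<Sum>l<p. m l)" by (simp add: m)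
      finally have "t = (\<Sum>l<p. m l)" by (simp only: of_nat_eq_iff)
      moreover have "m j \<le> (\<Sum>l<p. m l)" using j by (intro member_le_sum) auto
      moreover have "m j = t'" using m[of j] t' by simp
      ultimately show ?thesis using True by simp
    next
      case False
      then obtain x where x: "x \<in> H" "x \<notin> H'" using H'H by auto
      obtain i where i: "\<phi> x * \<phi> g = scale (\<zeta> ^ i) (\<phi> g * \<phi> x)" using gcomm x by blast
      define \<eta> where "\<eta> = inverse (\<zeta> ^ i)"
      have \<eta>p: "\<eta> ^ p = 1" using \<zeta>j[of i] by (simp add: \<eta>_def power_inverse)
      have "\<zeta> ^ i \<noteq> 1" using i x by (auto simp: H'_def scale_simps)
      then have \<eta>1: "\<eta> \<noteq> 1" by (simp add: \<eta>_def)
      note \<eta>prim = prime_root_of_unity_pow_ne_1[OF prime_p \<eta>p \<eta>1]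
      \<comment> \<open>Conjugation by \<open>x\<close> moves the eigenvalue \<open>\<alpha>\<close> to \<open>\<alpha> * \<eta>\<close>.\<close>
      have conj: "trace (eproj p g \<alpha>) = trace (eproj p g (\<alpha> * \<eta>))" for \<alpha>
      proof -
        have ix: "\<phi> (inv x) * \<phi> x = \<phi> \<one>" "\<phi> x * \<phi> (inv x) = \<phi> \<one>"
          using x H_inv H_carrier by (simp_all flip: rep_mult)
        have "trace (eproj p g \<alpha>) = trace (eproj p g \<alpha> * (\<phi> (inv x) * \<phi> x))"
          unfolding ix using g by (simp add: eproj_one)
        also have "\<dots> = trace (\<phi> x * eproj p g \<alpha> * \<phi> (inv x))"
          by (metis mult.assoc trace_mult_commute)
        also have "\<phi> x * eproj p g \<alpha> = eproj p g (\<alpha> * \<eta>) * \<phi> x"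
          using eproj_intertwine[OF g(1) x(1) i] \<zeta>0 by (simp add: \<eta>_def divide_inverse)
        also have "\<dots> * \<phi> (inv x) = eproj p g (\<alpha> * \<eta>)"
          using ix g by (simp add: mult.assoc eproj_one)
        finally show ?thesis .
      qed
      have tr: "trace (eproj p g (\<zeta> ^ j * \<eta> ^ l)) = of_nat t'" for l
      proof (induction l)
        case (Suc l)
        then show ?case using conj[of "\<zeta> ^ j * \<eta> ^ l"] by (simp add: mult_ac)
      qed (use t' in simp)
      have "of_nat t = trace (\<Sum>l<p. eproj p g (\<zeta> ^ j * \<eta> ^ l))"
        using eproj_sum[OF g(1) p0 \<eta>p \<eta>prim, of "\<zeta> ^ j"] t(1) by simp
      then have "(of_nat t :: complex) = of_nat (p * t')" by (simp add: trace_sum tr)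
      then have tt: "t = p * t'" by (simp only: of_nat_eq_iff)
      have "card H \<le> p * card H'"
      proof -
        \<comment> \<open>\<open>?S i\<close> is empty or a coset of \<open>H'\<close>.\<close>
        let ?S = "\<lambda>i. {x \<in> H. \<phi> x * \<phi> g = scale (\<zeta> ^ i) (\<phi> g * \<phi> x)}"
        have "H \<subseteq> (\<Union>i<p. ?S i)"
        proof
          fix y assume y: "y \<in> H"
          obtain i where i: "\<phi> y * \<phi> g = scale (\<zeta> ^ i) (\<phi> g * \<phi> y)" using gcomm y by blast
          have "\<zeta> ^ i = \<zeta> ^ (p * (i div p) + i mod p)" by simp
          also have "\<dots> = \<zeta> ^ (i mod p)" unfolding power_add power_mult \<zeta>_pow by simp
          finally have "y \<in> ?S (i mod p)" using i y by simp
          then show "y \<in> (\<Union>i<p. ?S i)" using p0 by auto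
        qed
        then have "card H \<le> card (\<Union>i<p. ?S i)" using finite_H by (intro card_mono) auto
        also have "\<dots> \<le> (\<Sum>i<p. card (?S i))" by (rule card_UN_le) simp
        also have "\<dots> \<le> (\<Sum>i<p. card H')"
        proof (rule sum_mono)
          fix i
          show "card (?S i) \<le> card H'"
          proof (cases "?S i = {}")
            case True
            show ?thesis unfolding True by simp
          next
            case False
            then obtain y where y: "y \<in> H" "\<phi> y * \<phi> g = scale (\<zeta> ^ i) (\<phi> g * \<phi> y)" by auto
            have iy: "\<phi> (inv y) * \<phi> y = \<phi> \<one>" "\<phi> y * \<phi> (inv y) = \<phi> \<one>"
              using y H_inv H_carrier by (simp_all flip: rep_mult)
            have ziy: "scale (\<zeta> ^ i) (\<phi> (inv y) * \<phi> g) = \<phi> g * \<phi> (inv y)"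
            proof -
              have "\<phi> g * \<phi> (inv y) = \<phi> (inv y) * (\<phi> y * \<phi> g) * \<phi> (inv y)"
                using iy g by (simp add: mult.assoc[symmetric] rep_one_mult)
              also have "\<dots> = scale (\<zeta> ^ i) (\<phi> (inv y) * \<phi> g * (\<phi> y * \<phi> (inv y)))"
                unfolding y(2) by (simp add: scale_mult_left scale_mult_right mult.assoc)
              finally show ?thesis unfolding iy using g by (simp add: mult.assoc rep_one_mult)
            qed
            show ?thesis
            proof (rule card_inj_on_le[of "\<lambda>x. inv y \<otimes> x"])
              show "inj_on (\<lambda>x. inv y \<otimes> x) (?S i)"
                using y H_carrier by (auto simp: inj_on_def)
              show "(\<lambda>x. inv y \<otimes> x) ` ?S i \<subseteq> H'"
              proof
                fix v assume "v \<in> (\<lambda>x. inv y \<otimes> x) ` ?S i"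
                then obtain x where x: "x \<in> H" "\<phi> x * \<phi> g = scale (\<zeta> ^ i) (\<phi> g * \<phi> x)" "v = inv y \<otimes> x" by auto
                have "\<phi> v * \<phi> g = \<phi> (inv y) * (\<phi> x * \<phi> g)" using x y H_inv by (simp add: rep_mult mult.assoc)
                also have "\<dots> = scale (\<zeta> ^ i) (\<phi> (inv y) * \<phi> g) * \<phi> x"
                  unfolding x(2) by (simp add: scale_mult_left scale_mult_right mult.assoc)
                also have "\<dots> = \<phi> g * \<phi> v" unfolding ziy using x y H_inv by (simp add: rep_mult mult.assoc)
                finally show "v \<in> H'" using x y H_inv H_mult by (simp add: H'_def)
              qed
              show "finite H'" using finite_H H'H finite_subset by blast
            qed
          qed
        qed
        finally show ?thesis by simp
      qed
      then have "card H * t' \<le> p * card H' * t'" by (rule mult_le_mono1)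
      then show ?thesis using tt by (simp add: mult_ac)
    qed
    have "card H * t' \<le> card L * (p * t') * t"
      using key L(5) s by (meson le_trans mult_le_mono1)
    then have "card H * t' \<le> (card L * (p * t)) * t'" by (simp add: mult_ac)
    then have "card H \<le> card L * (p * t)" using t' by simp
    then show ?thesis using L H'H t by blast
  qed
qed

section \<open>Permutation and quasi-permutation representations\<close>

lemma embeds_iff:
  assumes G: "group G"
  shows "(\<exists>H. subgroup H (sym_group n) \<and> G \<cong> (sym_group n)\<lparr>carrier := H\<rparr>) \<longleftrightarrow>
    (\<exists>h \<in> hom G (sym_group n). inj_on h (carrier G))"
proof safe
  fix H assume H: "subgroup H (sym_group n)" and "G \<cong> (sym_group n)\<lparr>carrier := H\<rparr>"
  then obtain h where h: "h \<in> iso G ((sym_group n)\<lparr>carrier := H\<rparr>)" by (auto simp: is_iso_def)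
  then have "h \<in> hom G (sym_group n)"
    using subgroup.subset[OF H] by (auto simp: iso_def hom_def Pi_def)
  moreover have "inj_on h (carrier G)" using h by (auto simp: iso_def bij_betw_def)
  ultimately show "\<exists>h \<in> hom G (sym_group n). inj_on h (carrier G)" by blast
next
  fix h assume h: "h \<in> hom G (sym_group n)" and inj: "inj_on h (carrier G)"
  interpret group_hom G "sym_group n" h
    using G h by (simp add: group_hom_def group_hom_axioms_def sym_group_is_group)
  have "h \<in> iso G ((sym_group n)\<lparr>carrier := h ` carrier G\<rparr>)"
    using h inj by (auto simp: iso_def hom_def bij_betw_def)
  then show "\<exists>H. subgroup H (sym_group n) \<and> G \<cong> (sym_group n)\<lparr>carrier := H\<rparr>"
    using img_is_subgroup by (auto simp: is_iso_def)
qed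

text \<open>
The symmetric group acts on \<open>{1..n}\<close>, so the action is carried over by a bijection of this set with \<open>E\<close>, and its
permutations are extended by the identity.
\<close>

lemma action_hom_sym_group:
  fixes G (structure)
  assumes G: "group G" and E: "finite E"
    and closed: "\<And>g x. g \<in> carrier G \<Longrightarrow> x \<in> E \<Longrightarrow> act g x \<in> E"
    and one: "\<And>x. x \<in> E \<Longrightarrow> act \<one> x = x"
    and mult: "\<And>g h x. g \<in> carrier G \<Longrightarrow> h \<in> carrier G \<Longrightarrow> x \<in> E \<Longrightarrow> act (g \<otimes> h) x = act g (act h x)"
  shows "\<exists>h \<in> hom G (sym_group (card E)). \<forall>g \<in> carrier G. h g = id \<longrightarrow> (\<forall>x \<in> E. act g x = x)"
proof -
  interpret group G by fact
  let ?N = "{1..card E}"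
  obtain f where f: "bij_betw f ?N E"
    using ex_bij_betw_nat_finite_1[OF E] by blast
  define f' where "f' = inv_into ?N f"
  have f'f: "f' (f i) = i" if "i \<in> ?N" for i using f that by (simp add: f'_def bij_betw_inv_into_left)
  have ff': "f (f' x) = x" if "x \<in> E" for x using f that by (simp add: f'_def bij_betw_inv_into_right)
  have fE: "f i \<in> E" if "i \<in> ?N" for i using f that by (auto simp: bij_betw_def)
  have f'N: "f' x \<in> ?N" if "x \<in> E" for x
    using bij_betw_inv_into[OF f] that unfolding f'_def by (metis bij_betw_apply)
  define h where "h g i = (if i \<in> ?N then f' (act g (f i)) else i)" for g i
  have h_in: "h g i = f' (act g (f i))" if "i \<in> ?N" for g i
    using that by (simp add: h_def del: atLeastAtMost_iff)
  have h_out: "h g i = i" if "i \<notin> ?N" for g i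
    using that by (simp add: h_def del: atLeastAtMost_iff)
  have hN: "h g i \<in> ?N" if "g \<in> carrier G" "i \<in> ?N" for g i
    unfolding h_in[OF that(2)] by (intro f'N closed fE that)
  have h_mult: "h (x \<otimes> y) = h x \<circ> h y" if "x \<in> carrier G" "y \<in> carrier G" for x y
  proof
    fix i
    show "h (x \<otimes> y) i = (h x \<circ> h y) i"
    proof (cases "i \<in> ?N")
      case True
      have "h x (h y i) = f' (act x (f (f' (act y (f i)))))"
        by (rule trans[OF h_in[OF hN[OF that(2) True]]]) (simp only: h_in[OF True])
      then show ?thesis using fE[OF True] that by (simp add: h_in[OF True] ff' closed mult)
    qed (simp add: h_out del: atLeastAtMost_iff)
  qed
  have h_one: "h \<one> = id"
    by (rule ext) (simp add: h_def one fE f'f del: atLeastAtMost_iff)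
  have perm: "h g permutes ?N" if g: "g \<in> carrier G" for g
  proof (rule bij_imp_permutes)
    have inv: "h (inv g) (h g i) = i" "h g (h (inv g) i) = i" for i
      using h_mult[of "inv g" g] h_mult[of g "inv g"] g h_one by (simp_all add: fun_eq_iff)
    show "bij_betw (h g) ?N ?N"
      by (rule bij_betw_byWitness[where f' = "h (inv g)"]) (use inv hN g in \<open>auto simp del: atLeastAtMost_iff\<close>)
  qed (rule h_out)
  have hom: "h \<in> hom G (sym_group (card E))"
    using perm h_mult by (simp add: hom_def sym_group_def)
  have "act g x = x" if g: "g \<in> carrier G" and id: "h g = id" and x: "x \<in> E" for g x
  proof -
    have "h g (f' x) = f' x" using id by simp
    then have "f' (act g x) = f' x" using f'N[OF x] x by (simp add: h_def ff' del: atLeastAtMost_iff)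
    then show "act g x = x" using ff' closed[OF g x] x by metis
  qed
  then show ?thesis using hom by blast
qed

lemma coset_action_hom:
  fixes G (structure)
  assumes G: "group G" and fin: "finite (carrier G)" and L: "subgroup L G"
  shows "\<exists>h \<in> hom G (sym_group (card (rcosets L))). \<forall>g \<in> carrier G. h g = id \<longrightarrow> g \<in> L"
proof -
  interpret group G by fact
  interpret L: subgroup L G by fact
  have ex: "\<exists>h \<in> hom G (sym_group (card (rcosets L))).
    \<forall>g \<in> carrier G. h g = id \<longrightarrow> (\<forall>X \<in> rcosets L. X #> inv g = X)"
  proof (rule action_hom_sym_group[OF G])
    show "finite (rcosets L)" using fin by (simp add: RCOSETS_def)
    fix X assume X: "X \<in> rcosets L"
    then have XG: "X \<subseteq> carrier G" by (rule L.rcosets_carrier[OF G])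
    then show "X #> inv \<one> = X" by simp
    obtain x where x: "x \<in> carrier G" "X = L #> x" using X by (auto simp: RCOSETS_def)
    fix g assume g: "g \<in> carrier G"
    then have "X #> inv g = L #> (x \<otimes> inv g)" using x L.subset by (simp add: coset_mult_assoc)
    then show "X #> inv g \<in> rcosets L" using x g by (auto simp: RCOSETS_def)
    fix h assume "h \<in> carrier G"
    then show "X #> inv (g \<otimes> h) = X #> inv h #> inv g"
      using g XG by (simp add: coset_mult_assoc inv_mult_group)
  qed
  have "g \<in> L" if g: "g \<in> carrier G" and "\<forall>X \<in> rcosets L. X #> inv g = X" for g
  proof -
    have "L #> inv g = L" using that(2) L.subgroup_in_rcosets[OF G] by blast
    then have "inv g \<in> L" using rcos_self[OF _ L, of "inv g"] g by simp
    then have "inv (inv g) \<in> L" by simp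
    then show ?thesis using g by simp
  qed
  with ex show ?thesis by metis
qed

lemma min_perm_degree_le:
  assumes "group G" "n > 0" "\<exists>h \<in> hom G (sym_group n). inj_on h (carrier G)"
  shows "min_perm_degree G \<le> n"
  unfolding min_perm_degree_def using assms embeds_iff by (intro Least_le) blast

lemma min_perm_degree_attained:
  fixes G (structure)
  assumes G: "group G" and fin: "finite (carrier G)"
  shows "min_perm_degree G > 0" and "\<exists>h \<in> hom G (sym_group (min_perm_degree G)). inj_on h (carrier G)"
proof -
  interpret group G by fact
  let ?P = "\<lambda>n. 0 < n \<and> (\<exists>H. subgroup H (sym_group n) \<and> G \<cong> (sym_group n)\<lparr>carrier := H\<rparr>)"
  have L: "subgroup {\<one>} G" by (rule triv_subgroup)
  obtain h where h: "h \<in> hom G (sym_group (card (rcosets {\<one>})))"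
    "\<And>g. g \<in> carrier G \<Longrightarrow> h g = id \<Longrightarrow> g = \<one>"
    using coset_action_hom[OF G fin L] by blast
  then interpret h: group_hom G "sym_group (card (rcosets {\<one>}))" h
    using G by (simp add: group_hom_def group_hom_axioms_def sym_group_is_group)
  have "inj_on h (carrier G)" using h(2) by (simp add: h.inj_on_one_iff sym_group_one)
  moreover have "card (rcosets {\<one>}) > 0"
    using lagrange[OF L] order_gt_0_iff_finite fin by (metis gr0I mult_0)
  ultimately have "?P (card (rcosets {\<one>}))" using embeds_iff[OF G] h(1) by blast
  then have "?P (min_perm_degree G)" unfolding min_perm_degree_def by (rule LeastI)
  then show "min_perm_degree G > 0" "\<exists>h \<in> hom G (sym_group (min_perm_degree G)). inj_on h (carrier G)"
    using embeds_iff[OF G] by blast+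
qed

text \<open>
The rows and columns of a matrix are numbered from \<open>0\<close>, the points of the symmetric group from \<open>1\<close>.
\<close>

definition perm_mat :: "nat \<Rightarrow> (nat \<Rightarrow> nat) \<Rightarrow> complex mat" where
  "perm_mat n q = mat n n (\<lambda>(i, j). if q (Suc j) = Suc i then 1 else 0)"

lemma perm_mat_carrier [simp]: "perm_mat n q \<in> carrier_mat n n"
  by (simp add: perm_mat_def)

lemma perm_mat_mult:
  assumes r: "r permutes {1..n}"
  shows "perm_mat n (q \<circ> r) = perm_mat n q * perm_mat n r"
proof (rule eq_matI)
  fix i j assume "i < dim_row (perm_mat n q * perm_mat n r)" "j < dim_col (perm_mat n q * perm_mat n r)"
  then have ij: "i < n" "j < n" by (simp_all add: perm_mat_def)
  have "r (Suc j) \<in> {1..n}" using permutes_in_image[OF r, of "Suc j"] ij by simp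
  then obtain l where l: "r (Suc j) = Suc l" "l < n"
    by (metis Suc_le_eq atLeastAtMost_iff not0_implies_Suc not_one_le_zero)
  have "(perm_mat n q * perm_mat n r) $$ (i, j) =
      (\<Sum>k<n. (if q (Suc k) = Suc i then 1 else 0) * (if r (Suc j) = Suc k then 1 else 0))"
    using ij by (simp add: perm_mat_def scalar_prod_def lessThan_atLeast0)
  also have "\<dots> = (\<Sum>k<n. if k = l then (if q (Suc l) = Suc i then 1 else 0) else 0)"
    by (rule sum.cong) (use l in auto)
  also have "\<dots> = perm_mat n (q \<circ> r) $$ (i, j)" using ij l by (simp add: perm_mat_def)
  finally show "perm_mat n (q \<circ> r) $$ (i, j) = (perm_mat n q * perm_mat n r) $$ (i, j)" by simp
qed (simp_all add: perm_mat_def)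

lemma perm_mat_one: "perm_mat n id = 1\<^sub>m n"
  by (rule eq_matI) (auto simp: perm_mat_def)

lemma perm_mat_inj:
  assumes "q permutes {1..n}" "r permutes {1..n}" "perm_mat n q = perm_mat n r"
  shows "q = r"
proof
  fix x
  show "q x = r x"
  proof (cases "x \<in> {1..n}")
    case True
    then obtain j where j: "x = Suc j" "j < n" by (cases x) auto
    have "q x \<in> {1..n}" using permutes_in_image[OF assms(1)] True by simp
    then obtain i where i: "q x = Suc i" "i < n" by (cases "q x") auto
    have "perm_mat n r $$ (i, j) = 1" unfolding assms(3)[symmetric] using i j by (simp add: perm_mat_def)
    then show ?thesis using i j by (simp add: perm_mat_def split: if_splits)
  next
    case False
    then show ?thesis using assms by (metis permutes_not_in)
  qed
qed

lemma complex_GL_simps: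
  "x \<otimes>\<^bsub>complex_GL n\<^esub> y = x * y" "\<one>\<^bsub>complex_GL n\<^esub> = 1\<^sub>m n"
  by (simp_all add: complex_GL_def units_of_def ring_mat_simps)

lemma complex_GL_carrier: "carrier (complex_GL n) \<subseteq> carrier_mat n n"
  by (auto simp: complex_GL_def units_of_def Units_def ring_mat_simps)

lemma group_complex_GL: "group (complex_GL n)"
proof -
  interpret semiring "ring_mat TYPE(complex) n ()" by (rule semiring_mat)
  show ?thesis unfolding complex_GL_def by (rule units_group)
qed

lemma perm_mat_quasi: "quasi_permutation_mat (perm_mat n q)"
proof -
  have "mat_trace (perm_mat n q) = (\<Sum>i<n. of_nat (if q (Suc i) = Suc i then 1 else 0))"
    by (auto simp: mat_trace_def perm_mat_def intro!: sum.cong)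
  also have "\<dots> = of_nat (\<Sum>i<n. if q (Suc i) = Suc i then 1 else 0)" by (rule of_nat_sum[symmetric])
  finally have "mat_trace (perm_mat n q) \<in> \<nat>" by (simp only: of_nat_in_Nats)
  then show ?thesis by (simp add: quasi_permutation_mat_def perm_mat_def)
qed

lemma perm_rep:
  assumes G: "group G" and "\<exists>h \<in> hom G (sym_group n). inj_on h (carrier G)"
  shows "\<exists>\<rho> \<in> hom G (complex_GL n). inj_on \<rho> (carrier G) \<and>
    (\<forall>g \<in> carrier G. quasi_permutation_mat (\<rho> g))"
proof -
  obtain h where h: "h \<in> hom G (sym_group n)" "inj_on h (carrier G)" using assms(2) by blast
  have perm: "h g permutes {1..n}" if "g \<in> carrier G" for g
    using hom_in_carrier[OF h(1) that] by (simp add: sym_group_def)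
  have GL: "perm_mat n q \<in> carrier (complex_GL n)" if q: "q permutes {1..n}" for q
  proof -
    have "perm_mat n q * perm_mat n (inv' q) = 1\<^sub>m n" "perm_mat n (inv' q) * perm_mat n q = 1\<^sub>m n"
      if "inv' = Hilbert_Choice.inv" for inv'
      using perm_mat_mult[OF permutes_inv[OF q], of q] perm_mat_mult[OF q, of "inv' q"] that
        permutes_inv_o[OF q] perm_mat_one by simp_all
    from this[OF refl] show ?thesis
      by (auto simp: complex_GL_def units_of_def Units_def ring_mat_simps intro!: bexI[of _ "perm_mat n (Hilbert_Choice.inv q)"])
  qed
  have "(\<lambda>g. perm_mat n (h g)) \<in> hom G (complex_GL n)"
  proof (rule homI)
    fix x y assume x: "x \<in> carrier G" and y: "y \<in> carrier G"
    then have "h (x \<otimes>\<^bsub>G\<^esub> y) = h x \<circ> h y" using hom_mult[OF h(1)] by (simp add: sym_group_mult)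
    then show "perm_mat n (h (x \<otimes>\<^bsub>G\<^esub> y)) = perm_mat n (h x) \<otimes>\<^bsub>complex_GL n\<^esub> perm_mat n (h y)"
      using perm_mat_mult[OF perm[OF y]] by (simp add: complex_GL_simps)
  qed (use GL perm in blast)
  moreover have "inj_on (\<lambda>g. perm_mat n (h g)) (carrier G)"
    using h(2) perm perm_mat_inj unfolding inj_on_def by blast
  ultimately show ?thesis using perm_mat_quasi by blast
qed

lemma min_quasi_perm_degree_le:
  fixes G (structure)
  assumes G: "group G" and fin: "finite (carrier G)"
  shows "min_quasi_perm_degree G \<le> min_perm_degree G"
  unfolding min_quasi_perm_degree_def
  by (rule Least_le) (use min_perm_degree_attained[OF assms] perm_rep[OF G] in blast)

lemma min_quasi_perm_degree_attained:
  fixes G (structure)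
  assumes G: "group G" and fin: "finite (carrier G)"
  shows "\<exists>\<rho> \<in> hom G (complex_GL (min_quasi_perm_degree G)). inj_on \<rho> (carrier G) \<and>
    (\<forall>g \<in> carrier G. quasi_permutation_mat (\<rho> g))"
proof -
  let ?P = "\<lambda>n. 0 < n \<and> (\<exists>\<rho> \<in> hom G (complex_GL n). inj_on \<rho> (carrier G) \<and>
           (\<forall>g \<in> carrier G. quasi_permutation_mat (\<rho> g)))"
  have "?P (min_perm_degree G)" using min_perm_degree_attained[OF assms] perm_rep[OF G] by blast
  then have "?P (min_quasi_perm_degree G)" unfolding min_quasi_perm_degree_def by (rule LeastI)
  then show ?thesis by blast
qed

lemma primitive_root_exists:
  assumes p: "prime (p::nat)"
  obtains \<omega> :: complex where "\<omega> ^ p = 1" "\<omega> \<noteq> 1"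
proof -
  obtain m where m: "p = Suc m" "m > 0" using prime_gt_1_nat[OF p] by (cases p) auto
  let ?f = "\<Sum>i<p. monom (1::complex) i"
  have "coeff ?f m = 1" using m by (simp add: coeff_sum)
  then have "degree ?f > 0" using m by (metis le_degree less_le_trans one_neq_zero)
  then have "\<not> constant (poly ?f)" by (simp add: constant_degree)
  then obtain \<omega> where "poly ?f \<omega> = 0" using fundamental_theorem_of_algebra by blast
  then have s: "(\<Sum>i<p. \<omega> ^ i) = 0" by (simp add: poly_sum poly_monom)
  have "\<omega> ^ p - 1 = (\<omega> - 1) * (\<Sum>i<p. \<omega> ^ i)" by (rule power_diff_1_eq)
  then have "\<omega> ^ p = 1" using s by simp
  moreover have "\<omega> \<noteq> 1"
  proof
    assume "\<omega> = 1"
    then have "(of_nat p :: complex) = 0" using s by simp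
    then show False using m by (simp only: of_nat_eq_0_iff)
  qed
  ultimately show ?thesis by (rule that)
qed

text \<open>
Since \<open>\<rho>\<close> is faithful, \<open>z\<close> has an eigenvalue \<open>\<zeta> \<noteq> 1\<close>; let \<open>t\<close> be the dimension of its eigenspace, to which
\<open>representation_degree_bound\<close> applies. The traces of \<open>z [^] i\<close> for \<open>0 < i < p\<close> are conjugate to the integer \<open>s\<close>
that is the trace of \<open>z\<close>, hence equal to it, and the formula for the trace of a projection gives \<open>p t = n - s\<close>.
As \<open>s \<ge> 0\<close>, it follows that \<open>p t \<le> n\<close>.
\<close>

lemma quasi_perm_rep_subgroup:
  fixes G (structure)
  assumes G: "group G" and p: "prime (p::nat)" and p3: "p \<ge> 3" and card: "Coset.order G = p ^ N"
    and z: "z \<in> group_center G" "z \<noteq> \<one>" "z [^] p = \<one>"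
    and \<rho>: "\<rho> \<in> hom G (complex_GL n)" "inj_on \<rho> (carrier G)"
    and quasi: "\<And>g. g \<in> carrier G \<Longrightarrow> quasi_permutation_mat (\<rho> g)"
  shows "\<exists>L. subgroup L G \<and> z \<notin> L \<and> Coset.order G \<le> card L * n"
proof -
  interpret group G by fact
  have p0: "p > 0" using p prime_gt_0_nat by blast
  have zG: "z \<in> carrier G" and zc: "\<And>x. x \<in> carrier G \<Longrightarrow> z \<otimes> x = x \<otimes> z"
    using z by (auto simp: group_center_def)
  have \<rho>c: "\<rho> g \<in> carrier_mat n n" if "g \<in> carrier G" for g
    using hom_in_carrier[OF \<rho>(1) that] complex_GL_carrier by blast
  define \<phi> where "\<phi> g = of_mat (\<rho> g)" for g
  have \<rho>_mult: "\<rho> (x \<otimes> y) = \<rho> x * \<rho> y" if "x \<in> carrier G" "y \<in> carrier G" for x y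
    using hom_mult[OF \<rho>(1) that] by (simp add: complex_GL_simps)
  interpret matrix_rep G "carrier G" \<phi>
  proof (intro matrix_rep.intro matrix_rep_axioms.intro)
    fix x y assume "x \<in> carrier G" "y \<in> carrier G"
    then show "\<phi> (x \<otimes> y) = \<phi> x * \<phi> y"
      unfolding \<phi>_def by (simp only: \<rho>_mult of_mat_mult[OF \<rho>c \<rho>c])
  qed (use G subgroup_self in auto)
  interpret h: group_hom G "complex_GL n" \<rho>
    using G \<rho> by (simp add: group_hom_def group_hom_axioms_def group_complex_GL)
  have \<rho>1: "\<rho> \<one> = 1\<^sub>m n" using h.hom_one by (simp add: complex_GL_simps)
  have tr1: "trace (\<phi> \<one>) = of_nat n"
    unfolding \<phi>_def \<rho>1 trace_of_mat[OF one_carrier_mat] by (simp add: mat_trace_def)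
  have nat: "\<exists>m. trace (\<phi> g) = of_nat m" if g: "g \<in> carrier G" for g
    using quasi[OF g] trace_of_mat[OF \<rho>c[OF g]] by (auto simp: quasi_permutation_mat_def \<phi>_def Nats_def)
  have zp: "\<phi> (z [^] p) = \<phi> \<one>" using z by simp
  have zne: "\<phi> z \<noteq> \<phi> \<one>"
    using of_mat_eq_iff[OF \<rho>c[OF zG] \<rho>c[OF one_closed]] inj_onD[OF \<rho>(2), of z \<one>] z zG by (auto simp: \<phi>_def)
  note prim = prime_root_of_unity_pow_ne_1[OF p] and powp = root_of_unity_pow
  \<comment> \<open>If \<open>1\<close> were the only eigenvalue, \<open>\<phi> z\<close> would be \<open>\<phi> \<one>\<close>.\<close>
  obtain \<zeta> where \<zeta>: "\<zeta> ^ p = 1" "\<zeta> \<noteq> 1" "eproj p z \<zeta> \<noteq> 0"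
  proof -
    obtain \<omega> :: complex where \<omega>: "\<omega> ^ p = 1" "\<omega> \<noteq> 1" using primitive_root_exists[OF p] by blast
    have sum: "(\<Sum>l<p. eproj p z (\<omega> ^ l)) = \<phi> \<one>"
      using eproj_sum[OF zG p0 \<omega>(1) prim[OF \<omega>], of 1] by simp
    have "\<exists>l. 0 < l \<and> l < p \<and> eproj p z (\<omega> ^ l) \<noteq> 0"
    proof (rule ccontr)
      assume "\<nexists>l. 0 < l \<and> l < p \<and> eproj p z (\<omega> ^ l) \<noteq> 0"
      then have "(\<Sum>l<p. eproj p z (\<omega> ^ l)) = (\<Sum>l<p. if l = 0 then eproj p z 1 else 0)"
        by (intro sum.cong) auto
      then have E1: "eproj p z 1 = \<phi> \<one>" using sum p0 by simp
      have "\<phi> z * eproj p z 1 = eproj p z 1"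
        using eproj_eigen[OF zG p0 zp, of 1] by (simp add: scale_simps)
      then show False using E1 zne rep_one_mult(2)[OF zG] by simp
    qed
    then obtain l where l: "0 < l" "l < p" "eproj p z (\<omega> ^ l) \<noteq> 0" by blast
    show ?thesis by (rule that[OF powp[OF \<omega>(1)] prim[OF \<omega> l(1,2)] l(3)])
  qed
  let ?E = "eproj p z \<zeta>"
  note idem = eproj_idempotent[OF zG p0 zp \<zeta>(1)]
  have E_comm: "\<phi> x * ?E = ?E * \<phi> x" if x: "x \<in> carrier G" for x
  proof -
    have "\<phi> x * \<phi> z = scale 1 (\<phi> z * \<phi> x)" using zc[OF x] x zG by (simp add: scale_simps flip: rep_mult)
    from eproj_intertwine[OF zG x this] show ?thesis by simp
  qed
  have rat: "trace (\<phi> x) \<in> rational_in \<zeta>" if "x \<in> carrier G" for x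
    using nat[OF that] rational_in_of_nat by auto
  have "p_matrix_rep G (carrier G) (\<lambda>x. ?E * \<phi> x) p N \<zeta> z"
  proof (intro p_matrix_rep.intro p_matrix_rep_axioms.intro)
    show "matrix_rep G (carrier G) (\<lambda>x. ?E * \<phi> x)"
      by (rule cut_by_idempotent[OF idem subgroup_self _ E_comm]) auto
    show "?E * \<phi> \<one> \<noteq> 0" using \<zeta> zG by (simp add: eproj_one)
    show "?E * \<phi> z = scale \<zeta> (?E * \<phi> \<one>)"
      using E_comm[OF zG] eproj_eigen[OF zG p0 zp \<zeta>(1)] zG by (simp add: eproj_one)
    fix x assume x: "x \<in> carrier G"
    show "trace (?E * \<phi> x) \<in> rational_in \<zeta>"
      using eproj_trace_rational[OF zG x p0, of \<zeta> 1] rat \<zeta> by simp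
  qed (use p p3 card \<zeta> zG G subgroup_self in auto)
  from representation_degree_bound[OF this]
  obtain L t where L: "subgroup L G" "z \<notin> L" "trace (?E * \<phi> \<one>) = of_nat t" "card (carrier G) \<le> card L * (p * t)"
    by auto
  have trE: "trace ?E = of_nat t" using L(3) zG by (simp add: eproj_one)
  obtain s where s: "trace (\<phi> z) = of_nat s" using nat[OF zG] by blast
  have trz: "trace (\<phi> (z [^] i)) = of_nat s" if i: "0 < i" "i < p" for i
  proof -
    have "\<exists>m. trace (eproj p z (\<zeta> ^ l)) = of_nat m" for l
      using eproj_nat_trace[OF zG p0 zp powp[OF \<zeta>(1), of l]] by blast
    then obtain m where m: "\<And>l. trace (eproj p z (\<zeta> ^ l)) = of_nat (m l)" by metis
    let ?f = "(\<Sum>l<p. monom (int (m l)) l) - [:int s:]"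
    have ev: "ipoly ?f x = (\<Sum>l<p. of_nat (m l) * x ^ l) - of_nat s" for x
      by (simp add: hom_distribs poly_sum poly_monom)
    have trp: "trace (\<phi> (z [^] i)) = (\<Sum>l<p. of_nat (m l) * (\<zeta> ^ i) ^ l)" for i :: nat
      using rep_pow_trace[OF zG p0 zp \<zeta>(1) prim[OF \<zeta>(1,2)], of i]
      by (simp add: m power_mult[symmetric] mult.commute)
    have "ipoly ?f \<zeta> = 0" using trp[of 1] s zG unfolding ev by simp
    then have "ipoly ?f (\<zeta> ^ i) = 0"
      by (rule ipoly_prime_power_root_conjugate[OF p, of \<zeta> 0, rotated 4])
        (use \<zeta> powp[OF \<zeta>(1), of i] prim[OF \<zeta>(1,2) i] in auto)
    then show ?thesis unfolding ev trp by simp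
  qed
  have "of_nat (p * t + s) = (of_nat n :: complex)"
  proof -
    let ?c = "\<lambda>i. inverse \<zeta> ^ i * trace (\<phi> (z [^] i))"
    have \<zeta>0: "\<zeta> \<noteq> 0" using root_of_unity_nonzero[OF \<zeta>(1) p0] .
    have s0: "(\<Sum>i<p. inverse \<zeta> ^ i) = 0"
      by (rule sum_powers_root_of_unity) (use \<zeta> in \<open>simp_all add: power_inverse\<close>)
    have "of_nat (p * t) = of_nat p * trace ?E" using trE by simp
    also have "\<dots> = (\<Sum>i<p. ?c i)" unfolding eproj_trace using p0 by simp
    also have "\<dots> = (\<Sum>i<p. (if i = 0 then of_nat n - of_nat s else 0) + inverse \<zeta> ^ i * of_nat s)"
      by (rule sum.cong) (use trz tr1 in auto)
    also have "\<dots> = of_nat n - of_nat s + (\<Sum>i<p. inverse \<zeta> ^ i) * of_nat s"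
      using p0 by (simp add: sum.distrib sum_distrib_right)
    finally show ?thesis using s0 by simp
  qed
  then have "p * t + s = n" by (simp only: of_nat_eq_iff)
  then have "p * t \<le> n" by simp
  then have "card L * (p * t) \<le> card L * n" by (rule mult_le_mono2)
  then have "Coset.order G \<le> card L * n"
    unfolding Coset.order_def by (rule le_trans[OF L(4)])
  then show ?thesis using L by blast
qed

section \<open>The degrees of a p-group\<close>

lemma (in group) subgroup_center: "subgroup (group_center G) G"
proof (rule subgroupI)
  show "group_center G \<noteq> {}" by (auto simp: group_center_def intro!: exI[of _ "\<one>"])
  fix x assume x: "x \<in> group_center G"
  have "inv x \<otimes> y = y \<otimes> inv x" if y: "y \<in> carrier G" for y
  proof -
    have "x \<otimes> inv y = inv y \<otimes> x" and xG: "x \<in> carrier G" using x y by (auto simp: group_center_def)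
    then have "inv (x \<otimes> inv y) = inv (inv y \<otimes> x)" by simp
    then show ?thesis using xG y by (simp add: inv_mult_group)
  qed
  then show "inv x \<in> group_center G" using x by (auto simp: group_center_def)
  fix y assume y: "y \<in> group_center G"
  have xyG: "x \<in> carrier G" "y \<in> carrier G" using x y by (auto simp: group_center_def)
  have comm: "x \<otimes> y \<otimes> g = g \<otimes> (x \<otimes> y)" if g: "g \<in> carrier G" for g
  proof -
    have "x \<otimes> y \<otimes> g = x \<otimes> (y \<otimes> g)" using xyG g by (rule m_assoc)
    also have "y \<otimes> g = g \<otimes> y" using y g by (simp add: group_center_def)
    also have "x \<otimes> (g \<otimes> y) = x \<otimes> g \<otimes> y" using xyG g by (simp add: m_assoc)
    also have "x \<otimes> g = g \<otimes> x" using x g by (simp add: group_center_def)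
    finally show ?thesis using xyG g by (simp add: m_assoc)
  qed
  have "x \<otimes> y \<in> carrier G" using xyG by simp
  with comm show "x \<otimes> y \<in> group_center G" unfolding group_center_def by blast
qed (auto simp: group_center_def)

text \<open>
The action on the cosets of a subgroup without \<open>z\<close> is faithful: otherwise its kernel would contain a central
element of order \<open>p\<close>, and in the cyclic center this element generates the same subgroup as \<open>z\<close>. So each such
subgroup bounds \<open>\<mu>(G)\<close> by its index. The subgroup obtained from a faithful quasi-permutation representation of least degree gives
\<open>\<mu>(G) \<le> c(G)\<close>; the subgroup generated by a noncentral element of order \<open>p\<close> gives \<open>\<mu>(G) \<le> p ^ (n - 1)\<close>.
\<close>

lemma p_group_cyclic_center_degrees:
  fixes G (structure)
  assumes p: "prime (p::nat)" and p3: "p \<ge> 3" and G: "group G" and card: "Coset.order G = p ^ n"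
    and noncomm: "\<not> comm_group G" and cyc: "cyclic_group (G\<lparr>carrier := group_center G\<rparr>)"
  shows "min_quasi_perm_degree G = min_perm_degree G \<and>
    min_perm_degree G \<in> {p ^ i | i. 2 \<le> i \<and> i \<le> n - 1}"
proof -
  interpret group G by fact
  have p0: "p > 0" using p prime_gt_0_nat by blast
  have p1: "p > 1" using p prime_gt_1_nat by blast
  have fin: "finite (carrier G)"
    by (rule finite_carrier_if_prime_power_order[OF p card])
  let ?Z = "group_center G"
  have ZG: "?Z \<subseteq> carrier G" by (auto simp: group_center_def)
  have ne1: "carrier G \<noteq> {\<one>}"
  proof
    assume *: "carrier G = {\<one>}"
    have "comm_group G" by (rule group_comm_groupI) (use * in auto)
    then show False using noncomm by simp
  qed
  obtain z where z: "z \<in> ?Z" "z \<noteq> \<one>" "z [^] p = \<one>"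
    using normal_subgroup_meets_center_order_p[OF G p card normal_self ne1] by auto
  have zG: "z \<in> carrier G" using z ZG by auto
  have subZ: "subgroup ?Z G" by (rule subgroup_center)
  let ?ZG = "G\<lparr>carrier := ?Z\<rparr>"
  interpret Z: group ?ZG by (rule subgroup.subgroup_is_group[OF subZ G])
  obtain a where a: "a \<in> ?Z" and aZ: "\<And>y. y \<in> ?Z \<Longrightarrow> \<exists>i::nat. y = a [^] i"
  proof -
    obtain a where a: "a \<in> carrier ?ZG" "carrier ?ZG = range (\<lambda>n::int. a [^]\<^bsub>?ZG\<^esub> n)"
      using cyc unfolding Z.cyclic_group by blast
    have finZ: "finite (carrier ?ZG)" using fin ZG finite_subset by auto
    have "generate ?ZG {a} = carrier ?ZG" unfolding a(2) Z.generate_pow[OF a(1)] by auto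
    then have "?Z = {a [^]\<^bsub>?ZG\<^esub> k | k. k \<in> (UNIV :: nat set)}"
      using Z.generate_pow_on_finite_carrier[OF finZ a(1)] by simp
    then have "\<exists>i::nat. y = a [^]\<^bsub>?ZG\<^esub> i" if "y \<in> ?Z" for y using that by blast
    moreover have "a [^]\<^bsub>?ZG\<^esub> i = a [^] i" for i :: nat by (simp add: nat_pow_def)
    ultimately show ?thesis using that a(1) by simp
  qed
  have aG: "a \<in> carrier G" using a ZG by auto
  obtain m where m: "ord a = p ^ m"
    using ord_dvd_group_order[OF aG] card p divides_primepow_nat by metis
  obtain l :: nat where l: "z = a [^] l" using aZ z by blast
  have core: "\<exists>h \<in> hom G (sym_group (card (rcosets L))). inj_on h (carrier G)"
    if L: "subgroup L G" "z \<notin> L" for L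
  proof -
    obtain h where h: "h \<in> hom G (sym_group (card (rcosets L)))"
      "\<And>g. g \<in> carrier G \<Longrightarrow> h g = id \<Longrightarrow> g \<in> L"
      using coset_action_hom[OF G fin L(1)] by blast
    then interpret h: group_hom G "sym_group (card (rcosets L))" h
      using G by (simp add: group_hom_def group_hom_axioms_def sym_group_is_group)
    let ?K = "kernel G (sym_group (card (rcosets L))) h"
    have "?K = {\<one>}"
    proof (rule ccontr)
      assume "?K \<noteq> {\<one>}"
      then obtain y where y: "y \<in> ?K" "y \<in> ?Z" "y \<noteq> \<one>" "y [^] p = \<one>"
        using normal_subgroup_meets_center_order_p[OF G p card h.normal_kernel] by blast
      obtain i :: nat where i: "y = a [^] i" using aZ y by blast
      obtain t :: nat where t: "z = y [^] t"
        using cyclic_p_torsion[OF p aG m i y(4,3) l z(3)] by blast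
      have "h z = h y [^]\<^bsub>sym_group (card (rcosets L))\<^esub> t"
        unfolding t using y(2) ZG by (intro h.hom_nat_pow) auto
      also have "\<dots> = id" using y(1) h.H.nat_pow_one by (simp add: kernel_def sym_group_one)
      finally show False using h(2)[OF zG] L(2) by simp
    qed
    then show ?thesis using h(1) h.inj_iff_trivial_ker by blast
  qed
  have index_bound: "min_perm_degree G \<le> card (rcosets L)" and index_pos: "card (rcosets L) * card L = p ^ n"
    if L: "subgroup L G" "z \<notin> L" for L
  proof -
    show i: "card (rcosets L) * card L = p ^ n" using lagrange[OF L(1)] card by simp
    have "card (rcosets L) > 0" using i p0 by (metis gr0I mult_0 power_not_zero not_gr_zero)
    then show "min_perm_degree G \<le> card (rcosets L)"
      using core[OF L] by (intro min_perm_degree_le[OF G]) auto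
  qed
  obtain \<rho> where \<rho>: "\<rho> \<in> hom G (complex_GL (min_quasi_perm_degree G))" "inj_on \<rho> (carrier G)"
    "\<And>g. g \<in> carrier G \<Longrightarrow> quasi_permutation_mat (\<rho> g)"
    using min_quasi_perm_degree_attained[OF G fin] by blast
  obtain L where L: "subgroup L G" "z \<notin> L" "Coset.order G \<le> card L * min_quasi_perm_degree G"
    using quasi_perm_rep_subgroup[OF G p p3 card z \<rho>] by blast
  have Lpos: "card L > 0" using index_pos[OF L(1,2)] p0 by (metis gr0I mult_0_right power_not_zero not_gr_zero)
  have "card L * card (rcosets L) \<le> card L * min_quasi_perm_degree G"
    using L(3) card index_pos[OF L(1,2)] by (simp add: mult.commute)
  then have "card (rcosets L) \<le> min_quasi_perm_degree G" using Lpos by simp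
  then have eq: "min_quasi_perm_degree G = min_perm_degree G" "min_perm_degree G = card (rcosets L)"
    using index_bound[OF L(1,2)] min_quasi_perm_degree_le[OF G fin] by auto
  have "min_perm_degree G dvd p ^ n" using eq(2) index_pos[OF L(1,2)] by (metis dvd_triv_left)
  then obtain i where i: "min_perm_degree G = p ^ i" using p divides_primepow_nat by blast
  have "2 \<le> i"
  proof (rule ccontr)
    assume "\<not> 2 \<le> i"
    then have ip: "p ^ i dvd p" by (cases i) auto
    obtain h where h: "h \<in> hom G (sym_group (p ^ i))" "inj_on h (carrier G)"
      using min_perm_degree_attained(2)[OF G fin] i by auto
    interpret h: group_hom G "sym_group (p ^ i)" h
      using G h by (simp add: group_hom_def group_hom_axioms_def sym_group_is_group)
    have "card (h ` carrier G) dvd Coset.order (sym_group (p ^ i))"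
      using group.lagrange[OF sym_group_is_group h.img_is_subgroup] by (metis dvd_triv_right)
    moreover have "card (h ` carrier G) = p ^ n" using card_image[OF h(2)] card by (simp add: Coset.order_def)
    moreover have "Coset.order (sym_group (p ^ i)) = fact (p ^ i)"
      by (simp add: Coset.order_def sym_group_card_carrier)
    ultimately have "p ^ n dvd (fact (p ^ i) :: nat)" by simp
    also have "(fact (p ^ i) :: nat) dvd fact p" using ip p0 by (intro fact_dvd) (simp add: dvd_imp_le)
    finally have d: "p ^ n dvd (fact p :: nat)" .
    have "n \<le> 1"
    proof (rule ccontr)
      assume "\<not> n \<le> 1"
      then have "p * p dvd p ^ n" by (metis le_imp_power_dvd not_less_eq_eq numeral_2_eq_2 One_nat_def power2_eq_square)
      then have "p * p dvd p * fact (p - 1)" using d p0 by (metis dvd_trans fact_reduce of_nat_id)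
      then have "p dvd (fact (p - 1) :: nat)" using p0 by simp
      then show False using prime_dvd_fact_iff[OF p, of "p - 1"] p0 by simp
    qed
    then have "p ^ n \<le> p ^ 1" using p0 by (intro power_increasing) auto
    have ordz: "ord z = p"
    proof -
      have "ord z dvd p" using z zG pow_eq_id by blast
      moreover have "ord z \<noteq> 1" using z zG ord_eq_1 by blast
      ultimately show ?thesis using p prime_nat_iff by blast
    qed
    have gz: "generate G {z} \<subseteq> ?Z" using generate_subgroup_incl[OF _ subZ] z by auto
    have "card (carrier G) \<le> card (generate G {z})"
      using \<open>p ^ n \<le> p ^ 1\<close> card ordz generate_pow_card[OF zG] by (simp add: Coset.order_def)
    moreover have "generate G {z} \<subseteq> carrier G" using generate_incl zG by auto
    ultimately have "generate G {z} = carrier G" using card_seteq[OF fin] by blast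
    then have all: "carrier G \<subseteq> ?Z" using gz by simp
    have "comm_group G" by (rule group_comm_groupI) (use all in \<open>auto simp: group_center_def\<close>)
    then show False using noncomm by simp
  qed
  moreover have "i \<le> n - 1"
  proof -
    have "\<not> cyclic_group G" using noncomm cyclic_imp_abelian_group by blast
    from noncyclic_p_group_normal_rank_two[OF G p p3 card this z]
    obtain w where w: "w \<in> carrier G" "w \<notin> range (\<lambda>i::nat. z [^] i)" "w [^] p = \<one>" by blast
    have w1: "w \<noteq> \<one>" using w(2) by (metis nat_pow_0 rangeI)
    have ordw: "ord w = p ^ 1"
    proof -
      have "ord w dvd p" using w pow_eq_id by blast
      moreover have "ord w \<noteq> 1" using w w1 ord_eq_1 by blast
      ultimately show ?thesis using p prime_nat_iff by auto
    qed
    let ?L = "generate G {w}"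
    have subL: "subgroup ?L G" using generate_is_subgroup w by auto
    have "z \<notin> ?L"
    proof
      assume "z \<in> ?L"
      then obtain t :: nat where t: "z = w [^] t" using generate_pow_on_finite_carrier[OF fin w(1)] by auto
      have "w = w [^] (1::nat)" using w by simp
      from cyclic_p_torsion[OF p w(1) ordw t z(3,2) this w(3)] show False using w(2) by auto
    qed
    from index_bound[OF subL this] index_pos[OF subL this]
    have "p ^ i * p \<le> p ^ n" using i generate_pow_card[OF w(1)] ordw by (metis mult_le_mono1 power_one_right)
    then have "p ^ Suc i \<le> p ^ n" by (simp add: mult.commute)
    then have "Suc i \<le> n" using p1 by (rule power_le_imp_le_exp[rotated])
    then show ?thesis by simp
  qed
  ultimately show ?thesis using eq(1) i by blast
qed

text \<open>
A point moved by \<open>q ^^ (p ^ k)\<close> lies in a cycle of \<open>q\<close> whose length divides \<open>p ^ Suc k\<close> but not \<open>p ^ k\<close>.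
\<close>

lemma permutation_order_prime_power_le:
  assumes p: "prime (p::nat)" and q: "q permutes {1..M}"
    and id: "q ^^ (p ^ Suc k) = id" and nid: "q ^^ (p ^ k) \<noteq> id"
  shows "p ^ Suc k \<le> M"
proof -
  obtain x where x: "(q ^^ (p ^ k)) x \<noteq> x" using nid by (auto simp: fun_eq_iff)
  have perm: "(q ^^ j) permutes {1..M}" for j
    by (rule permutes_funpow[OF q])
  have xM: "x \<in> {1..M}" using x permutes_not_in[OF perm] by metis
  have mult: "(q ^^ (j * u)) x = x" if "(q ^^ j) x = x" for j u
    by (induction u) (auto simp: funpow_add that)
  have period: False if d: "0 < d" "d < p ^ Suc k" "(q ^^ d) x = x" for d
  proof -
    obtain u v where uv: "d * u = p ^ Suc k * v + gcd d (p ^ Suc k)" using bezout_nat[of d "p ^ Suc k"] d by blast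
    obtain j where j: "gcd d (p ^ Suc k) = p ^ j" "j \<le> Suc k"
      using divides_primepow_nat[OF p, of "gcd d (p ^ Suc k)" "Suc k"] by auto
    have "j \<noteq> Suc k"
    proof
      assume "j = Suc k"
      then have "p ^ Suc k dvd d" using j by (metis gcd_dvd1)
      then show False using d by (simp add: dvd_imp_le leD)
    qed
    then have jk: "p ^ k = p ^ j * p ^ (k - j)" using j by (simp flip: power_add)
    have "x = (q ^^ (d * u)) x" using mult[OF d(3)] by simp
    also have "\<dots> = (q ^^ (p ^ j + p ^ Suc k * v)) x" unfolding uv j by (simp add: add.commute)
    also have "\<dots> = (q ^^ (p ^ j)) ((q ^^ (p ^ Suc k * v)) x)" by (simp add: funpow_add del: power_Suc)
    also have "(q ^^ (p ^ Suc k * v)) x = x" by (rule mult) (simp only: id id_apply)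
    finally have "(q ^^ (p ^ j)) x = x" by simp
    then show False using mult[of "p ^ j" "p ^ (k - j)"] jk x by simp
  qed
  have inj: "inj_on (\<lambda>j. (q ^^ j) x) {..<p ^ Suc k}"
  proof (rule linorder_inj_onI)
    fix a b assume ab: "a < b" "a \<in> {..<p ^ Suc k}" "b \<in> {..<p ^ Suc k}"
    show "(q ^^ a) x \<noteq> (q ^^ b) x"
    proof
      assume "(q ^^ a) x = (q ^^ b) x"
      also have "(q ^^ b) x = (q ^^ a) ((q ^^ (b - a)) x)"
        using ab(1) by (metis add_diff_inverse_nat comp_apply funpow_add less_imp_not_less)
      finally have "(q ^^ (b - a)) x = x"
        using permutes_inj[OF perm] by (metis injD)
      moreover have "0 < b - a" "b - a < p ^ Suc k" using ab by (auto simp del: power_Suc)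
      ultimately show False using period by blast
    qed
  qed (auto)
  have "(\<lambda>j. (q ^^ j) x) ` {..<p ^ Suc k} \<subseteq> {1..M}"
    using permutes_in_image[OF perm] xM by blast
  then have "card {..<p ^ Suc k} \<le> card {1..M}" by (intro card_inj_on_le[OF inj]) auto
  then show ?thesis by simp
qed

lemma sym_group_pow: "q [^]\<^bsub>sym_group m\<^esub> (k::nat) = q ^^ k"
  by (induction k) (simp_all add: sym_group_mult sym_group_one nat_pow_def funpow_Suc_right del: funpow.simps)

text \<open>
The cycle \<open>1 \<mapsto> 2 \<mapsto> \<dots> \<mapsto> m \<mapsto> 1\<close>, extended by the identity.
\<close>

definition full_cycle :: "nat \<Rightarrow> nat \<Rightarrow> nat" where
  "full_cycle m x = (if x \<in> {1..m} then x mod m + 1 else x)"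

lemma full_cycle_pow:
  assumes "m > 0"
  shows "(full_cycle m ^^ k) x = (if x \<in> {1..m} then (x - 1 + k) mod m + 1 else x)"
proof (induction k)
  case 0
  then show ?case by auto
next
  case (Suc k)
  have r: "y mod m + 1 \<in> {1..m}" for y using assms by (simp add: Suc_leI)
  show ?case
  proof (cases "x \<in> {1..m}")
    case True
    then have "(full_cycle m ^^ Suc k) x = full_cycle m ((x - 1 + k) mod m + 1)" using Suc by simp
    also have "\<dots> = ((x - 1 + k) mod m + 1) mod m + 1" using r by (simp only: full_cycle_def if_True)
    also have "\<dots> = (x - 1 + Suc k) mod m + 1" by (simp add: mod_Suc_eq)
    finally show ?thesis using True by simp
  next
    case False
    have "(full_cycle m ^^ Suc k) x = full_cycle m x"
      unfolding funpow.simps comp_apply Suc by (simp only: False if_False)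
    also have "\<dots> = x" by (simp only: full_cycle_def False if_False)
    finally show ?thesis by (simp only: False if_False)
  qed
qed

lemma full_cycle_pow_id_iff:
  assumes "m > 0"
  shows "full_cycle m ^^ k = id \<longleftrightarrow> m dvd k"
proof
  assume "full_cycle m ^^ k = id"
  then have "(full_cycle m ^^ k) 1 = 1" by simp
  then have "k mod m = 0" unfolding full_cycle_pow[OF assms] using assms by (simp add: Suc_leI)
  then show "m dvd k" by auto
next
  assume "m dvd k"
  then obtain c where c: "k = m * c" by auto
  have "(x - 1 + k) mod m + 1 = x" if x: "x \<in> {1..m}" for x
  proof -
    obtain y where "x = Suc y" "y < m" using x by (cases x) auto
    then show ?thesis unfolding c by simp
  qed
  then show "full_cycle m ^^ k = id"
    unfolding fun_eq_iff full_cycle_pow[OF assms] by simp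
qed

lemma full_cycle_permutes:
  assumes "m > 0"
  shows "full_cycle m permutes {1..m}"
proof (rule bij_imp_permutes)
  have inv: "full_cycle m ((full_cycle m ^^ (m - 1)) x) = x" "(full_cycle m ^^ (m - 1)) (full_cycle m x) = x" for x
  proof -
    have "full_cycle m ^^ m = id" using full_cycle_pow_id_iff[OF assms, of m] by simp
    moreover have "full_cycle m ^^ m = full_cycle m \<circ> (full_cycle m ^^ (m - 1))"
      using assms by (cases m) simp_all
    moreover have "full_cycle m ^^ m = (full_cycle m ^^ (m - 1)) \<circ> full_cycle m"
      using assms by (cases m) (simp_all add: funpow_Suc_right del: funpow.simps)
    ultimately show "full_cycle m ((full_cycle m ^^ (m - 1)) x) = x" "(full_cycle m ^^ (m - 1)) (full_cycle m x) = x"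
      by (metis comp_apply id_apply)+
  qed
  have "full_cycle m x \<in> {1..m}" if "x \<in> {1..m}" for x
    using that assms by (simp add: full_cycle_def Suc_leI)
  moreover have "(full_cycle m ^^ (m - 1)) x \<in> {1..m}" if "x \<in> {1..m}" for x
    unfolding full_cycle_pow[OF assms] using that assms by (simp add: Suc_leI)
  ultimately show "bij_betw (full_cycle m) {1..m} {1..m}"
    by (intro bij_betw_byWitness[where f' = "full_cycle m ^^ (m - 1)"]) (use inv in auto)
qed (auto simp: full_cycle_def)

text \<open>
Among the factors of the factorial, the \<open>k\<close> multiples of \<open>p\<close> contribute one factor \<open>p\<close> each.
\<close>

lemma power_dvd_fact:
  assumes p: "(p::nat) > 0"
  shows "p ^ k dvd (fact (p * k) :: nat)"
proof (induction k)
  case (Suc k)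
  have pos: "0 < p * Suc k" using p by simp
  have fact_step: "fact (p * Suc k) = p * Suc k * (fact (p * Suc k - 1) :: nat)"
    by (subst fact_reduce[OF pos]) simp
  have "(fact (p * k) :: nat) dvd fact (p * Suc k - 1)"
  proof (rule fact_dvd)
    show "p * k \<le> p * Suc k - 1" using p by (cases p) auto
  qed
  then have "p ^ k dvd (fact (p * Suc k - 1) :: nat)" using Suc dvd_trans by blast
  then have "p * p ^ k dvd (p * Suc k) * (fact (p * Suc k - 1) :: nat)"
    by (intro mult_dvd_mono) simp_all
  then show ?case unfolding fact_step by simp
qed simp

lemma finite_group_iso_nat:
  fixes G (structure)
  assumes G: "group G" and fin: "finite (carrier G)"
  shows "\<exists>H :: nat monoid. group H \<and> G \<cong> H"
proof -
  interpret group G by fact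
  obtain f :: "'a \<Rightarrow> nat" where inj: "inj_on f (carrier G)"
    using finite_imp_inj_to_nat_seg[OF fin] by blast
  let ?f' = "inv_into (carrier G) f"
  let ?M = "\<lparr>carrier = UNIV, mult = \<lambda>x y. f (?f' x \<otimes> ?f' y), one = f \<one>\<rparr> :: nat monoid"
  let ?H = "?M\<lparr>carrier := f ` carrier G, one := f \<one>\<rparr>"
  have "f \<in> hom G ?M" using inj by (simp add: hom_def)
  then have "group ?H" by (rule hom_imp_img_group)
  moreover have "f \<in> iso G ?H" using inj by (auto simp: iso_def hom_def bij_betw_def)
  ultimately show ?thesis by (auto simp: is_iso_def)
qed

lemma min_perm_degree_iso:
  assumes "group G" "G \<cong> H"
  shows "min_perm_degree G = min_perm_degree H"
proof -
  have "G \<cong> K \<longleftrightarrow> H \<cong> K" for K :: "(nat \<Rightarrow> nat) monoid"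
    using iso_trans[OF group.iso_sym[OF assms]] iso_trans[OF assms(2)] by blast
  then show ?thesis unfolding min_perm_degree_def by simp
qed

text \<open>
The group is any subgroup of order \<open>p ^ n\<close> of the symmetric group on \<open>p ^ i\<close> points that contains a cycle of
length \<open>p ^ i\<close>. It exists because \<open>p ^ n\<close> divides \<open>p ^ p\<close>, which divides the factorial of \<open>p * p\<close>. The cycle
forces the lower bound for the degree.
\<close>

lemma p_group_prescribed_min_perm_degree:
  assumes i: "2 \<le> i" "i \<le> n" and p: "prime (p::nat)" and pn: "n \<le> p"
  shows "\<exists>H :: nat monoid. group H \<and> Coset.order H = p ^ n \<and> min_perm_degree H = p ^ i"
proof -
  let ?m = "p ^ i"
  let ?S = "sym_group ?m"
  let ?c = "full_cycle ?m"
  have p0: "p > 0" using p prime_gt_0_nat by blast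
  have m0: "?m > 0" using p0 by simp
  interpret S: group ?S by (rule sym_group_is_group)
  have finS: "finite (carrier ?S)"
    using S.order_gt_0_iff_finite by (simp add: Coset.order_def sym_group_card_carrier)
  have cS: "?c \<in> carrier ?S" using full_cycle_permutes[OF m0] by (simp add: sym_group_def)
  have ordc: "S.ord ?c = ?m"
    using full_cycle_pow_id_iff[OF m0] by (simp add: S.ord_unique[OF cS] sym_group_pow sym_group_one)
  have "p ^ n dvd Coset.order ?S"
  proof -
    have "p ^ n dvd p ^ p" using pn by (rule le_imp_power_dvd)
    also have "\<dots> dvd fact (p * p)" by (rule power_dvd_fact[OF p0])
    also have "\<dots> dvd fact ?m"
    proof (rule fact_dvd)
      have "p ^ 2 \<le> p ^ i" using i p0 by (intro power_increasing) auto
      then show "p * p \<le> p ^ i" by (simp add: power2_eq_square)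
    qed
    finally show ?thesis by (simp add: Coset.order_def sym_group_card_carrier)
  qed
  moreover have "subgroup (generate ?S {?c}) ?S" using S.generate_is_subgroup cS by auto
  moreover have "card (generate ?S {?c}) = p ^ i" using S.generate_pow_card[OF cS] ordc by simp
  ultimately obtain T where T: "subgroup T ?S" "card T = p ^ n" "generate ?S {?c} \<subseteq> T"
    using p_subgroup_extend[OF S.is_group finS p _ _ i(2)] by blast
  have cT: "?c \<in> T" using T(3) by (auto intro: generate.incl)
  let ?T = "?S\<lparr>carrier := T\<rparr>"
  have grpT: "group ?T" by (rule subgroup.subgroup_is_group[OF T(1) S.is_group])
  have finT: "finite (carrier ?T)" using finS subgroup.subset[OF T(1)] finite_subset by auto
  have upper: "min_perm_degree ?T \<le> ?m"
  proof (rule min_perm_degree_le[OF grpT m0])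
    have "(\<lambda>x. x) \<in> hom ?T ?S" using subgroup.subset[OF T(1)] by (auto simp: hom_def)
    then show "\<exists>h\<in>hom ?T ?S. inj_on h (carrier ?T)" by (auto simp: inj_on_def)
  qed
  have lower: "?m \<le> min_perm_degree ?T"
  proof -
    let ?M = "min_perm_degree ?T"
    obtain h where h: "h \<in> hom ?T (sym_group ?M)" "inj_on h (carrier ?T)"
      using min_perm_degree_attained(2)[OF grpT finT] by blast
    interpret h: group_hom ?T "sym_group ?M" h
      using grpT h by (simp add: group_hom_def group_hom_axioms_def sym_group_is_group)
    have Tpow: "?c [^]\<^bsub>?T\<^esub> (k::nat) = ?c ^^ k" for k
      using sym_group_pow[of ?m ?c k] by (simp add: nat_pow_def)
    have pow: "(h ?c) ^^ k = h (?c ^^ k)" for k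
    proof -
      have "?c \<in> carrier ?T" using cT by simp
      from h.hom_nat_pow[OF this, of k] show ?thesis unfolding Tpow sym_group_pow by simp
    qed
    have h1: "h id = id" using h.hom_one by (simp add: sym_group_one)
    obtain k where k: "i = Suc k" using i by (cases i) auto
    have "p ^ Suc k \<le> ?M"
    proof (rule permutation_order_prime_power_le[OF p])
      show "h ?c permutes {1..?M}" using h.hom_closed[of ?c] cT by (simp add: sym_group_def)
      show "h ?c ^^ (p ^ Suc k) = id"
        unfolding pow using full_cycle_pow_id_iff[OF m0, of ?m] h1 k by simp
      show "h ?c ^^ (p ^ k) \<noteq> id"
      proof
        assume "h ?c ^^ (p ^ k) = id"
        then have "h (?c ^^ (p ^ k)) = h id" using pow h1 by simp
        moreover have "?c ^^ (p ^ k) \<in> T"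
          using monoid.nat_pow_closed[of ?T ?c "p ^ k"] grpT cT Tpow by (simp add: group_def)
        moreover have "id \<in> T" using subgroup.one_closed[OF T(1)] by (simp add: sym_group_one)
        ultimately have "?c ^^ (p ^ k) = id" using h(2) by (auto simp: inj_on_def)
        then have "?m dvd p ^ k" using full_cycle_pow_id_iff[OF m0] by blast
        then have "p ^ Suc k \<le> p ^ k" using k p0 by (intro dvd_imp_le) auto
        then show False using prime_gt_1_nat[OF p] by simp
      qed
    qed
    then show ?thesis using k by simp
  qed
  obtain H :: "nat monoid" where H: "group H" "?T \<cong> H" using finite_group_iso_nat[OF grpT finT] by blast
  have "Coset.order H = p ^ n"
    using iso_same_order[OF _ , of _ ?T H] H(2) T(2) iso_same_card[OF H(2)] by (simp add: Coset.order_def)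
  moreover have "min_perm_degree H = p ^ i" using min_perm_degree_iso[OF grpT H(2)] upper lower by simp
  ultimately show ?thesis using H(1) by blast
qed

theorem theorem5:
  shows "(\<forall>(p::nat) (n::nat) (G :: ('a, 'b) monoid_scheme).
            prime p \<and> p \<ge> 3 \<and> group G \<and> Coset.order G = p ^ n \<and> \<not> comm_group G \<and>
            cyclic_group (G\<lparr>carrier := group_center G\<rparr>)
            \<longrightarrow> min_quasi_perm_degree G = min_perm_degree G \<and>
                min_perm_degree G \<in> {p ^ i | i. 2 \<le> i \<and> i \<le> n - 1}) \<and>
         (\<forall>n\<ge>3. \<forall>i\<in>{2..n - 1}. \<exists>p::nat. prime p \<and>
            (\<exists>H :: nat monoid. group H \<and> Coset.order H = p ^ n \<and> min_perm_degree H = p ^ i))"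
proof (intro conjI allI impI ballI)
  fix p n :: nat and G :: "('a, 'b) monoid_scheme"
  assume *: "prime p \<and> p \<ge> 3 \<and> group G \<and> Coset.order G = p ^ n \<and> \<not> comm_group G \<and>
    cyclic_group (G\<lparr>carrier := group_center G\<rparr>)"
  show "min_quasi_perm_degree G = min_perm_degree G"
    using p_group_cyclic_center_degrees[of p G n] * by blast
  show "min_perm_degree G \<in> {p ^ i | i. 2 \<le> i \<and> i \<le> n - 1}"
    using p_group_cyclic_center_degrees[of p G n] * by blast
next
  fix n i :: nat assume n: "n \<ge> 3" and i: "i \<in> {2..n - 1}"
  obtain p where p: "prime p" "n < p" using bigger_prime by blast
  show "\<exists>p::nat. prime p \<and> (\<exists>H :: nat monoid. group H \<and> Coset.order H = p ^ n \<and> min_perm_degree H = p ^ i)"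
    using p_group_prescribed_min_perm_degree[of i n p] p i by auto
qed

end
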